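(* Let $R>1$, $c>-2$, and set $$K=1+\frac c2+\sqrt{\Big(1+\frac c2\Big)^2+1+|c|}.$$ If $T\in\mathbb{DLA}_R(c)$, then $\overline{A_R}$ is a $K$-spectral set for $T$. If $T\in\mathbb{CDLA}_R(c)$, then $\overline{A_R}$ is a complete $K$-spectral set for $T$.
   Context: Operators act on complex Hilbert spaces $H$; $\mathcal{B}(H)$ denotes the bounded operators, scalars are identified with multiples of the identity, $\Re X=\frac12(X+X^* )$, and $X\ge0$ means $X$ is a positive operator. $\mathbb{D}$ is the open unit disk. The annulus is $A_R=\{z\in\mathbb{C}:1/R<|z|<R\}$. $\mathcal{A}(A_R)$ is the uniform algebra of continuous functions on $\overline{A_R}$ that are holomorphic on $A_R$, with the supremum norm. Each $f\in\mathcal{A}(A_R)$ has a Laurent expansion $f=\sum_{n\in\mathbb{Z}}a_nz^n$ on $A_R$. Class $\mathbb{DLA}_R(c)$: all bounded Hilbert space operators $T$ such that (i) $\sigma(T)\subset\overline{A_R}$, and (ii) $2\Re\big[(1-zT/R)^{-1}+(1-wT^{-1}/R)^{-1}\big]-2+c\ge0$ for all $z,w\in\mathbb{D}$. Double-layer potential kernel: $\partial A_R$ is positively oriented (outer circle counter-clockwise, inner circle clockwise), $s$ denotes arc length and $\sigma=\sigma(s)$ the arc-length parametrization. For $\sigma(s)\notin\sigma(T)$, $$\mu(\sigma(s),T)=\frac{1}{2\pi i}\Big(\sigma'(s)(\sigma(s)-T)^{-1}-\overline{\sigma'(s)}\,(\overline{\sigma(s)}-T^* )^{-1}\Big).$$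 Class $\mathbb{CDLA}_R(c)$ ($c>-2$): all $T\in\mathcal{B}(H)$ with $\sigma(T)\subset A_R$ such that the linear map $S_{R,c}:\mathcal{A}(A_R)\to\mathcal{B}(H)$, $$S_{R,c}\Big(f=\sum_{n\in\mathbb{Z}}a_nz^n\Big)=\frac{1}{2+c}\Big[\int_{\partial A_R}\mu(\sigma,T)f(\sigma)\,ds+ca_0\Big],$$ is completely contractive, i.e. for every $m\ge1$ the entrywise map $[f_{ij}]\mapsto[S_{R,c}(f_{ij})]$ from $M_m(\mathcal{A}(A_R))$ (norm $\sup_{z\in\overline{A_R}}\|[f_{ij}(z)]\|$) to $\mathcal{B}(H^{(m)})$, $H^{(m)}=H\oplus\cdots\oplus H$, is a contraction. For a compact set $X\subset\mathbb{C}$ and an operator $T$ with $\sigma(T)\subset X$, $X$ is a $K$-spectral set for $T$ if $\|f(T)\|\le K\sup_{z\in X}|f(z)|$ for every rational function $f$ with poles off $X$; $X$ is a complete $K$-spectral set for $T$ if the same inequality holds for all square matrices (of any size) $f=[f_{ij}]$ of rational functions with poles off $X$, where $f(T)=[f_{ij}(T)]$ and $|f(z)|$ is replaced by the operator norm of the matrix $f(z)$. *)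

theory Defs
  imports "HOL-Analysis.Analysis" "HOL-Computational_Algebra.Polynomial"
begin

section \<open>Complex Hilbert spaces\<close>

text \<open>
  The inner product is linear in its first argument. The axiom \<open>cinner_self\<close> says that the norm of
  the underlying real normed space is the one induced by the inner product; it also contains
  positive definiteness.
\<close>

class complex_inner = real_normed_vector +
  fixes scaleC :: "complex \<Rightarrow> 'a \<Rightarrow> 'a" (infixr "*\<^sub>C" 75)
    and cinner :: "'a \<Rightarrow> 'a \<Rightarrow> complex"
  assumes scaleC_add_right: "a *\<^sub>C (x + y) = a *\<^sub>C x + a *\<^sub>C y"
    and scaleC_add_left: "(a + b) *\<^sub>C x = a *\<^sub>C x + b *\<^sub>C x"
    and scaleC_scaleC: "a *\<^sub>C b *\<^sub>C x = (a * b) *\<^sub>C x"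
    and scaleR_scaleC: "r *\<^sub>R x = complex_of_real r *\<^sub>C x"
    and cinner_commute: "cinner y x = cnj (cinner x y)"
    and cinner_add_left: "cinner (x + y) z = cinner x z + cinner y z"
    and cinner_scaleC_left: "cinner (a *\<^sub>C x) y = a * cinner x y"
    and cinner_self: "cinner x x = complex_of_real ((norm x)\<^sup>2)"

class complex_hilbert = complex_inner + banach

lemma norm_scaleC: "norm (a *\<^sub>C x) = cmod a * norm (x :: 'a :: complex_inner)"
proof -
  have "cinner (a *\<^sub>C x) (a *\<^sub>C x) = a * cnj (a * cinner x x)"
    by (metis cinner_commute cinner_scaleC_left)
  also have "\<dots> = complex_of_real ((cmod a * norm x)\<^sup>2)"
    by (simp add: cinner_self power_mult_distrib flip: mult.assoc complex_norm_square)
  finally have "(norm (a *\<^sub>C x))\<^sup>2 = (cmod a * norm x)\<^sup>2"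
    unfolding cinner_self of_real_eq_iff .
  then show ?thesis
    by (simp add: power2_eq_iff_nonneg)
qed

lemma bounded_linear_scaleC: "bounded_linear (\<lambda>x :: 'a :: complex_inner. a *\<^sub>C x)"
proof (rule bounded_linear_intro[where K = "cmod a"])
  fix x y :: 'a and r :: real
  show "a *\<^sub>C (x + y) = a *\<^sub>C x + a *\<^sub>C y"
    by (rule scaleC_add_right)
  show "a *\<^sub>C r *\<^sub>R x = r *\<^sub>R a *\<^sub>C x"
    by (simp add: scaleR_scaleC scaleC_scaleC mult.commute)
  show "norm (a *\<^sub>C x) \<le> norm x * cmod a"
    by (simp add: norm_scaleC mult.commute)
qed


section \<open>Bounded operators\<close>

text \<open>
  The type \<open>'a \<Rightarrow>\<^sub>L 'a\<close> consists of the bounded real-linear maps, and its norm is the operator norm.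
  \<open>B(H)\<close> is the closed subspace of the complex-linear ones.
\<close>

definition bounded_ops :: "('a::complex_hilbert \<Rightarrow>\<^sub>L 'a) set" where
  "bounded_ops = {T. \<forall>a x. blinfun_apply T (a *\<^sub>C x) = a *\<^sub>C blinfun_apply T x}"

text \<open>
  The scalar \<open>a\<close> as an operator. The operator written \<open>a X\<close> in the mathematics is
  \<open>scalar_op a o\<^sub>L X\<close>.
\<close>

lift_definition scalar_op :: "complex \<Rightarrow> ('a::complex_hilbert \<Rightarrow>\<^sub>L 'a)" is "\<lambda>a x. a *\<^sub>C x"
  by (rule bounded_linear_scaleC)

definition op_invertible :: "('a::complex_hilbert \<Rightarrow>\<^sub>L 'a) \<Rightarrow> bool" where
  "op_invertible X \<longleftrightarrow> (\<exists>Y\<in>bounded_ops. Y o\<^sub>L X = id_blinfun \<and> X o\<^sub>L Y = id_blinfun)"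

definition op_inverse :: "('a::complex_hilbert \<Rightarrow>\<^sub>L 'a) \<Rightarrow> ('a \<Rightarrow>\<^sub>L 'a)" where
  "op_inverse X = (THE Y. Y \<in> bounded_ops \<and> Y o\<^sub>L X = id_blinfun \<and> X o\<^sub>L Y = id_blinfun)"

definition spectrum :: "('a::complex_hilbert \<Rightarrow>\<^sub>L 'a) \<Rightarrow> complex set" where
  "spectrum T = {z. \<not> op_invertible (scalar_op z - T)}"

definition adj :: "('a::complex_hilbert \<Rightarrow>\<^sub>L 'a) \<Rightarrow> ('a \<Rightarrow>\<^sub>L 'a)" where
  "adj X = (THE Y. Y \<in> bounded_ops \<and>
              (\<forall>x y. cinner (blinfun_apply X x) y = cinner x (blinfun_apply Y y)))"

definition op_Re :: "('a::complex_hilbert \<Rightarrow>\<^sub>L 'a) \<Rightarrow> ('a \<Rightarrow>\<^sub>L 'a)" where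
  "op_Re X = (1/2) *\<^sub>R (X + adj X)"

definition positive_op :: "('a::complex_hilbert \<Rightarrow>\<^sub>L 'a) \<Rightarrow> bool" where
  "positive_op X \<longleftrightarrow> X \<in> bounded_ops \<and>
     (\<forall>x. cinner (blinfun_apply X x) x \<in> \<real> \<and> 0 \<le> Re (cinner (blinfun_apply X x) x))"

text \<open>
  The norm of the operator matrix \<open>[A i j]\<close>, \<open>i, j < m\<close>, on the \<open>m\<close>-fold Hilbert space direct sum,
  whose vectors are the families \<open>x i\<close> with \<open>i < m\<close>. It is applied both to operators on \<open>H\<close> and,
  with \<open>H\<close> the complex numbers, to scalar matrices.
\<close>

definition mat_norm :: "nat \<Rightarrow> (nat \<Rightarrow> nat \<Rightarrow> 'a::real_normed_vector \<Rightarrow> 'a) \<Rightarrow> real" where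
  "mat_norm m A = Sup {sqrt (\<Sum>i<m. (norm (\<Sum>j<m. A i j (x j)))\<^sup>2) | x. (\<Sum>j<m. (norm (x j))\<^sup>2) \<le> 1}"

definition op_mat_norm :: "nat \<Rightarrow> (nat \<Rightarrow> nat \<Rightarrow> 'a::complex_hilbert \<Rightarrow>\<^sub>L 'a) \<Rightarrow> real" where
  "op_mat_norm m A = mat_norm m (\<lambda>i j. blinfun_apply (A i j))"

definition scalar_mat_norm :: "nat \<Rightarrow> (nat \<Rightarrow> nat \<Rightarrow> complex) \<Rightarrow> real" where
  "scalar_mat_norm m A = mat_norm m (\<lambda>i j x. A i j * x)"


section \<open>Spectral sets\<close>

text \<open>
  A rational function with poles off \<open>X\<close> is given by a pair of polynomials \<open>p\<close>, \<open>q\<close> such that \<open>q\<close>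
  has no zero in \<open>X\<close>; it is then \<open>p / q\<close>, and its value at \<open>T\<close> is \<open>p(T) q(T)\<close> with the second
  factor inverted. Neither value depends on the choice of the pair.
\<close>

definition op_poly :: "complex poly \<Rightarrow> ('a::complex_hilbert \<Rightarrow>\<^sub>L 'a) \<Rightarrow> ('a \<Rightarrow>\<^sub>L 'a)" where
  "op_poly p T = (\<Sum>n\<le>degree p. scalar_op (coeff p n) o\<^sub>L (((o\<^sub>L) T) ^^ n) id_blinfun)"

definition op_rat :: "complex poly \<Rightarrow> complex poly \<Rightarrow> ('a::complex_hilbert \<Rightarrow>\<^sub>L 'a) \<Rightarrow> ('a \<Rightarrow>\<^sub>L 'a)" where
  "op_rat p q T = op_poly p T o\<^sub>L op_inverse (op_poly q T)"

definition K_spectral_set :: "real \<Rightarrow> complex set \<Rightarrow> ('a::complex_hilbert \<Rightarrow>\<^sub>L 'a) \<Rightarrow> bool" where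
  "K_spectral_set K X T \<longleftrightarrow> compact X \<and> T \<in> bounded_ops \<and> spectrum T \<subseteq> X \<and>
     (\<forall>p q. (\<forall>z\<in>X. poly q z \<noteq> 0) \<longrightarrow>
        norm (op_rat p q T) \<le> K * (SUP z\<in>X. cmod (poly p z / poly q z)))"

definition complete_K_spectral_set :: "real \<Rightarrow> complex set \<Rightarrow> ('a::complex_hilbert \<Rightarrow>\<^sub>L 'a) \<Rightarrow> bool" where
  "complete_K_spectral_set K X T \<longleftrightarrow> compact X \<and> T \<in> bounded_ops \<and> spectrum T \<subseteq> X \<and>
     (\<forall>m\<ge>1. \<forall>p q. (\<forall>i<m. \<forall>j<m. \<forall>z\<in>X. poly (q i j) z \<noteq> 0) \<longrightarrow>
        op_mat_norm m (\<lambda>i j. op_rat (p i j) (q i j) T)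
          \<le> K * (SUP z\<in>X. scalar_mat_norm m (\<lambda>i j. poly (p i j) z / poly (q i j) z)))"


section \<open>The annulus and its function algebra\<close>

definition annulus :: "real \<Rightarrow> complex set" where
  "annulus R = {z. 1 / R < cmod z \<and> cmod z < R}"

text \<open>
  Members of the algebra are represented by functions on the whole plane; only their values on the
  closed annulus are ever used.
\<close>

definition annulus_algebra :: "real \<Rightarrow> (complex \<Rightarrow> complex) set" where
  "annulus_algebra R = {f. continuous_on (closure (annulus R)) f \<and> f holomorphic_on annulus R}"

definition laurent_coeff :: "real \<Rightarrow> (complex \<Rightarrow> complex) \<Rightarrow> int \<Rightarrow> complex" where
  "laurent_coeff R f =
     (THE a. \<forall>z\<in>annulus R. ((\<lambda>n::int. a n * z powi n) has_sum f z) UNIV)"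


section \<open>The two operator classes\<close>

definition DLA :: "real \<Rightarrow> real \<Rightarrow> ('a::complex_hilbert \<Rightarrow>\<^sub>L 'a) set" where
  "DLA R c = {T \<in> bounded_ops. spectrum T \<subseteq> closure (annulus R) \<and>
     (\<forall>z\<in>ball 0 1. \<forall>w\<in>ball 0 1.
        positive_op
          (2 *\<^sub>R op_Re (op_inverse (id_blinfun - (scalar_op (z / of_real R) o\<^sub>L T))
                      + op_inverse (id_blinfun - (scalar_op (w / of_real R) o\<^sub>L op_inverse T)))
           - scalar_op 2 + scalar_op (of_real c)))}"

text \<open>
  Arc-length parametrizations of the two boundary circles: the outer one runs counter-clockwise
  for \<open>0 \<le> s \<le> 2 pi R\<close>, the inner one clockwise for \<open>0 \<le> s \<le> 2 pi / R\<close>.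
\<close>

definition outer_circle :: "real \<Rightarrow> real \<Rightarrow> complex" where
  "outer_circle R s = of_real R * cis (s / R)"

definition inner_circle :: "real \<Rightarrow> real \<Rightarrow> complex" where
  "inner_circle R s = of_real (1 / R) * cis (- (s * R))"

definition dl_kernel :: "(real \<Rightarrow> complex) \<Rightarrow> ('a::complex_hilbert \<Rightarrow>\<^sub>L 'a) \<Rightarrow> real \<Rightarrow> ('a \<Rightarrow>\<^sub>L 'a)" where
  "dl_kernel \<sigma> T s =
     scalar_op (1 / (2 * of_real pi * \<i>)) o\<^sub>L
       ((scalar_op (vector_derivative \<sigma> (at s)) o\<^sub>L op_inverse (scalar_op (\<sigma> s) - T))
        - (scalar_op (cnj (vector_derivative \<sigma> (at s))) o\<^sub>L op_inverse (scalar_op (cnj (\<sigma> s)) - adj T)))"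

definition dl_integral :: "real \<Rightarrow> ('a::complex_hilbert \<Rightarrow>\<^sub>L 'a) \<Rightarrow> (complex \<Rightarrow> complex) \<Rightarrow> ('a \<Rightarrow>\<^sub>L 'a)" where
  "dl_integral R T f =
     integral {0..2 * pi * R} (\<lambda>s. dl_kernel (outer_circle R) T s o\<^sub>L scalar_op (f (outer_circle R s)))
   + integral {0..2 * pi / R} (\<lambda>s. dl_kernel (inner_circle R) T s o\<^sub>L scalar_op (f (inner_circle R s)))"

definition S_map :: "real \<Rightarrow> real \<Rightarrow> ('a::complex_hilbert \<Rightarrow>\<^sub>L 'a) \<Rightarrow> (complex \<Rightarrow> complex) \<Rightarrow> ('a \<Rightarrow>\<^sub>L 'a)" where
  "S_map R c T f =
     (1 / (2 + c)) *\<^sub>R (dl_integral R T f + scalar_op (of_real c * laurent_coeff R f 0))"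

definition CDLA :: "real \<Rightarrow> real \<Rightarrow> ('a::complex_hilbert \<Rightarrow>\<^sub>L 'a) set" where
  "CDLA R c = {T \<in> bounded_ops. spectrum T \<subseteq> annulus R \<and>
     (\<forall>m\<ge>1. \<forall>f. (\<forall>i<m. \<forall>j<m. f i j \<in> annulus_algebra R) \<longrightarrow>
        op_mat_norm m (\<lambda>i j. S_map R c T (f i j))
          \<le> (SUP z\<in>closure (annulus R). scalar_mat_norm m (\<lambda>i j. f i j z)))}"

end

theory Submission
  imports Defs "HOL-Complex_Analysis.Complex_Analysis" "HOL-Library.Poly_Mapping"
    "HOL-Computational_Algebra.Fundamental_Theorem_Algebra"
begin

text \<open>
  The proof is carried out on Laurent polynomials \<open>f = \<Sum> a\<^sub>n z\<^sup>n\<close>, for which \<open>f(T)\<close> is a finite sum, and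
  extended to rational functions at the end. The second half of the double layer kernel produces the
  adjoint of \<open>g(T)\<close>, where \<open>g\<close> is the Cauchy integral of \<open>cnj f\<close> over the boundary; so
  \<open>(2 + c) S(f) = f(T) + g(T)\<^sup>* + c a\<^sub>0\<close> (\<open>S_map_laurent\<close>). For the annulus \<open>g\<close> is again a Laurent
  polynomial. It is, after a reflection, a Poisson integral of \<open>cnj f\<close>, and hence
  \<open>sup |g| \<le> sup |f|\<close> (\<open>cmod_cauchy_conj_le\<close>).

  Suppose that \<open>S\<close> is contractive on matrices of size \<open>m\<close>, and let \<open>M\<close> be the least constant with
  \<open>\<parallel>F(T)\<parallel> \<le> M\<close> whenever \<open>sup \<parallel>F\<parallel> \<le> 1\<close>. It is finite because the powers of \<open>T\<close> and \<open>T\<^sup>-\<^sup>1\<close> grow more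
  slowly than those of \<open>R\<close> (\<open>laurent_calculus_bound_exists\<close>). With \<open>A = F(T)\<close> the formula for \<open>S\<close>
  reads \<open>A\<^sup>* = (2 + c) S(F)\<^sup>* - H(T)\<close> with a matrix \<open>H\<close> of Laurent polynomials, \<open>sup \<parallel>H\<parallel> \<le> 1 + |c|\<close>.
  Therefore \<open>A A\<^sup>* A = (2 + c) A S(F)\<^sup>* A - (F H F)(T)\<close>, and since \<open>\<parallel>A\<parallel>\<^sup>4 \<le> \<parallel>A A\<^sup>* A\<parallel> \<parallel>A\<parallel>\<close> this gives
  \<open>M\<^sup>4 \<le> (2 + c) M\<^sup>3 + (1 + |c|) M\<^sup>2\<close>, that is \<open>M \<le> K\<close> (\<open>laurent_calculus_bound_K\<close>).

  For the second class contractivity of \<open>S\<close> for all \<open>m\<close> is the definition. For the first class it has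
  to be shown for \<open>m = 1\<close>. The operator belongs to the class for every \<open>R' > R\<close> too, and the spectrum
  lies in the open annulus of \<open>R'\<close>. There the resolvent condition makes \<open>S\<close> positive, in the sense
  that \<open>Re f \<ge> 0\<close> implies \<open>Re S(f) \<ge> 0\<close> (\<open>laurent_S_positive\<close>). A unital map which is positive in this
  sense is contractive: apply positivity to the Fejer sums of \<open>1 + 2 (\<zeta> f) + 2 (\<zeta> f)\<^sup>2 + \<dots>\<close> with
  \<open>|\<zeta>| = 1\<close> and average over \<open>\<zeta>\<close> (\<open>contraction_of_fejer_positive\<close>). Finally \<open>R'\<close> tends to \<open>R\<close>.
\<close>

section \<open>Inner products and bounded operators\<close>

lemma cinner_add_right: "cinner x (y + z) = cinner x y + cinner (x :: 'a :: complex_inner) z"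
  by (metis cinner_commute cinner_add_left complex_cnj_add)

lemma cinner_scaleC_right: "cinner x (a *\<^sub>C y) = cnj a * cinner (x :: 'a :: complex_inner) y"
  by (metis cinner_commute cinner_scaleC_left complex_cnj_mult)

lemma cinner_scaleR_left: "cinner (r *\<^sub>R x) y = of_real r * cinner (x :: 'a :: complex_inner) y"
  by (simp add: scaleR_scaleC cinner_scaleC_left)

lemma cinner_scaleR_right: "cinner x (r *\<^sub>R y) = of_real r * cinner (x :: 'a :: complex_inner) y"
  by (simp add: scaleR_scaleC cinner_scaleC_right)

lemma additive_cinner_left: "Modules.additive (\<lambda>x. cinner x (y :: 'a :: complex_inner))"
  by standard (rule cinner_add_left)

lemma additive_cinner_right: "Modules.additive (\<lambda>y. cinner (x :: 'a :: complex_inner) y)"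
  by standard (rule cinner_add_right)

lemmas cinner_zero_left [simp] = Modules.additive.zero[OF additive_cinner_left]
lemmas cinner_zero_right [simp] = Modules.additive.zero[OF additive_cinner_right]
lemmas cinner_minus_right = Modules.additive.minus[OF additive_cinner_right]
lemmas cinner_diff_left = Modules.additive.diff[OF additive_cinner_left]
lemmas cinner_diff_right = Modules.additive.diff[OF additive_cinner_right]
lemmas cinner_sum_left = Modules.additive.sum[OF additive_cinner_left]
lemmas cinner_sum_right = Modules.additive.sum[OF additive_cinner_right]

lemma scaleC_one [simp]: "1 *\<^sub>C x = (x :: 'a :: complex_inner)"
  by (metis scaleR_scaleC scaleR_one of_real_1)

lemma scaleC_zero_left [simp]: "0 *\<^sub>C x = (0 :: 'a :: complex_inner)"
  by (metis scaleR_scaleC scaleR_zero_left of_real_0)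

lemma Re_cinner_self: "Re (cinner x x) = (norm (x :: 'a :: complex_inner))\<^sup>2"
  by (simp add: cinner_self)

lemma cmod_eq_Re_rotation: "\<exists>u. cmod u = 1 \<and> u * z = of_real (cmod z)"
proof (cases "z = 0")
  case True
  then show ?thesis by (intro exI[of _ 1]) auto
next
  case False
  then show ?thesis
    by (intro exI[of _ "cnj z / of_real (cmod z)"])
      (auto simp: norm_divide field_simps complex_norm_square[symmetric] power2_eq_square)
qed

lemma Re_cinner_commute: "Re (cinner y x) = Re (cinner x (y :: 'a :: complex_inner))"
  by (subst cinner_commute) simp

lemma norm_add_squared:
  "(norm (x + y))\<^sup>2 = (norm x)\<^sup>2 + (norm (y :: 'a :: complex_inner))\<^sup>2 + 2 * Re (cinner x y)"
  by (simp add: Re_cinner_self[symmetric] cinner_add_left cinner_add_right Re_cinner_commute[of x y])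

lemma norm_diff_squared:
  "(norm (x - y))\<^sup>2 = (norm x)\<^sup>2 + (norm (y :: 'a :: complex_inner))\<^sup>2 - 2 * Re (cinner x y)"
  using norm_add_squared[of x "- y"] by (simp add: cinner_minus_right)

lemma cauchy_schwarz_half: "cmod (cinner x y) \<le> ((norm x)\<^sup>2 + (norm (y :: 'a :: complex_inner))\<^sup>2) / 2"
proof -
  obtain u where u: "cmod u = 1" "u * cinner x y = of_real (cmod (cinner x y))"
    using cmod_eq_Re_rotation by blast
  have "0 \<le> (norm (u *\<^sub>C x - y))\<^sup>2" by simp
  also have "\<dots> = (norm x)\<^sup>2 + (norm y)\<^sup>2 - 2 * cmod (cinner x y)"
    by (simp add: norm_diff_squared cinner_scaleC_left norm_scaleC u del: times_complex.sel)
  finally show ?thesis by simp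
qed

text \<open>A bound by the arithmetic mean becomes one by the geometric mean after rescaling the two
  arguments against each other.\<close>

lemma le_mult_from_le_half_squares:
  fixes a b v B :: real
  assumes le: "\<And>t. t > 0 \<Longrightarrow> v \<le> B * ((t * a)\<^sup>2 + (b / t)\<^sup>2) / 2" and "a \<ge> 0" "b \<ge> 0" "B \<ge> 0"
  shows "v \<le> B * (a * b)"
proof (rule field_le_epsilon)
  fix e :: real assume "e > 0"
  \<comment> \<open>\<open>t\<^sup>2 = b / a\<close> would balance the two squares; \<open>d\<close> keeps both terms of the quotient positive.\<close>
  define d where "d = min 1 (e / (B * (a + b + 1) + 1))"
  have d: "d > 0" "d \<le> 1" "B * (d * (a + b + 1)) \<le> e"
  proof -
    have p: "B * (a + b + 1) + 1 > 0" using assms by (simp add: add_nonneg_pos)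
    then show "d > 0" "d \<le> 1" using \<open>e > 0\<close> by (auto simp: d_def)
    have "d * (B * (a + b + 1)) \<le> d * (B * (a + b + 1) + 1)"
      using \<open>d > 0\<close> by (simp add: mult_left_mono)
    also have "\<dots> \<le> e / (B * (a + b + 1) + 1) * (B * (a + b + 1) + 1)"
      using p by (intro mult_right_mono) (auto simp: d_def)
    also have "\<dots> = e" using p by simp
    finally show "B * (d * (a + b + 1)) \<le> e" by (simp add: algebra_simps)
  qed
  define t where "t = sqrt ((b + d) / (a + d))"
  have t: "t > 0" "t\<^sup>2 = (b + d) / (a + d)" using assms d by (auto simp: t_def)
  have "(t * a)\<^sup>2 \<le> (a + d) * (b + d)"
  proof -
    have "(t * a)\<^sup>2 \<le> (t * (a + d))\<^sup>2"
      using assms d t by (intro power_mono mult_left_mono) auto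
    also have "\<dots> = (a + d) * (b + d)" using d assms unfolding power_mult_distrib t(2) by (simp add: power2_eq_square)
    finally show ?thesis .
  qed
  moreover have "(b / t)\<^sup>2 \<le> (a + d) * (b + d)"
  proof -
    have "(b / t)\<^sup>2 \<le> ((b + d) / t)\<^sup>2"
      using assms d t by (intro power_mono divide_right_mono) auto
    also have "\<dots> = (a + d) * (b + d)" using d assms unfolding power_divide t(2) by (simp add: power2_eq_square)
    finally show ?thesis .
  qed
  ultimately have "((t * a)\<^sup>2 + (b / t)\<^sup>2) / 2 \<le> (a + d) * (b + d)" by simp
  then have "B * (((t * a)\<^sup>2 + (b / t)\<^sup>2) / 2) \<le> B * ((a + d) * (b + d))"
    using \<open>B \<ge> 0\<close> by (rule mult_left_mono)
  moreover have "v \<le> B * (((t * a)\<^sup>2 + (b / t)\<^sup>2) / 2)" using le[OF t(1)] by simp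
  moreover have "B * ((a + d) * (b + d)) \<le> B * (a * b) + e"
  proof -
    have "d * d \<le> d" using d by (simp add: mult_left_le)
    then have "(a + d) * (b + d) \<le> a * b + d * (a + b + 1)" by (simp add: algebra_simps)
    then have "B * ((a + d) * (b + d)) \<le> B * (a * b + d * (a + b + 1))"
      using \<open>B \<ge> 0\<close> by (rule mult_left_mono)
    then show ?thesis using d by (simp add: distrib_left)
  qed
  ultimately show "v \<le> B * (a * b) + e" by linarith
qed

lemma sesquilinear_le_of_le_half_squares:
  fixes b :: "'a :: complex_inner \<Rightarrow> 'a \<Rightarrow> complex"
  assumes le: "\<And>x y. cmod (b x y) \<le> B * ((norm x)\<^sup>2 + (norm y)\<^sup>2) / 2" and "B \<ge> 0"
    and "\<And>t x y. b (t *\<^sub>R x) y = of_real t * b x y" "\<And>t x y. b x (t *\<^sub>R y) = of_real t * b x y"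
  shows "cmod (b x y) \<le> B * (norm x * norm y)"
proof (rule le_mult_from_le_half_squares)
  fix t :: real assume "t > 0"
  then have "cmod (b x y) = cmod (b (t *\<^sub>R x) ((1 / t) *\<^sub>R y))"
    by (simp add: assms)
  also have "\<dots> \<le> B * ((norm (t *\<^sub>R x))\<^sup>2 + (norm ((1 / t) *\<^sub>R y))\<^sup>2) / 2"
    by (rule le)
  finally show "cmod (b x y) \<le> B * ((t * norm x)\<^sup>2 + (norm y / t)\<^sup>2) / 2"
    using \<open>t > 0\<close> by simp
qed (use assms in auto)

lemma cauchy_schwarz: "cmod (cinner x y) \<le> norm x * norm (y :: 'a :: complex_inner)"
proof -
  have "cmod (cinner x y) \<le> 1 * (norm x * norm y)"
    by (rule sesquilinear_le_of_le_half_squares)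
      (use cauchy_schwarz_half in \<open>auto simp: cinner_scaleR_left cinner_scaleR_right\<close>)
  then show ?thesis by simp
qed

lemma bounded_linear_cinner_left: "bounded_linear (\<lambda>x. cinner x (y :: 'a :: complex_inner))"
  by (rule bounded_linear_intro[where K = "norm y"])
    (auto simp: cinner_add_left cinner_scaleR_left scaleR_conv_of_real cauchy_schwarz)

lemma cinner_right_eqI: "(\<And>x. cinner x y = cinner x z) \<Longrightarrow> y = (z :: 'a :: complex_inner)"
proof -
  assume "\<And>x. cinner x y = cinner x z"
  then have "cinner (y - z) (y - z) = 0" by (simp add: cinner_diff_right)
  then show "y = z" by (simp add: cinner_self)
qed

lemma parallelogram:
  "(norm (x - y))\<^sup>2 = 2 * (norm x)\<^sup>2 + 2 * (norm (y :: 'a :: complex_inner))\<^sup>2 - (norm (x + y))\<^sup>2"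
  by (simp add: norm_add_squared norm_diff_squared)

text \<open>The representing vector minimises \<open>\<parallel>x\<parallel>\<^sup>2 - 2 Re (\<phi> x)\<close>; by the parallelogram identity
  minimising sequences are Cauchy, so the minimum is attained, and the first variation vanishes
  there.\<close>

lemma riesz_representation:
  fixes \<phi> :: "'a :: complex_hilbert \<Rightarrow> complex"
  assumes bl: "bounded_linear \<phi>" and cl: "\<And>a x. \<phi> (a *\<^sub>C x) = a * \<phi> x"
  shows "\<exists>y. \<forall>x. \<phi> x = cinner x y"
proof -
  interpret \<phi>: bounded_linear \<phi> by (rule bl)
  obtain C where C: "\<And>x. cmod (\<phi> x) \<le> norm x * C" "C \<ge> 0" using \<phi>.nonneg_bounded by blast
  define J where "J x = (norm x)\<^sup>2 - 2 * Re (\<phi> x)" for x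
  have Jlow: "- C\<^sup>2 \<le> J x" for x
  proof -
    have "Re (\<phi> x) \<le> norm x * C" using C(1)[of x] complex_Re_le_cmod[of "\<phi> x"] by linarith
    moreover have "0 \<le> (norm x - C)\<^sup>2" by simp
    ultimately show ?thesis by (simp add: J_def power2_diff)
  qed
  define d where "d = Inf (range J)"
  have bdd: "bdd_below (range J)" using Jlow by (auto intro!: bdd_belowI)
  have dle: "d \<le> J x" for x unfolding d_def using bdd by (intro cInf_lower) auto
  have "\<exists>x. J x < d + 1 / real (Suc n)" for n
  proof -
    have "d < d + 1 / real (Suc n)" by simp
    then show ?thesis unfolding d_def using bdd by (subst (asm) cInf_less_iff) auto
  qed
  then obtain X where X: "\<And>n. J (X n) < d + 1 / real (Suc n)" by metis
  have J_mid: "(norm (x - y))\<^sup>2 = 2 * J x + 2 * J y - 4 * J ((1 / 2) *\<^sub>R (x + y))" for x y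
  proof -
    have "Re (\<phi> ((1 / 2) *\<^sub>R (x + y))) = (Re (\<phi> x) + Re (\<phi> y)) / 2"
      unfolding \<phi>.scaleR \<phi>.add by simp
    then show ?thesis by (simp add: J_def parallelogram power_divide)
  qed
  have X_close: "(norm (X m - X n))\<^sup>2 \<le> 2 / real (Suc m) + 2 / real (Suc n)" for m n
    using J_mid[of "X m" "X n"] X[of m] X[of n] dle[of "(1 / 2) *\<^sub>R (X m + X n)"] by simp
  have "Cauchy X"
  proof (rule CauchyI)
    fix e :: real assume "e > 0"
    then obtain N where N: "4 / e\<^sup>2 < real N" using reals_Archimedean2 by blast
    have "norm (X m - X n) < e" if "m \<ge> N" "n \<ge> N" for m n
    proof -
      have N0: "real N > 0" using N \<open>e > 0\<close> by (meson divide_pos_pos less_trans zero_less_numeral zero_less_power)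
      have "2 / real (Suc m) + 2 / real (Suc n) \<le> 2 / real N + 2 / real N"
        using that N0 by (intro add_mono divide_left_mono) auto
      also have "\<dots> = 4 / real N" by simp
      also have "\<dots> < e\<^sup>2" using N N0 \<open>e > 0\<close> by (simp add: field_simps)
      finally have "(norm (X m - X n))\<^sup>2 < e\<^sup>2" using X_close[of m n] by linarith
      then show ?thesis using \<open>e > 0\<close> by (simp add: power_less_imp_less_base)
    qed
    then show "\<exists>M. \<forall>m\<ge>M. \<forall>n\<ge>M. norm (X m - X n) < e" by blast
  qed
  then obtain y where y: "X \<longlonglongrightarrow> y" using Cauchy_convergent convergent_def by blast
  have "(\<lambda>n. J (X n)) \<longlonglongrightarrow> J y" unfolding J_def
    by (intro tendsto_intros y \<phi>.tendsto)
  moreover have "(\<lambda>n. d + 1 / real (Suc n)) \<longlonglongrightarrow> d + 0"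
    by (intro tendsto_intros LIMSEQ_inverse_real_of_nat[unfolded inverse_eq_divide])
  ultimately have "J y \<le> d + 0" by (rule LIMSEQ_le) (use X less_imp_le in blast)
  then have Jmin: "J y \<le> J x" for x using dle[of x] by simp
  have re: "Re (\<phi> h) = Re (cinner h y)" for h
  proof (rule ccontr)
    define q where "q = Re (cinner h y) - Re (\<phi> h)"
    assume "Re (\<phi> h) \<noteq> Re (cinner h y)"
    then have q: "q \<noteq> 0" by (simp add: q_def)
    have exp: "J (y + t *\<^sub>R h) = J y + 2 * t * q + t\<^sup>2 * (norm h)\<^sup>2" for t
      by (simp add: J_def q_def norm_add_squared cinner_scaleR_right Re_cinner_commute[of y h]
          \<phi>.add \<phi>.scaleR power_mult_distrib algebra_simps)
    \<comment> \<open>moving from \<open>y\<close> by a small multiple of \<open>h\<close>, of sign opposite to \<open>q\<close>, would decrease \<open>J\<close>\<close>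
    define n where "n = (norm h)\<^sup>2 + 1"
    have n: "n > 0" "(norm h)\<^sup>2 < n" unfolding n_def by (auto simp: add_nonneg_pos)
    have "0 \<le> 2 * (- q / n) * q + (- q / n)\<^sup>2 * (norm h)\<^sup>2"
      using Jmin[of "y + (- q / n) *\<^sub>R h"] unfolding exp by simp
    also have "\<dots> \<le> 2 * (- q / n) * q + (- q / n)\<^sup>2 * n"
      using n by (intro add_left_mono mult_left_mono) auto
    also have "\<dots> = - (q\<^sup>2 / n)" using n by (simp add: field_simps power2_eq_square)
    also have "\<dots> < 0" using n q by simp
    finally show False by simp
  qed
  have "\<phi> h = cinner h y" for h
  proof (rule complex_eqI)
    show "Re (\<phi> h) = Re (cinner h y)" by (rule re)
    show "Im (\<phi> h) = Im (cinner h y)" using re[of "\<i> *\<^sub>C h"] by (simp add: cl cinner_scaleC_left)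
  qed
  then show ?thesis by blast
qed

lemma op_scaleC: "X \<in> bounded_ops \<Longrightarrow> X (a *\<^sub>C x) = a *\<^sub>C X x"
  by (simp add: bounded_ops_def)

lemma scaleC_zero_right [simp]: "a *\<^sub>C (0 :: 'a :: complex_inner) = 0"
  by (metis bounded_linear_scaleC linear_simps(3))

lemma scaleC_minus_right: "a *\<^sub>C (- x) = - (a *\<^sub>C (x :: 'a :: complex_inner))"
  by (metis bounded_linear_scaleC linear_simps(4))

lemma scaleC_diff_right: "a *\<^sub>C (x - y) = a *\<^sub>C x - a *\<^sub>C (y :: 'a :: complex_inner)"
  by (metis bounded_linear_scaleC linear_simps(2))

lemma scaleC_sum_right: "a *\<^sub>C (\<Sum>i\<in>I. x i) = (\<Sum>i\<in>I. a *\<^sub>C (x i :: 'a :: complex_inner))"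
  using bounded_linear_scaleC by (rule bounded_linear.linear[THEN linear_sum])

lemma ex1_adjoint:
  fixes X :: "'a :: complex_hilbert \<Rightarrow>\<^sub>L 'a"
  assumes "X \<in> bounded_ops"
  shows "\<exists>!Y. Y \<in> bounded_ops \<and> (\<forall>x y. cinner (X x) y = cinner x (blinfun_apply Y y))"
proof -
  have "\<exists>z. \<forall>x. cinner (X x) y = cinner x z" for y
    by (rule riesz_representation)
      (use assms bounded_linear_compose[OF bounded_linear_cinner_left blinfun.bounded_linear_right]
        in \<open>auto simp: op_scaleC cinner_scaleC_left o_def\<close>)
  then obtain g where g: "\<And>x y. cinner (X x) y = cinner x (g y)" by metis
  have g_scaleC: "g (a *\<^sub>C y) = a *\<^sub>C g y" for a y
    by (rule cinner_right_eqI) (simp add: g[symmetric] cinner_scaleC_right)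
  have "bounded_linear g"
  proof (rule bounded_linear_intro[where K = "norm X"])
    show "g (x + y) = g x + g y" for x y
      by (rule cinner_right_eqI) (simp add: g[symmetric] cinner_add_right)
    show "g (r *\<^sub>R y) = r *\<^sub>R g y" for r y
      by (simp add: scaleR_scaleC g_scaleC)
    show "norm (g y) \<le> norm y * norm X" for y
    proof -
      have "(norm (g y))\<^sup>2 = cmod (cinner (X (g y)) y)" by (simp add: g cinner_self norm_power)
      also have "\<dots> \<le> norm (X (g y)) * norm y" by (rule cauchy_schwarz)
      also have "\<dots> \<le> (norm X * norm (g y)) * norm y"
        by (intro mult_right_mono norm_blinfun) auto
      finally have "norm (g y) * norm (g y) \<le> norm (g y) * (norm y * norm X)"
        by (simp add: power2_eq_square mult_ac)
      then show ?thesis by (cases "g y = 0") (auto simp: mult_le_cancel_left)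
    qed
  qed
  then have "Blinfun g \<in> bounded_ops" "\<forall>x y. cinner (X x) y = cinner x (Blinfun g y)"
    by (auto simp: bounded_ops_def bounded_linear_Blinfun_apply g_scaleC g)
  moreover have "Y = Z" if "\<forall>x y. cinner (X x) y = cinner x (blinfun_apply Y y)"
    "\<forall>x y. cinner (X x) y = cinner x (blinfun_apply Z y)" for Y Z
    using that by (intro blinfun_eqI cinner_right_eqI) auto
  ultimately show ?thesis by metis
qed

lemma
  assumes "X \<in> bounded_ops"
  shows adj_in_bounded_ops: "adj X \<in> bounded_ops"
    and cinner_adj_right: "cinner x (adj X y) = cinner (X x) y"
proof -
  have *: "adj X \<in> bounded_ops \<and> (\<forall>x y. cinner (X x) y = cinner x (adj X y))"
    unfolding adj_def by (rule theI'[OF ex1_adjoint[OF assms]])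
  then show "adj X \<in> bounded_ops" by (rule conjunct1)
  show "cinner x (adj X y) = cinner (X x) y" using *[THEN conjunct2, rule_format, of x y] by (rule sym)
qed

lemma cinner_adj_left: "X \<in> bounded_ops \<Longrightarrow> cinner (adj X x) y = cinner x (X y)"
  by (metis cinner_adj_right cinner_commute)

lemma adj_eqI:
  assumes "X \<in> bounded_ops" "\<And>x y. cinner (X x) y = cinner x (blinfun_apply Y y)"
  shows "adj X = Y"
  by (intro blinfun_eqI cinner_right_eqI) (simp add: cinner_adj_right assms)

lemma scalar_op_apply [simp]: "scalar_op a x = a *\<^sub>C x"
  by (simp add: scalar_op.rep_eq)

lemma bounded_ops_intros [simp, intro]:
  "scalar_op a \<in> bounded_ops" "id_blinfun \<in> bounded_ops" "0 \<in> bounded_ops"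
  "X \<in> bounded_ops \<Longrightarrow> Y \<in> bounded_ops \<Longrightarrow> X + Y \<in> bounded_ops"
  "X \<in> bounded_ops \<Longrightarrow> Y \<in> bounded_ops \<Longrightarrow> X - Y \<in> bounded_ops"
  "X \<in> bounded_ops \<Longrightarrow> Y \<in> bounded_ops \<Longrightarrow> X o\<^sub>L Y \<in> bounded_ops"
  "X \<in> bounded_ops \<Longrightarrow> r *\<^sub>R X \<in> bounded_ops"
  "(\<And>i. i \<in> I \<Longrightarrow> F i \<in> bounded_ops) \<Longrightarrow> (\<Sum>i\<in>I. F i) \<in> bounded_ops"
  by (auto simp: bounded_ops_def blinfun.bilinear_simps scaleC_add_right scaleC_diff_right
      scaleC_scaleC mult.commute scaleR_scaleC blinfun.sum_left scaleC_sum_right)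

lemma adj_add: "X \<in> bounded_ops \<Longrightarrow> Y \<in> bounded_ops \<Longrightarrow> adj (X + Y) = adj X + adj Y"
  by (rule adj_eqI) (auto simp: cinner_adj_right blinfun.bilinear_simps cinner_add_left cinner_add_right)

lemma adj_diff: "X \<in> bounded_ops \<Longrightarrow> Y \<in> bounded_ops \<Longrightarrow> adj (X - Y) = adj X - adj Y"
  by (rule adj_eqI) (auto simp: cinner_adj_right blinfun.bilinear_simps cinner_diff_left cinner_diff_right)

lemma adj_compose: "X \<in> bounded_ops \<Longrightarrow> Y \<in> bounded_ops \<Longrightarrow> adj (X o\<^sub>L Y) = adj Y o\<^sub>L adj X"
  by (rule adj_eqI) (auto simp: cinner_adj_right)

lemma adj_scaleR: "X \<in> bounded_ops \<Longrightarrow> adj (r *\<^sub>R X) = r *\<^sub>R adj X"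
  by (rule adj_eqI)
    (auto simp: cinner_adj_right blinfun.bilinear_simps cinner_scaleR_left cinner_scaleR_right)

lemma adj_scalar_op: "adj (scalar_op a) = scalar_op (cnj a)"
  by (rule adj_eqI) (auto simp: cinner_scaleC_left cinner_scaleC_right)

lemma adj_id: "adj (id_blinfun :: 'a :: complex_hilbert \<Rightarrow>\<^sub>L 'a) = id_blinfun"
  by (rule adj_eqI) auto

lemmas adj_simps = adj_add adj_diff adj_compose adj_scaleR adj_scalar_op adj_id

lemma adj_zero [simp]: "adj (0 :: 'a :: complex_hilbert \<Rightarrow>\<^sub>L 'a) = 0"
  by (rule adj_eqI) auto

lemma adj_adj: "X \<in> bounded_ops \<Longrightarrow> adj (adj X) = X"
  by (rule adj_eqI) (auto simp: adj_in_bounded_ops cinner_adj_left)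

lemma adj_sum:
  "(\<And>i. i \<in> I \<Longrightarrow> F i \<in> bounded_ops) \<Longrightarrow> adj (\<Sum>i\<in>I. F i) = (\<Sum>i\<in>I. adj (F i))"
  by (induction I rule: infinite_finite_induct) (auto simp: adj_simps)

lemma norm_le_of_cinner_bound:
  fixes X :: "'a::complex_hilbert \<Rightarrow>\<^sub>L 'a"
  assumes le: "\<And>x y. cmod (cinner (X x) y) \<le> C * (norm x * norm y)" and "C \<ge> 0"
  shows "norm X \<le> C"
proof (rule norm_blinfun_bound)
  fix x
  have "norm (X x) * norm (X x) \<le> norm (X x) * (C * norm x)"
    using le[of x "X x"] by (simp add: cinner_self norm_mult power2_eq_square mult_ac)
  moreover have "0 \<le> C * norm x" using \<open>C \<ge> 0\<close> by simp
  ultimately show "norm (X x) \<le> C * norm x" by (cases "X x = 0") (auto simp: mult_le_cancel_left)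
qed fact

lemma norm_adj_le:
  assumes "X \<in> bounded_ops"
  shows "norm (adj X) \<le> norm X"
proof (rule norm_le_of_cinner_bound)
  fix x y
  have "cmod (cinner (adj X x) y) \<le> norm x * norm (X y)"
    unfolding cinner_adj_left[OF assms] by (rule cauchy_schwarz)
  also have "\<dots> \<le> norm x * (norm X * norm y)" by (intro mult_left_mono norm_blinfun) auto
  finally show "cmod (cinner (adj X x) y) \<le> norm X * (norm x * norm y)" by (simp add: mult_ac)
qed simp

lemma scalar_op_commute: "X \<in> bounded_ops \<Longrightarrow> scalar_op a o\<^sub>L X = X o\<^sub>L scalar_op a"
  by (rule blinfun_eqI) (simp add: op_scaleC)

lemma norm_scalar_op_le: "norm (scalar_op a) \<le> cmod a"
  by (rule norm_blinfun_bound) (auto simp: norm_scaleC)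

lemma norm_scalar_op_compose_le: "norm (scalar_op a o\<^sub>L X) \<le> cmod a * norm X"
  by (rule norm_blinfun_bound) (auto simp: norm_scaleC norm_blinfun mult.assoc intro!: mult_left_mono)

lemma blinfun_compose_assoc: "(X o\<^sub>L Y) o\<^sub>L Z = X o\<^sub>L (Y o\<^sub>L Z)"
  by (rule blinfun_eqI) simp

lemma blinfun_compose_id [simp]: "X o\<^sub>L id_blinfun = X" "id_blinfun o\<^sub>L X = X"
  by (auto intro: blinfun_eqI)

lemmas blinfun_compose_simps =
  bounded_bilinear.add_left[OF bounded_bilinear_blinfun_compose]
  bounded_bilinear.add_right[OF bounded_bilinear_blinfun_compose]
  bounded_bilinear.diff_left[OF bounded_bilinear_blinfun_compose]
  bounded_bilinear.diff_right[OF bounded_bilinear_blinfun_compose]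
  bounded_bilinear.minus_left[OF bounded_bilinear_blinfun_compose]
  bounded_bilinear.minus_right[OF bounded_bilinear_blinfun_compose]
  bounded_bilinear.scaleR_left[OF bounded_bilinear_blinfun_compose]
  bounded_bilinear.scaleR_right[OF bounded_bilinear_blinfun_compose]
  bounded_bilinear.sum_left[OF bounded_bilinear_blinfun_compose]
  bounded_bilinear.sum_right[OF bounded_bilinear_blinfun_compose]

lemma op_inverse_eqI:
  assumes "Y \<in> bounded_ops" "Y o\<^sub>L X = id_blinfun" "X o\<^sub>L Y = id_blinfun"
  shows "op_inverse X = Y"
  unfolding op_inverse_def
proof (rule the_equality)
  fix Z assume Z: "Z \<in> bounded_ops \<and> Z o\<^sub>L X = id_blinfun \<and> X o\<^sub>L Z = id_blinfun"
  have "Z = Z o\<^sub>L (X o\<^sub>L Y)" by (simp add: assms blinfun_eqI)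
  also have "\<dots> = (Z o\<^sub>L X) o\<^sub>L Y" by (simp add: blinfun_compose_assoc)
  finally show "Z = Y" using Z by (simp add: blinfun_eqI)
qed (use assms in auto)

lemma
  assumes "op_invertible X"
  shows op_inverse_in_bounded_ops: "op_inverse X \<in> bounded_ops"
    and op_inverse_left: "op_inverse X o\<^sub>L X = id_blinfun"
    and op_inverse_right: "X o\<^sub>L op_inverse X = id_blinfun"
  using assms op_inverse_eqI unfolding op_invertible_def by metis+

section \<open>Laurent polynomials\<close>

type_synonym laurent = "int \<Rightarrow>\<^sub>0 complex"

abbreviation lcoeff :: "laurent \<Rightarrow> int \<Rightarrow> complex" where "lcoeff \<equiv> Poly_Mapping.lookup"
abbreviation lmonom :: "int \<Rightarrow> complex \<Rightarrow> laurent" where "lmonom \<equiv> Poly_Mapping.single"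

text \<open>The extension of a map given on monomials \<open>a z\<^sup>n\<close>; all the maps on Laurent polynomials below have
  this form, with terms additive in \<open>a\<close>.\<close>

definition laurent_sum :: "(int \<Rightarrow> complex \<Rightarrow> 'b) \<Rightarrow> laurent \<Rightarrow> 'b::comm_monoid_add" where
  "laurent_sum G f = (\<Sum>n\<in>Poly_Mapping.keys f. G n (lcoeff f n))"

definition laurent_eval :: "laurent \<Rightarrow> complex \<Rightarrow> complex" where
  "laurent_eval f z = laurent_sum (\<lambda>n a. a * z powi n) f"

definition op_powi :: "('a::complex_hilbert \<Rightarrow>\<^sub>L 'a) \<Rightarrow> int \<Rightarrow> ('a \<Rightarrow>\<^sub>L 'a)" where
  "op_powi T n = (if n \<ge> 0 then (((o\<^sub>L) T) ^^ nat n) id_blinfun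
                  else (((o\<^sub>L) (op_inverse T)) ^^ nat (- n)) id_blinfun)"

definition laurent_op :: "laurent \<Rightarrow> ('a::complex_hilbert \<Rightarrow>\<^sub>L 'a) \<Rightarrow> ('a \<Rightarrow>\<^sub>L 'a)" where
  "laurent_op f T = laurent_sum (\<lambda>n a. scalar_op a o\<^sub>L op_powi T n) f"

text \<open>The Cauchy integral \<open>1/(2 \<pi> i) \<integral> cnj (f \<zeta>) / (\<zeta> - z) d\<zeta>\<close> over the boundary of the annulus.\<close>

definition cauchy_conj :: "real \<Rightarrow> laurent \<Rightarrow> laurent" where
  "cauchy_conj R f = laurent_sum (\<lambda>n a. lmonom (- n) (cnj a * of_real (R powi (- 2 * \<bar>n\<bar>)))) f"

lemma laurent_sum_add:
  fixes G :: "int \<Rightarrow> complex \<Rightarrow> 'b :: ab_group_add"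
  assumes "\<And>n. Modules.additive (G n)"
  shows "laurent_sum G (f + g) = laurent_sum G f + laurent_sum G g"
  unfolding laurent_sum_def using assms
  by (intro setsum_keys_plus_distrib) (auto simp: Modules.additive.add Modules.additive.zero)

lemma laurent_sum_monom:
  fixes G :: "int \<Rightarrow> complex \<Rightarrow> 'b :: ab_group_add"
  assumes "\<And>n. Modules.additive (G n)"
  shows "laurent_sum G (lmonom n a) = G n a"
  using assms by (auto simp: laurent_sum_def Modules.additive.zero)

lemma laurent_eq_sum_monom: "f = (\<Sum>n\<in>Poly_Mapping.keys f. lmonom n (lcoeff f n))"
proof (rule poly_mapping_eqI)
  fix k
  have "(\<Sum>n\<in>Poly_Mapping.keys f. lcoeff (lmonom n (lcoeff f n)) k)
      = (\<Sum>n\<in>Poly_Mapping.keys f. if n = k then lcoeff f n else 0)"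
    by (intro sum.cong) (auto simp: lookup_single when_def)
  also have "\<dots> = lcoeff f k" by (simp add: in_keys_iff)
  finally show "lcoeff f k = lcoeff (\<Sum>n\<in>Poly_Mapping.keys f. lmonom n (lcoeff f n)) k"
    by (simp add: lookup_sum)
qed

lemma laurent_induct [case_names monom add]:
  assumes monom: "\<And>n a. P (lmonom n a)" and add: "\<And>f g. P f \<Longrightarrow> P g \<Longrightarrow> P (f + g)"
  shows "P f"
proof -
  have "P 0" using monom[of 0 0] by simp
  then have "P (\<Sum>n\<in>S. lmonom n (lcoeff f n))" for S
    by (induction S rule: infinite_finite_induct) (auto intro: monom add)
  then show ?thesis using laurent_eq_sum_monom[of f] by metis
qed

lemma additive_laurent_sum:
  fixes G :: "int \<Rightarrow> complex \<Rightarrow> 'b :: ab_group_add"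
  assumes "\<And>n. Modules.additive (G n)"
  shows "Modules.additive (laurent_sum G)"
  using laurent_sum_add[OF assms] by (simp add: Modules.additive_def)

lemma additive_eval_term: "Modules.additive (\<lambda>a :: complex. a * w)"
  by (simp add: Modules.additive_def distrib_right)

lemma additive_op_term: "Modules.additive (\<lambda>a. scalar_op a o\<^sub>L X)"
  by (auto simp: Modules.additive_def blinfun.bilinear_simps scaleC_add_left intro!: blinfun_eqI)

lemma additive_cauchy_conj_term: "Modules.additive (\<lambda>a. lmonom k (cnj a * w))"
  by (simp add: Modules.additive_def distrib_right single_add)

lemmas additive_laurent_terms = additive_eval_term additive_op_term additive_cauchy_conj_term

lemma additive_laurent_eval: "Modules.additive (\<lambda>f. laurent_eval f z)"
  unfolding laurent_eval_def by (intro additive_laurent_sum additive_laurent_terms)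

lemma additive_laurent_op: "Modules.additive (\<lambda>f. laurent_op f T)"
  unfolding laurent_op_def by (intro additive_laurent_sum additive_laurent_terms)

lemma additive_cauchy_conj: "Modules.additive (cauchy_conj R)"
  unfolding cauchy_conj_def[abs_def] by (intro additive_laurent_sum additive_laurent_terms)

lemmas laurent_eval_add = Modules.additive.add[OF additive_laurent_eval]
lemmas laurent_eval_sum = Modules.additive.sum[OF additive_laurent_eval]
lemmas laurent_op_add = Modules.additive.add[OF additive_laurent_op]
lemmas laurent_op_sum = Modules.additive.sum[OF additive_laurent_op]
lemmas cauchy_conj_add = Modules.additive.add[OF additive_cauchy_conj]
lemmas cauchy_conj_sum = Modules.additive.sum[OF additive_cauchy_conj]

lemma laurent_eval_monom: "laurent_eval (lmonom n a) z = a * z powi n"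
  unfolding laurent_eval_def by (intro laurent_sum_monom additive_laurent_terms)

lemma laurent_op_monom: "laurent_op (lmonom n a) T = scalar_op a o\<^sub>L op_powi T n"
  unfolding laurent_op_def by (intro laurent_sum_monom additive_laurent_terms)

lemma cauchy_conj_monom:
  "cauchy_conj R (lmonom n a) = lmonom (- n) (cnj a * of_real (R powi (- 2 * \<bar>n\<bar>)))"
  unfolding cauchy_conj_def by (intro laurent_sum_monom additive_laurent_terms)

lemma laurent_eval_one [simp]: "laurent_eval 1 z = 1"
  using laurent_eval_monom[of 0 1] by simp

lemma laurent_eval_mult:
  assumes "z \<noteq> 0"
  shows "laurent_eval (f * g) z = laurent_eval f z * laurent_eval g z"
proof (induction f rule: laurent_induct)
  case (monom n a)
  show ?case
    by (induction g rule: laurent_induct)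
      (auto simp: mult_single laurent_eval_monom laurent_eval_add power_int_add assms distrib_left)
qed (auto simp: laurent_eval_add distrib_right)

lemma laurent_eval_power: "z \<noteq> 0 \<Longrightarrow> laurent_eval (f ^ n) z = laurent_eval f z ^ n"
  by (induction n) (auto simp: laurent_eval_mult)

lemma lcoeff_scale: "lcoeff (lmonom 0 a * f) n = a * lcoeff f n"
  by (induction f rule: laurent_induct)
    (auto simp: mult_single lookup_single when_def lookup_add distrib_left)

lemma cauchy_conj_scale: "cauchy_conj R (lmonom 0 a * f) = lmonom 0 (cnj a) * cauchy_conj R f"
proof (induction f rule: laurent_induct)
  case (monom n b)
  then show ?case by (simp add: mult_single cauchy_conj_monom mult_ac)
qed (simp add: distrib_left cauchy_conj_add)

lemma op_powi_0 [simp]: "op_powi T 0 = id_blinfun"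
  by (simp add: op_powi_def)

lemma op_powi_in_bounded_ops:
  assumes "T \<in> bounded_ops" "op_invertible T"
  shows "op_powi T n \<in> bounded_ops"
proof -
  have "X \<in> bounded_ops \<Longrightarrow> (((o\<^sub>L) X) ^^ k) id_blinfun \<in> bounded_ops" for X :: "'a \<Rightarrow>\<^sub>L 'a" and k
    by (induction k) auto
  then show ?thesis using assms by (simp add: op_powi_def op_inverse_in_bounded_ops)
qed

lemma op_powi_add:
  assumes "op_invertible T"
  shows "op_powi T (m + n) = op_powi T m o\<^sub>L op_powi T n"
proof -
  let ?Q = "op_inverse T"
  have QT: "?Q o\<^sub>L (T o\<^sub>L X) = X" "T o\<^sub>L (?Q o\<^sub>L X) = X" for X
    using assms by (simp_all add: op_inverse_left op_inverse_right flip: blinfun_compose_assoc)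
  have up: "op_powi T (k + 1) = T o\<^sub>L op_powi T k" for k
  proof (cases "k \<ge> 0")
    case True
    then show ?thesis by (simp add: op_powi_def nat_add_distrib)
  next
    case False
    then obtain j where "k = - int (Suc j)" by (metis int_cases not_le of_nat_0_le_iff)
    then show ?thesis by (cases j) (auto simp: op_powi_def QT QT[of id_blinfun, simplified] nat_add_distrib)
  qed
  have down: "op_powi T (k - 1) = ?Q o\<^sub>L op_powi T k" for k
    using up[of "k - 1"] by (simp add: QT)
  show ?thesis
  proof (induction m rule: int_induct[where k = 0])
    case base
    then show ?case by simp
  next
    case (step1 i)
    then show ?case using up[of "i + n"] up[of i] by (simp add: blinfun_compose_assoc algebra_simps)
  next
    case (step2 i)
    then show ?case using down[of "i + n"] down[of i]
      by (simp add: blinfun_compose_assoc algebra_simps)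
  qed
qed

lemma laurent_op_in_bounded_ops:
  "T \<in> bounded_ops \<Longrightarrow> op_invertible T \<Longrightarrow> laurent_op f T \<in> bounded_ops"
  by (auto simp: laurent_op_def laurent_sum_def op_powi_in_bounded_ops)

lemma scalar_op_mult: "scalar_op (a * b) = scalar_op a o\<^sub>L scalar_op b"
  by (rule blinfun_eqI) (simp add: scaleC_scaleC)

lemma laurent_op_mult:
  assumes T: "T \<in> bounded_ops" "op_invertible T"
  shows "laurent_op (f * g) T = laurent_op f T o\<^sub>L laurent_op g T"
proof (induction f rule: laurent_induct)
  case (monom m a)
  show ?case
  proof (induction g rule: laurent_induct)
    case (monom n b)
    show ?case
      by (rule blinfun_eqI)
        (simp add: mult_single laurent_op_monom op_powi_add[OF T(2)] op_scaleC
          op_powi_in_bounded_ops[OF T] scaleC_scaleC)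
  qed (simp add: distrib_left laurent_op_add blinfun_compose_simps)
qed (simp add: distrib_right laurent_op_add blinfun_compose_simps)

lemma laurent_op_one [simp]: "laurent_op 1 T = id_blinfun"
  by (rule blinfun_eqI) (use laurent_op_monom[of 0 1 T] in simp)

lemma laurent_op_const: "laurent_op (lmonom 0 a) T = scalar_op a"
  by (rule blinfun_eqI) (simp add: laurent_op_monom)


lemma laurent_op_scale: "laurent_op (lmonom 0 a * f) T = scalar_op a o\<^sub>L laurent_op f T"
  by (induction f rule: laurent_induct)
    (auto simp: mult_single laurent_op_monom distrib_left laurent_op_add blinfun_compose_simps
      scalar_op_mult blinfun_compose_assoc)


section \<open>Sup norm estimates on circles\<close>

lemma has_integral_cis:
  "((\<lambda>t. cis (of_int n * t)) has_integral (if n = 0 then of_real (2 * pi) else 0)) {0..2 * pi}"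
proof (cases "n = 0")
  case True
  then show ?thesis using has_integral_const_real[of "1 :: complex" 0 "2 * pi"]
    by (simp add: scaleR_conv_of_real)
next
  case False
  have "((\<lambda>t. cis (of_int n * t)) has_integral
      (cis (of_int n * (2 * pi)) / (\<i> * of_int n) - cis (of_int n * 0) / (\<i> * of_int n))) {0..2 * pi}"
    using False
    by (intro fundamental_theorem_of_calculus)
      (auto intro!: derivative_eq_intros simp: has_vector_derivative_def scaleR_conv_of_real fun_eq_iff
        complex_eq_iff)
  moreover have "cis (of_int n * (2 * pi)) = 1"
    using cis_multiple_2pi[of "of_int n"] by (simp add: mult_ac)
  ultimately show ?thesis using False by simp
qed

lemma cis_powi: "cis t powi n = cis (of_int n * t)"
  by (cases n rule: int_cases2) (auto simp: Complex.DeMoivre power_int_minus)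

lemma laurent_coeff_integral:
  assumes "r > 0"
  shows "((\<lambda>t. laurent_eval f (of_real r * cis t) * cis (- of_int n * t)) has_integral
    of_real (2 * pi) * (lcoeff f n * of_real r powi n)) {0..2 * pi}"
proof (induction f rule: laurent_induct)
  case (monom m a)
  have "((\<lambda>t. (a * of_real r powi m) * cis (of_int (m - n) * t)) has_integral
    (a * of_real r powi m) * (if m - n = 0 then of_real (2 * pi) else 0)) {0..2 * pi}"
    by (intro has_integral_mult_right has_integral_cis)
  moreover have "laurent_eval (lmonom m a) (of_real r * cis t) * cis (- of_int n * t)
    = (a * of_real r powi m) * cis (of_int (m - n) * t)" for t
    by (simp add: laurent_eval_monom power_int_mult_distrib cis_powi cis_mult algebra_simps)
  ultimately show ?case by (simp add: lookup_single when_def mult_ac split: if_splits)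
next
  case (add f g)
  from has_integral_add[OF this] show ?case
    by (simp add: laurent_eval_add lookup_add algebra_simps)
qed

lemma cauchy_estimate:
  assumes "r > 0" "\<And>z. cmod z = r \<Longrightarrow> cmod (laurent_eval f z) \<le> B"
  shows "cmod (lcoeff f n) * r powi n \<le> B"
proof -
  have "0 \<le> B" using order_trans[OF norm_ge_zero assms(2)[of "of_real r"]] \<open>r > 0\<close> by simp
  have "cmod (of_real (2 * pi) * (lcoeff f n * of_real r powi n)) \<le> B * measure lborel {0..2 * pi}"
    by (rule has_integral_bound_real[OF \<open>0 \<le> B\<close> finite.emptyI laurent_coeff_integral])
      (use assms in \<open>auto simp: norm_mult\<close>)
  then have "2 * pi * (cmod (lcoeff f n) * r powi n) \<le> 2 * pi * B"
    using \<open>r > 0\<close> by (simp add: norm_mult norm_power_int mult_ac)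
  then show ?thesis by simp
qed

text \<open>Up to the reflection \<open>z \<mapsto> 1 / cnj z\<close> the passage from \<open>cnj f\<close> to its Cauchy integral multiplies
  the \<open>n\<close>-th coefficient by \<open>R\<^bsup>-2|n|\<^esup>\<close>, which amounts to a Poisson integral along circles: on each
  circle the values are those, at radius \<open>R\<^bsup>-2\<^esup>\<close>, of the harmonic extension of the reflected
  function to the disk. The maximum principle for the real parts of the rotations of this extension
  gives the estimate.\<close>

lemma cmod_cauchy_conj_le:
  assumes "R \<ge> 1" "z \<noteq> 0" and B: "\<And>w. cmod w = 1 / cmod z \<Longrightarrow> cmod (laurent_eval f w) \<le> B"
  shows "cmod (laurent_eval (cauchy_conj R f) z) \<le> B"
proof -
  let ?K = "Poly_Mapping.keys f"
  define q where "q = R powi - 2"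
  have q: "0 \<le> q" "q \<le> 1"
    using \<open>R \<ge> 1\<close> by (auto simp: q_def power_int_minus field_simps)
  obtain u where u: "cmod u = 1"
    "u * laurent_eval (cauchy_conj R f) z = of_real (cmod (laurent_eval (cauchy_conj R f) z))"
    using cmod_eq_Re_rotation by blast
  define b where "b n = u * cnj (lcoeff f n) * z powi (- n)" for n
  \<comment> \<open>\<open>Re p\<close> is the real part of \<open>u\<close> times the harmonic extension; conjugating the coefficients of the
    powers of \<open>cnj \<zeta>\<close> makes \<open>p\<close> a polynomial in \<open>\<zeta>\<close>.\<close>
  define p where "p \<zeta> = (\<Sum>n\<in>?K. (if n \<le> 0 then b n else cnj (b n)) * \<zeta> ^ nat \<bar>n\<bar>)" for \<zeta>
  have "Re (p (of_real q)) \<le> B"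
  proof (rule maximum_real_frontier[where S = "cball 0 1" and f = p])
    fix \<zeta> :: complex assume "\<zeta> \<in> frontier (cball 0 1)"
    then have \<zeta>: "cmod \<zeta> = 1" by simp
    then have "\<zeta> \<noteq> 0" by auto
    have "\<zeta> * cnj \<zeta> = 1" using complex_norm_square[of \<zeta>] \<zeta> by simp
    then have "cnj \<zeta> = inverse \<zeta>" by (simp add: inverse_unique)
    have "Re ((if n \<le> 0 then b n else cnj (b n)) * \<zeta> ^ nat \<bar>n\<bar>) = Re (b n * \<zeta> powi (- n))" for n
    proof (cases "n \<le> 0")
      case True
      then show ?thesis by (simp add: power_int_def)
    next
      case False
      then have eq: "b n * \<zeta> powi (- n) = cnj (cnj (b n) * \<zeta> ^ nat \<bar>n\<bar>)"
        by (simp add: power_int_def \<open>cnj \<zeta> = inverse \<zeta>\<close>)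
      show ?thesis unfolding eq cnj.sel using False by simp
    qed
    then have "Re (p \<zeta>) = Re (\<Sum>n\<in>?K. b n * \<zeta> powi (- n))" by (simp add: p_def del: times_complex.sel)
    also have "(\<Sum>n\<in>?K. b n * \<zeta> powi (- n)) = u * cnj (laurent_eval f (1 / cnj (z * \<zeta>)))"
    proof -
      have "b n * \<zeta> powi (- n) = u * cnj (lcoeff f n * (1 / cnj (z * \<zeta>)) powi n)" for n
        by (simp add: b_def power_int_mult_distrib power_int_minus power_int_divide_distrib
            divide_inverse inverse_mult_distrib)
          (simp add: power_int_inverse)
      then show ?thesis by (simp add: laurent_eval_def laurent_sum_def sum_distrib_left)
    qed
    also have "Re \<dots> \<le> cmod \<dots>" by (rule complex_Re_le_cmod)
    also have "\<dots> \<le> B" using \<zeta> u by (auto simp: norm_mult norm_divide intro!: B)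
    finally show "Re (p \<zeta>) \<le> B" .
  qed (use q in \<open>auto simp: p_def[abs_def] intro!: holomorphic_intros continuous_intros\<close>)
  moreover have "Re (p (of_real q)) = Re (u * laurent_eval (cauchy_conj R f) z)"
  proof -
    have "Re ((if n \<le> 0 then b n else cnj (b n)) * of_real q ^ nat \<bar>n\<bar>)
      = Re (u * (cnj (lcoeff f n) * of_real (R powi (- 2 * \<bar>n\<bar>)) * z powi (- n)))" for n
    proof -
      have "R powi (- 2 * \<bar>n\<bar>) = q ^ nat \<bar>n\<bar>" unfolding q_def
        by (subst power_int_power') simp
      then have "u * (cnj (lcoeff f n) * of_real (R powi (- 2 * \<bar>n\<bar>)) * z powi (- n))
          = b n * of_real (q ^ nat \<bar>n\<bar>)"
        by (simp add: b_def)
      then show ?thesis by (simp flip: of_real_power)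
    qed
    then show ?thesis
      by (simp add: p_def cauchy_conj_def laurent_sum_def laurent_eval_sum laurent_eval_monom
          sum_distrib_left del: times_complex.sel)
  qed
  ultimately show ?thesis using u by simp
qed

section \<open>Operator matrices\<close>

definition fam_norm :: "nat \<Rightarrow> (nat \<Rightarrow> 'a::real_normed_vector) \<Rightarrow> real" where
  "fam_norm m x = L2_set (\<lambda>i. norm (x i)) {..<m}"

text \<open>Bounds for operator matrices are stated on vectors, so that adjoints and products of matrices can be
  handled without the direct sum of Hilbert spaces as a type.\<close>

definition mat_bounded :: "nat \<Rightarrow> (nat \<Rightarrow> nat \<Rightarrow> 'a::real_normed_vector \<Rightarrow> 'a) \<Rightarrow> real \<Rightarrow> bool" where
  "mat_bounded m A B \<longleftrightarrow> (\<forall>x. fam_norm m (\<lambda>i. \<Sum>j<m. A i j (x j)) \<le> B * fam_norm m x)"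

lemma fam_norm_nonneg [simp]: "0 \<le> fam_norm m x"
  by (simp add: fam_norm_def)

lemma fam_norm_power2: "(fam_norm m x)\<^sup>2 = (\<Sum>i<m. (norm (x i))\<^sup>2)"
  by (simp add: fam_norm_def L2_set_def sum_nonneg)

lemma fam_norm_zero [simp]: "fam_norm m (\<lambda>_. 0) = 0"
  by (simp add: fam_norm_def L2_set_def)

lemma fam_norm_triangle: "fam_norm m (\<lambda>i. x i + y i) \<le> fam_norm m x + fam_norm m y"
  unfolding fam_norm_def
  by (rule order_trans[OF L2_set_mono L2_set_triangle_ineq]) (auto intro: norm_triangle_ineq)

lemma fam_norm_scaleR: "fam_norm m (\<lambda>i. r *\<^sub>R x i) = \<bar>r\<bar> * fam_norm m x"
  unfolding fam_norm_def by (simp add: L2_set_right_distrib)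

lemma fam_norm_diff: "fam_norm m (\<lambda>i. x i - y i) \<le> fam_norm m x + fam_norm m y"
  using fam_norm_triangle[of m x "\<lambda>i. - y i"] by (simp add: fam_norm_def)

lemma norm_le_fam_norm: "i < m \<Longrightarrow> norm (x i) \<le> fam_norm m x"
  unfolding fam_norm_def by (rule member_le_L2_set) auto

lemma fam_norm_le_sum: "fam_norm m x \<le> (\<Sum>i<m. norm (x i))"
  unfolding fam_norm_def by (rule L2_set_le_sum) auto

lemma mat_boundedD: "mat_bounded m A B \<Longrightarrow> fam_norm m (\<lambda>i. \<Sum>j<m. A i j (x j)) \<le> B * fam_norm m x"
  by (simp add: mat_bounded_def)

lemma mat_bounded_mono: "mat_bounded m A B \<Longrightarrow> B \<le> C \<Longrightarrow> mat_bounded m A C"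
  unfolding mat_bounded_def by (meson fam_norm_nonneg mult_right_mono order_trans)

lemma mat_bounded_add:
  assumes "mat_bounded m A B" "mat_bounded m A' B'"
  shows "mat_bounded m (\<lambda>i j x. A i j x + A' i j x) (B + B')"
  unfolding mat_bounded_def
proof
  fix x
  have "fam_norm m (\<lambda>i. \<Sum>j<m. A i j (x j) + A' i j (x j))
      \<le> fam_norm m (\<lambda>i. \<Sum>j<m. A i j (x j)) + fam_norm m (\<lambda>i. \<Sum>j<m. A' i j (x j))"
    unfolding sum.distrib by (rule fam_norm_triangle)
  also have "\<dots> \<le> B * fam_norm m x + B' * fam_norm m x"
    using assms by (intro add_mono mat_boundedD)
  finally show "fam_norm m (\<lambda>i. \<Sum>j<m. A i j (x j) + A' i j (x j)) \<le> (B + B') * fam_norm m x"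
    by (simp add: distrib_right)
qed

lemma mat_bounded_entrywise:
  assumes "e \<ge> 0" and "\<And>i j x. i < m \<Longrightarrow> j < m \<Longrightarrow> norm (A i j x) \<le> e * norm x"
  shows "mat_bounded m A (real m * real m * e)"
  unfolding mat_bounded_def
proof
  fix x
  have "fam_norm m (\<lambda>i. \<Sum>j<m. A i j (x j)) \<le> (\<Sum>i<m. norm (\<Sum>j<m. A i j (x j)))"
    by (rule fam_norm_le_sum)
  also have "\<dots> \<le> (\<Sum>i<m. \<Sum>j<m. e * fam_norm m x)"
    by (intro sum_mono order_trans[OF norm_sum] order_trans[OF assms(2)] mult_left_mono
        norm_le_fam_norm assms(1)) auto
  finally show "fam_norm m (\<lambda>i. \<Sum>j<m. A i j (x j)) \<le> real m * real m * e * fam_norm m x"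
    by simp
qed

lemma mat_bounded_entry:
  assumes "mat_bounded m A B" "i < m" "j < m" "\<And>i j. A i j 0 = 0"
  shows "norm (A i j x) \<le> B * norm x"
proof -
  define y where "y k = (if k = j then x else 0)" for k
  have "A i k (y k) = (if k = j then A i j x else 0)" for i k
    by (simp add: y_def assms(4))
  then have "(\<Sum>k<m. A i k (y k)) = A i j x" for i
    using \<open>j < m\<close> by simp
  then have "norm (A i j x) \<le> fam_norm m (\<lambda>i. \<Sum>k<m. A i k (y k))"
    using norm_le_fam_norm[OF \<open>i < m\<close>, of "\<lambda>i. A i j x"] by simp
  also have "\<dots> \<le> B * fam_norm m y" by (rule mat_boundedD) fact
  also have "fam_norm m y = norm x"
  proof -
    have "(fam_norm m y)\<^sup>2 = (\<Sum>k<m. if k = j then (norm x)\<^sup>2 else 0)"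
      unfolding fam_norm_power2 by (intro sum.cong) (auto simp: y_def)
    then have "(fam_norm m y)\<^sup>2 = (norm x)\<^sup>2" using \<open>j < m\<close> by simp
    then show ?thesis by (simp add: power2_eq_iff_nonneg)
  qed
  finally show ?thesis .
qed

lemma mat_norm_eq_Sup_fam_norm:
  "mat_norm m A = Sup ((\<lambda>x. fam_norm m (\<lambda>i. \<Sum>j<m. A i j (x j))) ` {x. fam_norm m x \<le> 1})"
proof -
  have "(\<Sum>j<m. (norm (x j))\<^sup>2) \<le> 1 \<longleftrightarrow> fam_norm m x \<le> 1" for x :: "nat \<Rightarrow> 'a"
    by (simp add: fam_norm_def L2_set_def)
  then show ?thesis
    unfolding mat_norm_def by (simp add: fam_norm_def L2_set_def setcompr_eq_image)
qed

lemma mat_norm_le: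
  assumes "mat_bounded m A B" "0 \<le> B"
  shows "mat_norm m A \<le> B"
  unfolding mat_norm_eq_Sup_fam_norm
proof (rule cSup_least)
  have "(\<lambda>_. 0) \<in> {x :: nat \<Rightarrow> 'a. fam_norm m x \<le> 1}" by simp
  then show "(\<lambda>x. fam_norm m (\<lambda>i. \<Sum>j<m. A i j (x j))) ` {x. fam_norm m x \<le> 1} \<noteq> {}" by blast
next
  fix r assume "r \<in> (\<lambda>x. fam_norm m (\<lambda>i. \<Sum>j<m. A i j (x j))) ` {x. fam_norm m x \<le> 1}"
  then obtain x where "r = fam_norm m (\<lambda>i. \<Sum>j<m. A i j (x j))" "fam_norm m x \<le> 1" by blast
  then show "r \<le> B"
    using mat_boundedD[OF assms(1), of x] mult_left_mono[of "fam_norm m x" 1 B] assms(2) by simp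
qed

lemma mat_bounded_mat_norm:
  assumes lin: "\<And>i j. bounded_linear (A i j)"
  shows "mat_bounded m A (mat_norm m A)"
proof -
  have "\<exists>e\<ge>0. \<forall>i<m. \<forall>j<m. \<forall>x. norm (A i j x) \<le> e * norm x"
  proof (intro exI conjI allI impI)
    let ?e = "\<Sum>i<m. \<Sum>j<m. onorm (A i j)"
    show "0 \<le> ?e" by (intro sum_nonneg onorm_pos_le lin)
    fix i j x assume "i < m" "j < m"
    have "onorm (A i j) \<le> (\<Sum>j<m. onorm (A i j))"
      using \<open>j < m\<close> by (intro member_le_sum onorm_pos_le lin) auto
    also have "\<dots> \<le> ?e"
      using \<open>i < m\<close> by (intro member_le_sum[of i _ "\<lambda>i. \<Sum>j<m. onorm (A i j)"] sum_nonneg onorm_pos_le lin) auto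
    finally show "norm (A i j x) \<le> ?e * norm x"
      by (rule order_trans[OF onorm[OF lin] mult_right_mono]) auto
  qed
  then obtain e where e: "e \<ge> 0" "\<And>i j x. i < m \<Longrightarrow> j < m \<Longrightarrow> norm (A i j x) \<le> e * norm x" by blast
  let ?B = "real m * real m * e"
  have B: "mat_bounded m A ?B" by (rule mat_bounded_entrywise) (use e in auto)
  have bdd: "bdd_above ((\<lambda>x. fam_norm m (\<lambda>i. \<Sum>j<m. A i j (x j))) ` {x. fam_norm m x \<le> 1})"
  proof (rule bdd_aboveI2)
    fix x :: "nat \<Rightarrow> 'a" assume "x \<in> {x. fam_norm m x \<le> 1}"
    then show "fam_norm m (\<lambda>i. \<Sum>j<m. A i j (x j)) \<le> ?B * 1"
      using e(1) by (intro order_trans[OF mat_boundedD[OF B]] mult_left_mono) auto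
  qed
  show ?thesis
    unfolding mat_bounded_def
  proof
    fix x :: "nat \<Rightarrow> 'a"
    let ?n = "fam_norm m x" and ?y = "\<lambda>j. inverse (fam_norm m x) *\<^sub>R x j"
    show "fam_norm m (\<lambda>i. \<Sum>j<m. A i j (x j)) \<le> mat_norm m A * ?n"
    proof (cases "?n = 0")
      case True
      then show ?thesis using mat_boundedD[OF B, of x] by simp
    next
      case False
      then have pos: "?n > 0" using fam_norm_nonneg[of m x] by linarith
      have "fam_norm m ?y \<le> 1" using pos by (simp add: fam_norm_scaleR)
      then have "fam_norm m (\<lambda>i. \<Sum>j<m. A i j (?y j)) \<le> mat_norm m A"
        unfolding mat_norm_eq_Sup_fam_norm using bdd by (intro cSUP_upper) auto
      also have "(\<lambda>i. \<Sum>j<m. A i j (?y j)) = (\<lambda>i. inverse ?n *\<^sub>R (\<Sum>j<m. A i j (x j)))"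
        using linear_simps(5)[OF lin] by (simp add: scaleR_right.sum)
      finally show ?thesis using pos by (simp add: fam_norm_scaleR field_simps)
    qed
  qed
qed

definition fam_inner :: "nat \<Rightarrow> (nat \<Rightarrow> 'a::complex_inner) \<Rightarrow> (nat \<Rightarrow> 'a) \<Rightarrow> complex" where
  "fam_inner m x y = (\<Sum>i<m. cinner (x i) (y i))"

lemma fam_inner_self: "fam_inner m x x = of_real ((fam_norm m x)\<^sup>2)"
  by (simp add: fam_inner_def cinner_self fam_norm_power2)

lemma fam_cauchy_schwarz: "cmod (fam_inner m x y) \<le> fam_norm m x * fam_norm m y"
proof -
  have "cmod (fam_inner m x y) \<le> (\<Sum>i<m. \<bar>norm (x i)\<bar> * \<bar>norm (y i)\<bar>)"
    unfolding fam_inner_def by (rule order_trans[OF norm_sum sum_mono]) (simp add: cauchy_schwarz)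
  also have "\<dots> \<le> fam_norm m x * fam_norm m y"
    unfolding fam_norm_def by (rule L2_set_mult_ineq)
  finally show ?thesis .
qed

definition op_mat_apply ::
    "nat \<Rightarrow> (nat \<Rightarrow> nat \<Rightarrow> 'a::complex_hilbert \<Rightarrow>\<^sub>L 'a) \<Rightarrow> (nat \<Rightarrow> 'a) \<Rightarrow> (nat \<Rightarrow> 'a)" where
  "op_mat_apply m A x = (\<lambda>i. \<Sum>j<m. blinfun_apply (A i j) (x j))"

abbreviation op_mat_bounded where
  "op_mat_bounded m A B \<equiv> mat_bounded m (\<lambda>i j. blinfun_apply (A i j)) B"

lemma op_mat_boundedD: "op_mat_bounded m A B \<Longrightarrow> fam_norm m (op_mat_apply m A x) \<le> B * fam_norm m x"
  unfolding op_mat_apply_def by (rule mat_boundedD)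

lemma op_mat_boundedI:
  "(\<And>x. fam_norm m (op_mat_apply m A x) \<le> B * fam_norm m x) \<Longrightarrow> op_mat_bounded m A B"
  by (simp add: mat_bounded_def op_mat_apply_def)

lemma fam_inner_adj:
  assumes "\<And>i j. A i j \<in> bounded_ops"
  shows "fam_inner m (op_mat_apply m A x) y = fam_inner m x (op_mat_apply m (\<lambda>i j. adj (A j i)) y)"
proof -
  have "fam_inner m (op_mat_apply m A x) y = (\<Sum>i<m. \<Sum>j<m. cinner (x j) (adj (A i j) (y i)))"
    by (simp add: fam_inner_def op_mat_apply_def cinner_sum_left cinner_adj_right assms)
  also have "\<dots> = (\<Sum>j<m. \<Sum>i<m. cinner (x j) (adj (A i j) (y i)))" by (rule sum.swap)
  finally show ?thesis by (simp add: fam_inner_def op_mat_apply_def cinner_sum_right)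
qed

lemma op_mat_bounded_adj:
  assumes ops: "\<And>i j. A i j \<in> bounded_ops" and B: "op_mat_bounded m A B" "B \<ge> 0"
  shows "op_mat_bounded m (\<lambda>i j. adj (A j i)) B"
proof (rule op_mat_boundedI)
  fix y
  let ?z = "op_mat_apply m (\<lambda>i j. adj (A j i)) y"
  have "(fam_norm m ?z)\<^sup>2 = cmod (fam_inner m (op_mat_apply m A ?z) y)"
    by (simp add: fam_inner_adj ops fam_inner_self norm_power)
  also have "\<dots> \<le> fam_norm m (op_mat_apply m A ?z) * fam_norm m y" by (rule fam_cauchy_schwarz)
  also have "\<dots> \<le> (B * fam_norm m ?z) * fam_norm m y"
    by (intro mult_right_mono op_mat_boundedD B) auto
  finally have "fam_norm m ?z * fam_norm m ?z \<le> fam_norm m ?z * (B * fam_norm m y)"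
    by (simp add: power2_eq_square mult_ac)
  moreover have "0 \<le> B * fam_norm m y" using B by simp
  ultimately show "fam_norm m ?z \<le> B * fam_norm m y"
    by (cases "fam_norm m ?z = 0") (auto simp: mult_le_cancel_left)
qed

text \<open>For the converse direction take \<open>v = M u\<close>.\<close>

lemma scalar_mat_bounded_iff:
  assumes "B \<ge> 0"
  shows "mat_bounded m (\<lambda>i j x. M i j * x) B \<longleftrightarrow>
    (\<forall>u v. cmod (\<Sum>i<m. \<Sum>j<m. M i j * u j * cnj (v i)) \<le> B * (fam_norm m u * fam_norm m v))"
    (is "?L \<longleftrightarrow> ?R")
proof
  assume L: ?L
  show ?R
  proof (intro allI)
    fix u v
    let ?y = "\<lambda>i. \<Sum>j<m. M i j * u j"
    have "cmod (\<Sum>i<m. \<Sum>j<m. M i j * u j * cnj (v i)) = cmod (\<Sum>i<m. ?y i * cnj (v i))"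
      by (simp add: sum_distrib_right)
    also have "\<dots> \<le> (\<Sum>i<m. \<bar>cmod (?y i)\<bar> * \<bar>cmod (v i)\<bar>)"
      by (rule order_trans[OF norm_sum]) (simp add: norm_mult)
    also have "\<dots> \<le> fam_norm m ?y * fam_norm m v"
      unfolding fam_norm_def by (rule L2_set_mult_ineq)
    also have "\<dots> \<le> (B * fam_norm m u) * fam_norm m v"
      by (intro mult_right_mono mat_boundedD[OF L]) auto
    finally show "cmod (\<Sum>i<m. \<Sum>j<m. M i j * u j * cnj (v i)) \<le> B * (fam_norm m u * fam_norm m v)"
      by (simp add: mult_ac)
  qed
next
  assume R: ?R
  show ?L
    unfolding mat_bounded_def
  proof
    fix u
    let ?y = "\<lambda>i. \<Sum>j<m. M i j * u j"
    have "of_real ((fam_norm m ?y)\<^sup>2) = (\<Sum>i<m. ?y i * cnj (?y i))"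
      unfolding fam_norm_power2 of_real_sum complex_norm_square ..
    also have "\<dots> = (\<Sum>i<m. \<Sum>j<m. M i j * u j * cnj (?y i))" by (simp only: sum_distrib_right)
    finally have "cmod (of_real ((fam_norm m ?y)\<^sup>2)) \<le> B * (fam_norm m u * fam_norm m ?y)"
      using R[rule_format, of u ?y] by (simp only:)
    then have "fam_norm m ?y * fam_norm m ?y \<le> fam_norm m ?y * (B * fam_norm m u)"
      by (simp add: power2_eq_square mult_ac norm_mult)
    moreover have "0 \<le> B * fam_norm m u" using assms by simp
    ultimately show "fam_norm m ?y \<le> B * fam_norm m u"
      by (cases "fam_norm m ?y = 0") (auto simp: mult_le_cancel_left)
  qed
qed


section \<open>The iterated norm estimate\<close>

definition closed_annulus :: "real \<Rightarrow> complex set" where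
  "closed_annulus R = {z. 1 / R \<le> cmod z \<and> cmod z \<le> R}"

definition laurent_mat_bounded :: "nat \<Rightarrow> real \<Rightarrow> (nat \<Rightarrow> nat \<Rightarrow> laurent) \<Rightarrow> real \<Rightarrow> bool" where
  "laurent_mat_bounded m R F B \<longleftrightarrow>
    (\<forall>z\<in>closed_annulus R. mat_bounded m (\<lambda>i j x. laurent_eval (F i j) z * x) B)"

text \<open>The closed form of \<^const>\<open>S_map\<close> on Laurent polynomials, for an operator with spectrum in the open
  annulus.\<close>

definition laurent_S :: "real \<Rightarrow> real \<Rightarrow> ('a::complex_hilbert \<Rightarrow>\<^sub>L 'a) \<Rightarrow> laurent \<Rightarrow> ('a \<Rightarrow>\<^sub>L 'a)" where
  "laurent_S R c T f = (1 / (2 + c)) *\<^sub>R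
    (laurent_op f T + adj (laurent_op (cauchy_conj R f) T) + scalar_op (of_real c * lcoeff f 0))"

text \<open>The matrix whose value at \<open>T\<close>, added to the adjoint of \<open>F(T)\<close>, gives \<open>2 + c\<close> times the adjoint
  of \<open>S(F)\<close>.\<close>

definition dual_mat :: "real \<Rightarrow> real \<Rightarrow> (nat \<Rightarrow> nat \<Rightarrow> laurent) \<Rightarrow> nat \<Rightarrow> nat \<Rightarrow> laurent" where
  "dual_mat R c F i j = cauchy_conj R (F j i) + lmonom 0 (of_real c * cnj (lcoeff (F j i) 0))"

lemma closed_annulus_nonzero: "z \<in> closed_annulus R \<Longrightarrow> R > 1 \<Longrightarrow> z \<noteq> 0"
  by (auto simp: closed_annulus_def)

text \<open>Pairing with two vectors reduces the matrix statement to a single Laurent polynomial, as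
  \<^term>\<open>cauchy_conj R\<close> is antilinear.\<close>

lemma laurent_mat_bounded_dual:
  assumes "R > 1" "B \<ge> 0" and F: "laurent_mat_bounded m R F B"
  shows "laurent_mat_bounded m R (dual_mat R c F) ((1 + \<bar>c\<bar>) * B)"
  unfolding laurent_mat_bounded_def
proof (intro ballI)
  fix z assume z: "z \<in> closed_annulus R"
  have "z \<noteq> 0" by (rule closed_annulus_nonzero[OF z \<open>R > 1\<close>])
  show "mat_bounded m (\<lambda>i j x. laurent_eval (dual_mat R c F i j) z * x) ((1 + \<bar>c\<bar>) * B)"
  proof (subst scalar_mat_bounded_iff, safe)
    show "0 \<le> (1 + \<bar>c\<bar>) * B" using \<open>B \<ge> 0\<close> by simp
    fix u v
    define \<phi> where "\<phi> = (\<Sum>i<m. \<Sum>j<m. lmonom 0 (v i * cnj (u j)) * F j i)"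
    let ?N = "fam_norm m u * fam_norm m v"
    have \<phi>: "cmod (laurent_eval \<phi> w) \<le> B * ?N" if "w \<in> closed_annulus R" for w
    proof -
      have "w \<noteq> 0" using that \<open>R > 1\<close> by (auto simp: closed_annulus_def)
      then have "laurent_eval \<phi> w = (\<Sum>i<m. \<Sum>j<m. laurent_eval (F j i) w * v i * cnj (u j))"
        by (simp add: \<phi>_def laurent_eval_sum laurent_eval_mult laurent_eval_monom mult_ac)
      also have "\<dots> = (\<Sum>j<m. \<Sum>i<m. laurent_eval (F j i) w * v i * cnj (u j))" by (rule sum.swap)
      also have "cmod \<dots> \<le> B * (fam_norm m v * fam_norm m u)"
        using F that scalar_mat_bounded_iff[OF \<open>B \<ge> 0\<close>, of m "\<lambda>i j. laurent_eval (F i j) w"]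
        unfolding laurent_mat_bounded_def by blast
      finally show ?thesis by (simp add: mult_ac)
    qed
    have 1: "cmod (laurent_eval (cauchy_conj R \<phi>) z) \<le> B * ?N"
    proof (rule cmod_cauchy_conj_le)
      fix w assume "cmod w = 1 / cmod z"
      moreover have "1 / R \<le> 1 / cmod z" "1 / cmod z \<le> R"
        using z \<open>R > 1\<close> \<open>z \<noteq> 0\<close> by (auto simp: closed_annulus_def field_simps)
      ultimately show "cmod (laurent_eval \<phi> w) \<le> B * ?N"
        by (intro \<phi>) (simp add: closed_annulus_def)
    qed (use \<open>R > 1\<close> \<open>z \<noteq> 0\<close> in auto)
    have 2: "cmod (lcoeff \<phi> 0) \<le> B * ?N"
    proof -
      have "cmod (lcoeff \<phi> 0) * 1 powi 0 \<le> B * ?N"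
        by (rule cauchy_estimate) (use \<open>R > 1\<close> \<phi> in \<open>auto simp: closed_annulus_def\<close>)
      then show ?thesis by simp
    qed
    have "(\<Sum>i<m. \<Sum>j<m. laurent_eval (dual_mat R c F i j) z * u j * cnj (v i))
      = laurent_eval (cauchy_conj R \<phi>) z + of_real c * cnj (lcoeff \<phi> 0)"
      using \<open>z \<noteq> 0\<close>
      by (simp add: dual_mat_def \<phi>_def laurent_eval_add laurent_eval_sum laurent_eval_mult
          laurent_eval_monom cauchy_conj_sum cauchy_conj_scale lookup_sum lcoeff_scale
          sum_distrib_left distrib_right sum.distrib)
        (simp add: mult_ac)
    also have "cmod \<dots> \<le> B * ?N + \<bar>c\<bar> * (B * ?N)"
      by (rule norm_triangle_le, rule add_mono[OF 1])
        (use mult_left_mono[OF 2, of "\<bar>c\<bar>"] in \<open>simp add: norm_mult\<close>)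
    finally show "cmod (\<Sum>i<m. \<Sum>j<m. laurent_eval (dual_mat R c F i j) z * u j * cnj (v i))
      \<le> (1 + \<bar>c\<bar>) * B * ?N"
      by (simp add: algebra_simps)
  qed
qed

definition laurent_mat_mult :: "nat \<Rightarrow> (nat \<Rightarrow> nat \<Rightarrow> laurent) \<Rightarrow> (nat \<Rightarrow> nat \<Rightarrow> laurent) \<Rightarrow> nat \<Rightarrow> nat \<Rightarrow> laurent" where
  "laurent_mat_mult m F G i j = (\<Sum>k<m. F i k * G k j)"

lemma laurent_mat_bounded_mult:
  assumes "R > 1" "0 \<le> B" "laurent_mat_bounded m R F B" "laurent_mat_bounded m R G C"
  shows "laurent_mat_bounded m R (laurent_mat_mult m F G) (B * C)"
  unfolding laurent_mat_bounded_def mat_bounded_def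
proof (intro ballI allI)
  fix z x assume z: "z \<in> closed_annulus R"
  then have "z \<noteq> 0" using \<open>R > 1\<close> by (rule closed_annulus_nonzero)
  let ?y = "\<lambda>k. \<Sum>j<m. laurent_eval (G k j) z * x j"
  have "(\<Sum>j<m. laurent_eval (laurent_mat_mult m F G i j) z * x j) = (\<Sum>k<m. laurent_eval (F i k) z * ?y k)" for i
  proof -
    have "(\<Sum>j<m. laurent_eval (laurent_mat_mult m F G i j) z * x j)
        = (\<Sum>j<m. \<Sum>k<m. laurent_eval (F i k) z * (laurent_eval (G k j) z * x j))"
      using \<open>z \<noteq> 0\<close> by (simp add: laurent_mat_mult_def laurent_eval_sum laurent_eval_mult
          sum_distrib_right mult.assoc)
    also have "\<dots> = (\<Sum>k<m. \<Sum>j<m. laurent_eval (F i k) z * (laurent_eval (G k j) z * x j))"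
      by (rule sum.swap)
    finally show ?thesis by (simp add: sum_distrib_left)
  qed
  then have "fam_norm m (\<lambda>i. \<Sum>j<m. laurent_eval (laurent_mat_mult m F G i j) z * x j) \<le> B * fam_norm m ?y"
    using mat_boundedD[of m "\<lambda>i j x. laurent_eval (F i j) z * x" B ?y] assms(3) z
    by (simp add: laurent_mat_bounded_def)
  also have "\<dots> \<le> B * (C * fam_norm m x)"
    using assms(4) z by (intro mult_left_mono mat_boundedD assms(2)) (auto simp: laurent_mat_bounded_def)
  finally show "fam_norm m (\<lambda>i. \<Sum>j<m. laurent_eval (laurent_mat_mult m F G i j) z * x j) \<le> B * C * fam_norm m x"
    by (simp add: mult_ac)
qed

abbreviation laurent_mat_op where
  "laurent_mat_op F T \<equiv> (\<lambda>i j. laurent_op (F i j) T)"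

lemma op_mat_apply_mult:
  assumes T: "T \<in> bounded_ops" "op_invertible T"
  shows "op_mat_apply m (laurent_mat_op (laurent_mat_mult m F G) T) x
    = op_mat_apply m (laurent_mat_op F T) (op_mat_apply m (laurent_mat_op G T) x)"
proof
  fix i
  have "op_mat_apply m (laurent_mat_op (laurent_mat_mult m F G) T) x i
      = (\<Sum>j<m. \<Sum>k<m. laurent_op (F i k) T (laurent_op (G k j) T (x j)))"
    by (simp add: op_mat_apply_def laurent_mat_mult_def laurent_op_sum laurent_op_mult[OF T]
        blinfun.sum_left)
  also have "\<dots> = (\<Sum>k<m. \<Sum>j<m. laurent_op (F i k) T (laurent_op (G k j) T (x j)))"
    by (rule sum.swap)
  finally show "op_mat_apply m (laurent_mat_op (laurent_mat_mult m F G) T) x i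
    = op_mat_apply m (laurent_mat_op F T) (op_mat_apply m (laurent_mat_op G T) x) i"
    by (simp add: op_mat_apply_def blinfun.sum_right)
qed

definition laurent_calculus_bound :: "nat \<Rightarrow> real \<Rightarrow> ('a::complex_hilbert \<Rightarrow>\<^sub>L 'a) \<Rightarrow> real \<Rightarrow> bool" where
  "laurent_calculus_bound m R T M \<longleftrightarrow>
    (\<forall>F. laurent_mat_bounded m R F 1 \<longrightarrow> op_mat_bounded m (laurent_mat_op F T) M)"

lemma laurent_calculus_boundD:
  assumes M: "laurent_calculus_bound m R T M" and "R > 1" "B > 0" "laurent_mat_bounded m R F B"
  shows "op_mat_bounded m (laurent_mat_op F T) (M * B)"
proof -
  let ?G = "\<lambda>i j. lmonom 0 (1 / of_real B) * F i j"
  have G_eval: "laurent_eval (?G i j) z = laurent_eval (F i j) z / of_real B" if "z \<noteq> 0" for i j z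
    using that by (simp add: laurent_eval_mult laurent_eval_monom)
  have scaleR_eq: "(\<Sum>j<m. laurent_eval (?G i j) z * x j) = (1 / B) *\<^sub>R (\<Sum>j<m. laurent_eval (F i j) z * x j)"
    if "z \<noteq> 0" for i z x
    unfolding G_eval[OF that] by (simp add: scaleR_conv_of_real sum_distrib_left)
  have "laurent_mat_bounded m R ?G 1"
    unfolding laurent_mat_bounded_def mat_bounded_def
  proof (intro ballI allI)
    fix z x assume z: "z \<in> closed_annulus R"
    then have "z \<noteq> 0" using \<open>R > 1\<close> by (rule closed_annulus_nonzero)
    show "fam_norm m (\<lambda>i. \<Sum>j<m. laurent_eval (?G i j) z * x j) \<le> 1 * fam_norm m x"
      unfolding scaleR_eq[OF \<open>z \<noteq> 0\<close>] fam_norm_scaleR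
      using mat_boundedD[of m "\<lambda>i j x. laurent_eval (F i j) z * x" B x] z assms(3,4)
      by (simp add: laurent_mat_bounded_def field_simps)
  qed
  then have G: "op_mat_bounded m (laurent_mat_op ?G T) M"
    using M by (simp add: laurent_calculus_bound_def)
  have "laurent_op (?G i j) T = (1 / B) *\<^sub>R laurent_op (F i j) T" for i j
    unfolding laurent_op_scale by (rule blinfun_eqI) (simp add: blinfun.scaleR_left scaleR_scaleC)
  then have "op_mat_apply m (laurent_mat_op ?G T) x = (\<lambda>i. (1 / B) *\<^sub>R op_mat_apply m (laurent_mat_op F T) x i)" for x
    by (simp add: op_mat_apply_def blinfun.scaleR_left scaleR_right.sum)
  then show ?thesis
    using op_mat_boundedD[OF G] \<open>B > 0\<close>
    by (intro op_mat_boundedI) (simp add: fam_norm_scaleR field_simps)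
qed

text \<open>With \<open>A = F(T)\<close> and \<open>H\<close> the dual matrix, \<open>A\<^sup>* = (2 + c) S(F)\<^sup>* - H(T)\<close>, so that
  \<open>A A\<^sup>* A = (2 + c) A S(F)\<^sup>* A - (F H F)(T)\<close>. Here \<open>F H F\<close> is again a matrix of Laurent polynomials,
  of sup norm at most \<open>1 + |c|\<close>, and the bound \<open>M\<close> applies to it too.\<close>

lemma laurent_calculus_bound_step:
  assumes "R > 1" "c > -2" and T: "T \<in> bounded_ops" "op_invertible T"
    and contr: "\<And>F. laurent_mat_bounded m R F 1 \<Longrightarrow> op_mat_bounded m (\<lambda>i j. laurent_S R c T (F i j)) 1"
    and M: "laurent_calculus_bound m R T M" "M \<ge> 0"
    and M': "M' \<ge> 0" "M' ^ 4 = (2 + c) * M ^ 3 + (1 + \<bar>c\<bar>) * M\<^sup>2"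
  shows "laurent_calculus_bound m R T M'"
  unfolding laurent_calculus_bound_def
proof (intro allI impI op_mat_boundedI)
  fix F x assume F: "laurent_mat_bounded m R F 1"
  let ?A = "laurent_mat_op F T" and ?H = "laurent_mat_op (dual_mat R c F) T"
  let ?S = "\<lambda>i j. adj (laurent_S R c T (F j i))" and ?Aa = "\<lambda>i j. adj (laurent_op (F j i) T)"
  define y where "y = op_mat_apply m ?A x"
  define w where "w = op_mat_apply m ?Aa y"
  let ?n = "fam_norm m"
  have ops: "laurent_op f T \<in> bounded_ops" for f using T by (rule laurent_op_in_bounded_ops)
  have S_ops: "laurent_S R c T f \<in> bounded_ops" for f
    by (simp add: laurent_S_def ops adj_in_bounded_ops)
  have A: "?n (op_mat_apply m ?A v) \<le> M * ?n v" for v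
    using M F by (intro op_mat_boundedD) (auto simp: laurent_calculus_bound_def)
  have S: "?n (op_mat_apply m ?S v) \<le> 1 * ?n v" for v
    by (intro op_mat_boundedD op_mat_bounded_adj contr F S_ops) auto
  have adj_eq: "?Aa i j = (2 + c) *\<^sub>R ?S i j - ?H i j" for i j
    using \<open>c > -2\<close>
    by (simp add: laurent_S_def dual_mat_def adj_simps adj_adj ops adj_in_bounded_ops
        laurent_op_add laurent_op_const)
  have w_eq: "w = (\<lambda>i. (2 + c) *\<^sub>R op_mat_apply m ?S y i - op_mat_apply m ?H y i)"
    unfolding w_def adj_eq
    by (simp add: op_mat_apply_def blinfun.diff_left blinfun.scaleR_left sum_subtractf scaleR_right.sum)
  let ?P = "laurent_mat_mult m F (laurent_mat_mult m (dual_mat R c F) F)"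
  have "laurent_mat_bounded m R ?P (1 * ((1 + \<bar>c\<bar>) * 1 * 1))"
    by (intro laurent_mat_bounded_mult laurent_mat_bounded_dual F \<open>R > 1\<close>) auto
  then have P: "?n (op_mat_apply m (laurent_mat_op ?P T) x) \<le> M * (1 + \<bar>c\<bar>) * ?n x"
    by (intro op_mat_boundedD laurent_calculus_boundD[OF M(1) \<open>R > 1\<close>]) auto
  have "op_mat_apply m ?A w = (\<lambda>i. (2 + c) *\<^sub>R op_mat_apply m ?A (op_mat_apply m ?S y) i
      - op_mat_apply m (laurent_mat_op ?P T) x i)"
    unfolding op_mat_apply_mult[OF T] w_eq y_def[symmetric]
    by (simp add: op_mat_apply_def[of m ?A] blinfun.diff_right blinfun.scaleR_right sum_subtractf scaleR_right.sum)
  then have "?n (op_mat_apply m ?A w)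
      \<le> (2 + c) * ?n (op_mat_apply m ?A (op_mat_apply m ?S y)) + ?n (op_mat_apply m (laurent_mat_op ?P T) x)"
    using fam_norm_diff[of m "\<lambda>i. (2 + c) *\<^sub>R op_mat_apply m ?A (op_mat_apply m ?S y) i"
        "op_mat_apply m (laurent_mat_op ?P T) x"] \<open>c > -2\<close>
    by (simp add: fam_norm_scaleR)
  also have "\<dots> \<le> (2 + c) * (M * ?n y) + M * (1 + \<bar>c\<bar>) * ?n x"
    using \<open>c > -2\<close> M(2) S[of y]
    by (intro add_mono P mult_left_mono order_trans[OF A]) auto
  also have "\<dots> \<le> (2 + c) * (M * (M * ?n x)) + M * (1 + \<bar>c\<bar>) * ?n x"
    using \<open>c > -2\<close> M(2) A[of x] by (intro add_right_mono mult_left_mono) (auto simp: y_def)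
  finally have Aw: "?n (op_mat_apply m ?A w) \<le> ((2 + c) * M\<^sup>2 + (1 + \<bar>c\<bar>) * M) * ?n x"
    by (simp add: algebra_simps power2_eq_square)
  have "(?n w)\<^sup>2 = cmod (fam_inner m (op_mat_apply m ?A w) y)"
    by (simp add: fam_inner_adj ops w_def[symmetric] fam_inner_self norm_power)
  also have "\<dots> \<le> ?n (op_mat_apply m ?A w) * ?n y" by (rule fam_cauchy_schwarz)
  also have "\<dots> \<le> (((2 + c) * M\<^sup>2 + (1 + \<bar>c\<bar>) * M) * ?n x) * (M * ?n x)"
    using A[of x] \<open>c > -2\<close> M(2) by (intro mult_mono Aw) (auto simp: y_def)
  also have "\<dots> = M' ^ 4 * (?n x)\<^sup>2"
    unfolding M'(2) by (simp add: algebra_simps power2_eq_square power3_eq_cube)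
  finally have w: "(?n w)\<^sup>2 \<le> M' ^ 4 * (?n x)\<^sup>2" .
  have "(?n y)\<^sup>2 = cmod (fam_inner m x w)"
    by (simp add: w_def fam_inner_adj[symmetric] ops y_def[symmetric] fam_inner_self norm_power)
  also have "\<dots> \<le> ?n x * ?n w" by (rule fam_cauchy_schwarz)
  finally have "((?n y)\<^sup>2)\<^sup>2 \<le> (?n x * ?n w)\<^sup>2" by (rule power_mono) simp
  also have "\<dots> \<le> (?n x)\<^sup>2 * (M' ^ 4 * (?n x)\<^sup>2)"
    unfolding power_mult_distrib using w by (intro mult_left_mono) auto
  finally have "(?n y) ^ 4 \<le> (M' * ?n x) ^ 4"
    by (simp add: power_mult_distrib power4_eq_xxxx power2_eq_square mult_ac)
  then show "?n (op_mat_apply m ?A x) \<le> M' * ?n x"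
    using M'(1) by (simp add: y_def power_mono_iff)
qed

text \<open>The infimum \<open>M\<close> of all bounds is itself a bound, so the previous step cannot improve it:
  \<open>M\<^sup>4 \<le> (2 + c) M\<^sup>3 + (1 + |c|) M\<^sup>2\<close>. The constant \<open>K\<close> is the positive root of
  \<open>M\<^sup>2 = (2 + c) M + 1 + |c|\<close>. The bound \<open>M1\<close> makes the set of bounds
  nonempty.\<close>

lemma laurent_calculus_bound_K:
  assumes "R > 1" "c > -2" and T: "T \<in> bounded_ops" "op_invertible T"
    and contr: "\<And>F. laurent_mat_bounded m R F 1 \<Longrightarrow> op_mat_bounded m (\<lambda>i j. laurent_S R c T (F i j)) 1"
    and fin: "laurent_calculus_bound m R T M1"
  shows "laurent_calculus_bound m R T (1 + c / 2 + sqrt ((1 + c / 2)\<^sup>2 + 1 + \<bar>c\<bar>))"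
proof -
  define Ms where "Ms = {M. M \<ge> 0 \<and> laurent_calculus_bound m R T M}"
  define M where "M = Inf Ms"
  have "max 0 M1 \<in> Ms" using fin
    by (auto simp: Ms_def laurent_calculus_bound_def intro: mat_bounded_mono)
  then have ne: "Ms \<noteq> {}" by blast
  have bdd: "bdd_below Ms" by (auto simp: Ms_def intro: bdd_belowI)
  have "M \<ge> 0" unfolding M_def using ne by (rule cInf_greatest) (auto simp: Ms_def)
  have M: "laurent_calculus_bound m R T M"
    unfolding laurent_calculus_bound_def
  proof (intro allI impI op_mat_boundedI)
    fix F x assume F: "laurent_mat_bounded m R F 1"
    let ?y = "op_mat_apply m (laurent_mat_op F T) x"
    have le: "fam_norm m ?y \<le> N * fam_norm m x" if "N \<in> Ms" for N
      using that F by (auto simp: Ms_def laurent_calculus_bound_def intro: op_mat_boundedD)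
    show "fam_norm m ?y \<le> M * fam_norm m x"
    proof (cases "fam_norm m x = 0")
      case True
      then show ?thesis using le[OF \<open>max 0 M1 \<in> Ms\<close>] by simp
    next
      case False
      then have pos: "fam_norm m x > 0" using fam_norm_nonneg[of m x] by linarith
      have "fam_norm m ?y / fam_norm m x \<le> M"
        unfolding M_def using ne by (rule cInf_greatest) (use le pos in \<open>simp add: field_simps\<close>)
      then show ?thesis using pos by (simp add: field_simps)
    qed
  qed
  let ?C = "(2 + c) * M ^ 3 + (1 + \<bar>c\<bar>) * M\<^sup>2"
  have "?C \<ge> 0" using \<open>c > -2\<close> \<open>M \<ge> 0\<close> by simp
  then have "root 4 ?C \<in> Ms"
    unfolding Ms_def using laurent_calculus_bound_step[OF assms(1-5) M \<open>M \<ge> 0\<close>, of "root 4 ?C"] by simp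
  then have "M \<le> root 4 ?C" unfolding M_def by (rule cInf_lower) (rule bdd)
  then have "M ^ 4 \<le> root 4 ?C ^ 4" using \<open>M \<ge> 0\<close> by (intro power_mono)
  then have le: "M ^ 4 \<le> ?C" using \<open>?C \<ge> 0\<close> by simp
  have "M \<le> 1 + c / 2 + sqrt ((1 + c / 2)\<^sup>2 + 1 + \<bar>c\<bar>)"
  proof (cases "M = 0")
    case True
    then show ?thesis using \<open>c > -2\<close> by simp
  next
    case False
    then have "M > 0" using \<open>M \<ge> 0\<close> by simp
    have "M\<^sup>2 * M\<^sup>2 \<le> M\<^sup>2 * ((2 + c) * M + (1 + \<bar>c\<bar>))"
      using le by (simp add: algebra_simps power4_eq_xxxx power2_eq_square power3_eq_cube)
    then have "M\<^sup>2 \<le> (2 + c) * M + (1 + \<bar>c\<bar>)"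
      by (rule mult_left_le_imp_le) (use \<open>M > 0\<close> in simp)
    then have "(M - (1 + c / 2))\<^sup>2 \<le> (1 + c / 2)\<^sup>2 + 1 + \<bar>c\<bar>"
      by (simp add: power2_eq_square algebra_simps)
    then have "M - (1 + c / 2) \<le> sqrt ((1 + c / 2)\<^sup>2 + 1 + \<bar>c\<bar>)" by (rule real_le_rsqrt)
    then show ?thesis by simp
  qed
  then show ?thesis using M by (auto simp: laurent_calculus_bound_def intro: mat_bounded_mono)
qed

section \<open>Growth of the powers of an operator\<close>

abbreviation op_pow :: "('a::complex_hilbert \<Rightarrow>\<^sub>L 'a) \<Rightarrow> nat \<Rightarrow> ('a \<Rightarrow>\<^sub>L 'a)" where
  "op_pow X k \<equiv> (((o\<^sub>L) X) ^^ k) id_blinfun"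

lemma op_powi_of_nat: "op_powi T (int k) = op_pow T k"
  by (simp add: op_powi_def)

lemma op_powi_minus_of_nat: "op_powi T (- int k) = op_pow (op_inverse T) k"
  by (cases k) (auto simp: op_powi_def nat_add_distrib)

lemma op_pow_in_bounded_ops [simp]: "X \<in> bounded_ops \<Longrightarrow> op_pow X k \<in> bounded_ops"
  by (induction k) auto

lemma norm_op_pow_le: "norm (op_pow X k) \<le> norm X ^ k"
proof (induction k)
  case (Suc k)
  have "norm (op_pow X (Suc k)) \<le> norm X * norm (op_pow X k)"
    by (simp add: norm_blinfun_compose)
  also have "\<dots> \<le> norm X * norm X ^ k" using Suc by (rule mult_left_mono) simp
  finally show ?case by simp
qed (simp add: norm_blinfun_id_le)

lemma op_pow_scale:
  assumes "T \<in> bounded_ops"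
  shows "op_pow (scalar_op z o\<^sub>L T) k = scalar_op (z ^ k) o\<^sub>L op_pow T k"
proof (induction k)
  case 0
  show ?case by (rule blinfun_eqI) simp
next
  case (Suc k)
  then show ?case
    by (intro blinfun_eqI) (simp add: op_scaleC assms scaleC_scaleC)
qed

lemma op_pow_Suc_right: "op_pow X k o\<^sub>L X = X o\<^sub>L op_pow X k"
  by (induction k) (auto simp: blinfun_compose_assoc)

lemma closed_bounded_ops: "closed (bounded_ops :: ('a::complex_hilbert \<Rightarrow>\<^sub>L 'a) set)"
proof -
  have "closed {T :: 'a \<Rightarrow>\<^sub>L 'a. T (a *\<^sub>C x) = a *\<^sub>C T x}" for a x
    by (intro closed_Collect_eq continuous_intros
        bounded_linear.continuous_on[OF bounded_linear_scaleC])
  then have "closed (\<Inter>a. \<Inter>x. {T :: 'a \<Rightarrow>\<^sub>L 'a. T (a *\<^sub>C x) = a *\<^sub>C T x})" by blast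
  also have "(\<Inter>a. \<Inter>x. {T :: 'a \<Rightarrow>\<^sub>L 'a. T (a *\<^sub>C x) = a *\<^sub>C T x}) = bounded_ops"
    by (auto simp: bounded_ops_def)
  finally show ?thesis .
qed

lemma tendsto_blinfun_compose:
  "(f \<longlongrightarrow> X) F \<Longrightarrow> (g \<longlongrightarrow> Y) F \<Longrightarrow> ((\<lambda>i. f i o\<^sub>L g i) \<longlongrightarrow> X o\<^sub>L Y) F"
  by (rule bounded_bilinear.tendsto[OF bounded_bilinear_blinfun_compose])

lemma
  assumes "op_invertible X" "op_invertible Y"
  shows op_invertible_compose: "op_invertible (X o\<^sub>L Y)"
    and op_inverse_compose: "op_inverse (X o\<^sub>L Y) = op_inverse Y o\<^sub>L op_inverse X"
proof -
  have "op_inverse Y o\<^sub>L op_inverse X o\<^sub>L (X o\<^sub>L Y) = op_inverse Y o\<^sub>L (op_inverse X o\<^sub>L X) o\<^sub>L Y"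
    "X o\<^sub>L Y o\<^sub>L (op_inverse Y o\<^sub>L op_inverse X) = X o\<^sub>L (Y o\<^sub>L op_inverse Y) o\<^sub>L op_inverse X"
    by (simp_all only: blinfun_compose_assoc)
  then have *: "op_inverse Y o\<^sub>L op_inverse X \<in> bounded_ops"
    "op_inverse Y o\<^sub>L op_inverse X o\<^sub>L (X o\<^sub>L Y) = id_blinfun"
    "X o\<^sub>L Y o\<^sub>L (op_inverse Y o\<^sub>L op_inverse X) = id_blinfun"
    by (auto simp: assms op_inverse_left op_inverse_right op_inverse_in_bounded_ops)
  then show "op_invertible (X o\<^sub>L Y)" unfolding op_invertible_def by blast
  show "op_inverse (X o\<^sub>L Y) = op_inverse Y o\<^sub>L op_inverse X" using * by (rule op_inverse_eqI)
qed

lemma scalar_op_one: "scalar_op 1 = id_blinfun"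
  by (rule blinfun_eqI) simp

lemma op_invertible_scalar_op: "a \<noteq> 0 \<Longrightarrow> op_invertible (scalar_op a)"
  unfolding op_invertible_def
  by (intro bexI[of _ "scalar_op (1 / a)"]) (simp_all add: scalar_op_one flip: scalar_op_mult)

lemma op_invertible_op_inverse:
  "X \<in> bounded_ops \<Longrightarrow> op_invertible X \<Longrightarrow> op_invertible (op_inverse X)"
  using op_inverse_left op_inverse_right by (auto simp: op_invertible_def[of "op_inverse X"])

lemma geometric_partial_sum:
  "(\<Sum>k<n. op_pow X k) o\<^sub>L (id_blinfun - X) = id_blinfun - op_pow X n"
  "(id_blinfun - X) o\<^sub>L (\<Sum>k<n. op_pow X k) = id_blinfun - op_pow X n"
proof (induction n)
  case (Suc n)
  {
    case 1
    have "(\<Sum>k<Suc n. op_pow X k) o\<^sub>L (id_blinfun - X)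
        = ((\<Sum>k<n. op_pow X k) o\<^sub>L (id_blinfun - X)) + (op_pow X n o\<^sub>L (id_blinfun - X))"
      by (simp only: sum.lessThan_Suc blinfun_compose_simps(1))
    then show ?case unfolding Suc by (simp add: blinfun_compose_simps(4) op_pow_Suc_right)
  next
    case 2
    have "(id_blinfun - X) o\<^sub>L (\<Sum>k<Suc n. op_pow X k)
        = ((id_blinfun - X) o\<^sub>L (\<Sum>k<n. op_pow X k)) + ((id_blinfun - X) o\<^sub>L op_pow X n)"
      by (simp only: sum.lessThan_Suc blinfun_compose_simps(2))
    then show ?case unfolding Suc by (simp add: blinfun_compose_simps(3))
  }
qed auto

lemma neumann_partial_sum:
  assumes "op_invertible (id_blinfun - X)"
  shows "(\<Sum>k<n. op_pow X k) = op_inverse (id_blinfun - X) - (op_inverse (id_blinfun - X) o\<^sub>L op_pow X n)"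
proof -
  have "(\<Sum>k<n. op_pow X k)
      = op_inverse (id_blinfun - X) o\<^sub>L ((id_blinfun - X) o\<^sub>L (\<Sum>k<n. op_pow X k))"
    by (simp add: op_inverse_left[OF assms] flip: blinfun_compose_assoc)
  then show ?thesis by (simp only: geometric_partial_sum blinfun_compose_simps(4) blinfun_compose_id)
qed

lemma neumann_sums:
  assumes "op_invertible (id_blinfun - X)" "(\<lambda>n. op_pow X n) \<longlonglongrightarrow> 0"
  shows "(\<lambda>k. op_pow X k) sums op_inverse (id_blinfun - X)"
proof -
  let ?Y = "op_inverse (id_blinfun - X)"
  have "(\<lambda>n. ?Y - (?Y o\<^sub>L op_pow X n)) \<longlonglongrightarrow> ?Y - (?Y o\<^sub>L 0)"
    by (intro tendsto_diff tendsto_const tendsto_blinfun_compose assms)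
  then show ?thesis by (simp add: sums_def neumann_partial_sum[OF assms(1)])
qed

lemma op_pow_tendsto_zero: "norm X < 1 \<Longrightarrow> (\<lambda>n. op_pow X n) \<longlonglongrightarrow> 0"
  by (rule Lim_null_comparison[OF _ LIMSEQ_power_zero[of "norm X"]]) (auto simp: norm_op_pow_le)

lemma op_invertible_id_minus:
  assumes "X \<in> bounded_ops" "norm X < 1"
  shows "op_invertible (id_blinfun - X)"
proof -
  have "summable (\<lambda>k. op_pow X k)"
    using assms(2) by (intro summable_comparison_test[OF _ summable_geometric[of "norm X"]])
      (auto simp: norm_op_pow_le)
  then have lim: "(\<lambda>n. \<Sum>k<n. op_pow X k) \<longlonglongrightarrow> suminf (op_pow X)"
    by (simp add: summable_LIMSEQ)
  have lim_id: "(\<lambda>n. id_blinfun - op_pow X n) \<longlonglongrightarrow> id_blinfun - 0"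
    by (intro tendsto_diff tendsto_const op_pow_tendsto_zero assms)
  have "suminf (op_pow X) \<in> bounded_ops"
    by (rule Lim_in_closed_set[OF closed_bounded_ops _ _ lim]) (use assms in auto)
  moreover have "suminf (op_pow X) o\<^sub>L (id_blinfun - X) = id_blinfun"
    using LIMSEQ_unique[OF tendsto_blinfun_compose[OF lim tendsto_const[of "id_blinfun - X"]]] lim_id
    by (simp add: geometric_partial_sum)
  moreover have "(id_blinfun - X) o\<^sub>L suminf (op_pow X) = id_blinfun"
    using LIMSEQ_unique[OF tendsto_blinfun_compose[OF tendsto_const[of "id_blinfun - X"] lim]] lim_id
    by (simp add: geometric_partial_sum)
  ultimately show ?thesis unfolding op_invertible_def by blast
qed

lemma op_invertible_perturb:
  assumes "X \<in> bounded_ops" "Y \<in> bounded_ops" "op_invertible X" "norm (op_inverse X) * norm (X - Y) < 1"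
  shows "op_invertible Y"
proof -
  have "norm (op_inverse X o\<^sub>L (X - Y)) < 1"
    using norm_blinfun_compose assms(4) by (rule le_less_trans)
  then have "op_invertible (X o\<^sub>L (id_blinfun - (op_inverse X o\<^sub>L (X - Y))))"
    by (intro op_invertible_compose op_invertible_id_minus assms)
      (auto simp: assms op_inverse_in_bounded_ops)
  also have "X o\<^sub>L (id_blinfun - (op_inverse X o\<^sub>L (X - Y))) = Y"
    by (simp add: blinfun_compose_simps op_inverse_right assms flip: blinfun_compose_assoc)
  finally show ?thesis .
qed

lemma open_op_invertible_affine:
  assumes X: "\<And>z. X z \<in> bounded_ops" and lip: "\<And>z w. norm (X z - X w) \<le> L * cmod (z - w)"
  shows "open {z. op_invertible (X z)}"
  unfolding open_dist
proof safe
  fix z assume z: "op_invertible (X z)"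
  have "L \<ge> 0" using order_trans[OF norm_ge_zero lip[of 1 0]] by simp
  define e where "e = 1 / (norm (op_inverse (X z)) * L + 1)"
  have pos: "norm (op_inverse (X z)) * L + 1 > 0" using \<open>L \<ge> 0\<close> by (simp add: add_nonneg_pos)
  show "\<exists>e>0. \<forall>y. dist y z < e \<longrightarrow> y \<in> {z. op_invertible (X z)}"
  proof (intro exI[of _ e] conjI allI impI CollectI)
    show "0 < e" using pos by (simp add: e_def)
    fix y assume y: "dist y z < e"
    show "op_invertible (X y)"
    proof (rule op_invertible_perturb[OF X X z])
      have "norm (op_inverse (X z)) * norm (X z - X y) \<le> norm (op_inverse (X z)) * (L * cmod (z - y))"
        by (intro mult_left_mono lip) auto
      also have "\<dots> \<le> (norm (op_inverse (X z)) * L + 1) * cmod (z - y)"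
        by (simp add: algebra_simps)
      also have "\<dots> < (norm (op_inverse (X z)) * L + 1) * e"
        using y pos by (intro mult_strict_left_mono) (auto simp: dist_norm norm_minus_commute)
      also have "\<dots> = 1" using pos by (simp add: e_def)
      finally show "norm (op_inverse (X z)) * norm (X z - X y) < 1" .
    qed
  qed
qed

lemma op_inverse_diff:
  assumes "op_invertible X" "op_invertible Y"
  shows "op_inverse X - op_inverse Y = op_inverse X o\<^sub>L (Y - X) o\<^sub>L op_inverse Y"
proof -
  have "op_inverse X o\<^sub>L (Y - X) o\<^sub>L op_inverse Y
      = (op_inverse X o\<^sub>L (Y o\<^sub>L op_inverse Y)) - ((op_inverse X o\<^sub>L X) o\<^sub>L op_inverse Y)"
    by (simp only: blinfun_compose_simps(3,4) blinfun_compose_assoc)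
  then show ?thesis by (simp add: op_inverse_left op_inverse_right assms)
qed

text \<open>The function \<open>z \<mapsto> (1 - z T)\<^sup>-\<^sup>1\<close> is weakly holomorphic by the resolvent identity, and its
  Taylor coefficients at the origin are the powers of \<open>T\<close>; Cauchy's inequalities then bound them.\<close>

lemma op_pow_bound:
  fixes T :: "'a::complex_hilbert \<Rightarrow>\<^sub>L 'a"
  assumes T: "T \<in> bounded_ops" and "\<rho> > 0"
    and inv: "\<And>z. cmod z \<le> 1 / \<rho> \<Longrightarrow> op_invertible (id_blinfun - (scalar_op z o\<^sub>L T))"
  shows "\<exists>C\<ge>0. \<forall>n. norm (op_pow T n) \<le> C * \<rho> ^ n"
proof -
  define U where "U = {z. op_invertible (id_blinfun - (scalar_op z o\<^sub>L T))}"
  define r where "r z = op_inverse (id_blinfun - (scalar_op z o\<^sub>L T))" for z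
  have diff: "(id_blinfun - (scalar_op z o\<^sub>L T)) - (id_blinfun - (scalar_op w o\<^sub>L T)) = scalar_op (w - z) o\<^sub>L T"
    for z w
    by (rule blinfun_eqI) (simp add: blinfun.diff_left algebra_simps flip: scaleC_add_left)
  have "open U"
    unfolding U_def
  proof (rule open_op_invertible_affine[where L = "norm T"])
    show "norm ((id_blinfun - (scalar_op z o\<^sub>L T)) - (id_blinfun - (scalar_op w o\<^sub>L T)))
        \<le> norm T * cmod (z - w)" for z w
      using norm_scalar_op_compose_le[of "w - z" T]
      by (simp add: diff norm_minus_commute[of z w] mult.commute)
  qed (use T in auto)
  have resolvent: "r z - r w = scalar_op (z - w) o\<^sub>L (r z o\<^sub>L T o\<^sub>L r w)" if "z \<in> U" "w \<in> U" for z w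
  proof -
    have r: "r z \<in> bounded_ops" using that by (simp add: U_def r_def op_inverse_in_bounded_ops)
    have "r z - r w = r z o\<^sub>L ((id_blinfun - (scalar_op w o\<^sub>L T)) - (id_blinfun - (scalar_op z o\<^sub>L T))) o\<^sub>L r w"
      using that unfolding r_def by (intro op_inverse_diff) (auto simp: U_def)
    also have "\<dots> = scalar_op (z - w) o\<^sub>L (r z o\<^sub>L T o\<^sub>L r w)"
      unfolding diff by (rule blinfun_eqI) (simp add: op_scaleC r)
    finally show ?thesis .
  qed
  have cont: "continuous (at w) r" if w: "w \<in> U" for w
  proof -
    define N where "N = norm T * norm (r w)"
    have N: "N \<ge> 0" by (simp add: N_def)
    have step: "norm (r z - r w) \<le> cmod (z - w) * norm (r z) * N" if "z \<in> U" for z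
    proof -
      have "norm (r z o\<^sub>L T o\<^sub>L r w) \<le> norm (r z) * norm T * norm (r w)"
        by (rule order_trans[OF norm_blinfun_compose mult_right_mono[OF norm_blinfun_compose]]) simp
      then have "cmod (z - w) * norm (r z o\<^sub>L T o\<^sub>L r w) \<le> cmod (z - w) * (norm (r z) * N)"
        by (intro mult_left_mono) (auto simp: N_def mult.assoc)
      then show ?thesis
        unfolding resolvent[OF that w] mult.assoc by (rule order_trans[OF norm_scalar_op_compose_le])
    qed
    have ev: "eventually (\<lambda>z. norm (r z - r w) \<le> cmod (z - w) * (2 * norm (r w) * N)) (at w)"
    proof -
      have "eventually (\<lambda>z. z \<in> U) (at w)" using \<open>open U\<close> w by (rule eventually_at_in_open')
      moreover have "eventually (\<lambda>z. z \<in> ball w (1 / (2 * (N + 1)))) (at w)"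
        using N by (intro eventually_at_in_open') auto
      ultimately show ?thesis
      proof eventually_elim
        case (elim z)
        have "cmod (z - w) * (N + 1) \<le> 1 / 2"
          using elim(2) N by (simp add: dist_norm norm_minus_commute field_simps)
        then have "cmod (z - w) * N \<le> 1 / 2"
          by (rule order_trans[rotated]) (simp add: mult_left_mono)
        then have "norm (r z) * (cmod (z - w) * N) \<le> norm (r z) * (1 / 2)"
          by (rule mult_left_mono) simp
        then have "norm (r z - r w) \<le> norm (r z) / 2" using step[OF elim(1)] by (simp add: mult_ac)
        then have "norm (r z) \<le> 2 * norm (r w)" using norm_triangle_ineq2[of "r z" "r w"] by linarith
        then have "cmod (z - w) * norm (r z) * N \<le> cmod (z - w) * (2 * norm (r w)) * N"
          using N by (intro mult_left_mono mult_right_mono) auto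
        then show ?case using step[OF elim(1)] by (simp add: mult_ac)
      qed
    qed
    have "((\<lambda>z. cmod (z - w) * (2 * norm (r w) * N)) \<longlongrightarrow> cmod (w - w) * (2 * norm (r w) * N)) (at w)"
      by (intro tendsto_intros)
    then have "((\<lambda>z. r z - r w) \<longlongrightarrow> 0) (at w)"
      by (intro Lim_null_comparison[OF ev]) simp
    then show ?thesis unfolding continuous_at using Lim_null[of r] by blast
  qed
  have cball: "cball 0 (1 / \<rho>) \<subseteq> U" using inv by (auto simp: U_def)
  have "compact (r ` cball 0 (1 / \<rho>))"
    using cball by (intro compact_continuous_image continuous_at_imp_continuous_on ballI cont) auto
  then have "bounded (r ` cball 0 (1 / \<rho>))" by (rule compact_imp_bounded)
  then obtain C where C: "\<And>z. z \<in> cball 0 (1 / \<rho>) \<Longrightarrow> norm (r z) \<le> C"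
    unfolding bounded_iff by blast
  have C0: "C \<ge> 0" using order_trans[OF norm_ge_zero C[of 0]] \<open>\<rho> > 0\<close> by simp
  have weak: "cmod (cinner (op_pow T n x) y) \<le> C * \<rho> ^ n * (norm x * norm y)" for n x y
  proof -
    define f where "f z = cinner (r z x) y" for z
    define F where "F = Abs_fps (\<lambda>n. cinner (op_pow T n x) y)"
    have cont_r: "((\<lambda>z. r z v) \<longlongrightarrow> r w v) (at w)" if "w \<in> U" for w v
      using cont[OF that] unfolding continuous_at by (intro tendsto_intros)
    have der: "(f has_field_derivative cinner (r w (T (r w x))) y) (at w)" if w: "w \<in> U" for w
      unfolding has_field_derivative_iff
    proof (rule Lim_transform_eventually)
      show "((\<lambda>z. cinner (r z (T (r w x))) y) \<longlongrightarrow> cinner (r w (T (r w x))) y) (at w)"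
        by (intro bounded_linear.tendsto[OF bounded_linear_cinner_left] cont_r w)
      have "eventually (\<lambda>z. z \<in> U - {w}) (at w)" using \<open>open U\<close> w by (rule eventually_at_in_open)
      then show "eventually (\<lambda>z. cinner (r z (T (r w x))) y = (f z - f w) / (z - w)) (at w)"
      proof eventually_elim
        case (elim z)
        have "f z - f w = cinner ((r z - r w) x) y"
          by (simp add: f_def blinfun.diff_left cinner_diff_left)
        also have "\<dots> = (z - w) * cinner (r z (T (r w x))) y"
          using elim w by (simp add: resolvent cinner_scaleC_left)
        finally show ?case using elim by simp
      qed
    qed
    have hol: "f holomorphic_on U"
      using \<open>open U\<close> der by (auto simp: holomorphic_on_open)
    have "cmod ((deriv ^^ n) f 0) \<le> fact n * (C * (norm x * norm y)) / (1 / \<rho>) ^ n"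
    proof (rule Cauchy_inequality)
      show "f holomorphic_on ball 0 (1 / \<rho>)"
        by (rule holomorphic_on_subset[OF hol]) (use cball in auto)
      show "continuous_on (cball 0 (1 / \<rho>)) f"
        by (rule continuous_on_subset[OF holomorphic_on_imp_continuous_on[OF hol] cball])
      fix z :: complex assume "cmod (0 - z) = 1 / \<rho>"
      then have z: "z \<in> cball 0 (1 / \<rho>)" by simp
      have "cmod (f z) \<le> norm (r z x) * norm y" unfolding f_def by (rule cauchy_schwarz)
      also have "\<dots> \<le> (norm (r z) * norm x) * norm y" by (intro mult_right_mono norm_blinfun) auto
      also have "\<dots> \<le> (C * norm x) * norm y" using C[OF z] by (intro mult_right_mono) auto
      finally show "cmod (f z) \<le> C * (norm x * norm y)" by (simp add: mult.assoc)
    qed (use \<open>\<rho> > 0\<close> in auto)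
    moreover have "(deriv ^^ n) f 0 = fact n * cinner (op_pow T n x) y"
    proof -
      \<comment> \<open>for \<open>|z| < d\<close> the Neumann series of \<open>r z\<close> converges\<close>
      define d where "d = 1 / (norm T + 1)"
      have "norm T + 1 > 0" by (simp add: add_nonneg_pos)
      then have "d > 0" by (simp add: d_def)
      have sums: "(\<lambda>n. cinner (op_pow T n x) y * z ^ n) sums f z" if "cmod z < d" for z
      proof -
        have "cmod z * norm T \<le> cmod z * (norm T + 1)" by (simp add: mult_left_mono)
        also have "\<dots> < 1" using that \<open>norm T + 1 > 0\<close> by (simp add: d_def field_simps)
        finally have z: "norm (scalar_op z o\<^sub>L T) < 1"
          by (rule le_less_trans[OF norm_scalar_op_compose_le])
        then have "(\<lambda>k. op_pow (scalar_op z o\<^sub>L T) k) sums r z"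
          unfolding r_def using T
          by (intro neumann_sums op_invertible_id_minus op_pow_tendsto_zero) auto
        then have "(\<lambda>k. cinner (blinfun_apply (op_pow (scalar_op z o\<^sub>L T) k) x) y) sums cinner (r z x) y"
          by (intro bounded_linear.sums[OF bounded_linear_cinner_left]
              bounded_linear.sums[OF blinfun.bounded_linear_left])
        then show ?thesis
          by (simp add: op_pow_scale[OF T] cinner_scaleC_left f_def mult.commute)
      qed
      have "f has_fps_expansion F"
        unfolding has_fps_expansion_def
      proof
        have "ereal (cmod (of_real (d / 2))) \<le> fps_conv_radius F"
          unfolding fps_conv_radius_def F_def fps_nth_Abs_fps
          by (rule conv_radius_geI, rule sums_summable, rule sums) (use \<open>d > 0\<close> in \<open>simp del: of_real_divide\<close>)
        then show "0 < fps_conv_radius F"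
          using \<open>d > 0\<close> by (intro less_le_trans[OF _ \<open>_ \<le> fps_conv_radius F\<close>]) (simp del: of_real_divide)
        have "eventually (\<lambda>z. z \<in> ball 0 d) (nhds (0 :: complex))"
          using \<open>d > 0\<close> by (intro eventually_nhds_in_open) auto
        then show "eventually (\<lambda>z. eval_fps F z = f z) (nhds 0)"
          by eventually_elim (use sums in \<open>auto simp: eval_fps_def F_def sums_iff\<close>)
      qed
      from fps_nth_fps_expansion[OF this, of n] show ?thesis by (simp add: F_def)
    qed
    ultimately have "fact n * cmod (cinner (op_pow T n x) y) \<le> fact n * (C * \<rho> ^ n * (norm x * norm y))"
      using \<open>\<rho> > 0\<close> by (simp add: norm_mult power_one_over field_simps)
    then show ?thesis by simp
  qed
  have "norm (op_pow T n) \<le> C * \<rho> ^ n" for n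
    by (rule norm_le_of_cinner_bound[OF weak]) (use C0 \<open>\<rho> > 0\<close> in simp)
  with C0 show ?thesis by blast
qed

lemma scaleC_minus_one: "(- 1) *\<^sub>C v = - (v :: 'a :: complex_inner)"
  by (metis scaleR_minus1_left scaleR_scaleC of_real_minus of_real_1)

lemma op_invertible_of_zero_notin_spectrum:
  assumes "0 \<notin> spectrum T"
  shows "op_invertible T"
proof -
  have "op_invertible (scalar_op (- 1) o\<^sub>L (scalar_op 0 - T))"
    using assms by (intro op_invertible_compose op_invertible_scalar_op) (auto simp: spectrum_def)
  also have "scalar_op (- 1) o\<^sub>L (scalar_op 0 - T) = T"
    by (rule blinfun_eqI) (simp add: blinfun.diff_left scaleC_minus_one)
  finally show ?thesis .
qed

text \<open>Here \<open>1 - z T = z (1/z - T)\<close> and \<open>1 - z T\<^sup>-\<^sup>1 = - T\<^sup>-\<^sup>1 (z - T)\<close>, where neither \<open>1/z\<close> nor \<open>z\<close> lies in the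
  annulus.\<close>

lemma
  fixes T :: "'a::complex_hilbert \<Rightarrow>\<^sub>L 'a"
  assumes T: "T \<in> bounded_ops" and sp: "spectrum T \<subseteq> annulus \<rho>" and "\<rho> > 0"
  shows op_invertible_of_annulus: "op_invertible T"
    and op_invertible_id_minus_scaled:
      "cmod z \<le> 1 / \<rho> \<Longrightarrow> op_invertible (id_blinfun - (scalar_op z o\<^sub>L T))"
    and op_invertible_id_minus_scaled_inverse:
      "cmod z \<le> 1 / \<rho> \<Longrightarrow> op_invertible (id_blinfun - (scalar_op z o\<^sub>L op_inverse T))"
proof -
  have "0 \<notin> spectrum T" using sp \<open>\<rho> > 0\<close> by (auto simp: annulus_def)
  then show inv: "op_invertible T" by (rule op_invertible_of_zero_notin_spectrum)
  have resolvent: "op_invertible (scalar_op z - T)" if "z \<notin> annulus \<rho>" for z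
    using that sp by (auto simp: spectrum_def)
  show "op_invertible (id_blinfun - (scalar_op z o\<^sub>L T))" if z: "cmod z \<le> 1 / \<rho>"
  proof (cases "z = 0")
    case True
    then have "scalar_op z o\<^sub>L T = 0" by (intro blinfun_eqI) simp
    then show ?thesis by (intro op_invertible_id_minus) auto
  next
    case False
    have "op_invertible (scalar_op z o\<^sub>L (scalar_op (1 / z) - T))"
      using z \<open>\<rho> > 0\<close> False
      by (intro op_invertible_compose op_invertible_scalar_op resolvent)
        (auto simp: annulus_def norm_divide field_simps)
    also have "scalar_op z o\<^sub>L (scalar_op (1 / z) - T) = id_blinfun - (scalar_op z o\<^sub>L T)"
      using False by (intro blinfun_eqI) (simp add: blinfun.diff_left scaleC_diff_right scaleC_scaleC)
    finally show ?thesis .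
  qed
  show "op_invertible (id_blinfun - (scalar_op z o\<^sub>L op_inverse T))" if z: "cmod z \<le> 1 / \<rho>"
  proof -
    have "op_invertible (scalar_op (- 1) o\<^sub>L (op_inverse T o\<^sub>L (scalar_op z - T)))"
      using z by (intro op_invertible_compose op_invertible_scalar_op resolvent
          op_invertible_op_inverse T inv) (auto simp: annulus_def)
    also have "op_inverse T o\<^sub>L (scalar_op z - T) = (scalar_op z o\<^sub>L op_inverse T) - id_blinfun"
      by (simp add: blinfun_compose_simps op_inverse_left inv scalar_op_commute op_inverse_in_bounded_ops)
    also have "scalar_op (- 1) o\<^sub>L ((scalar_op z o\<^sub>L op_inverse T) - id_blinfun)
        = id_blinfun - (scalar_op z o\<^sub>L op_inverse T)"
      by (rule blinfun_eqI) (simp add: blinfun.diff_left scaleC_minus_one)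
    finally show ?thesis .
  qed
qed

lemma op_powi_bound:
  fixes T :: "'a::complex_hilbert \<Rightarrow>\<^sub>L 'a"
  assumes T: "T \<in> bounded_ops" and sp: "spectrum T \<subseteq> annulus \<rho>" and "\<rho> > 0"
  shows "\<exists>C\<ge>0. \<forall>n. norm (op_powi T n) \<le> C * \<rho> ^ nat \<bar>n\<bar>"
proof -
  note inv = op_invertible_of_annulus[OF assms]
  from op_pow_bound[OF T \<open>\<rho> > 0\<close> op_invertible_id_minus_scaled[OF assms]] obtain C1
    where C1: "C1 \<ge> 0" "\<And>n. norm (op_pow T n) \<le> C1 * \<rho> ^ n" by blast
  from op_pow_bound[OF op_inverse_in_bounded_ops[OF inv] \<open>\<rho> > 0\<close> op_invertible_id_minus_scaled_inverse[OF assms]] obtain C2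
    where C2: "C2 \<ge> 0" "\<And>n. norm (op_pow (op_inverse T) n) \<le> C2 * \<rho> ^ n" by blast
  have "norm (op_powi T n) \<le> max C1 C2 * \<rho> ^ nat \<bar>n\<bar>" for n
  proof (cases n rule: int_cases2)
    case (nonneg k)
    then show ?thesis
      using \<open>\<rho> > 0\<close> by (simp add: op_powi_of_nat order_trans[OF C1(2)] mult_right_mono)
  next
    case (nonpos k)
    then show ?thesis
      using \<open>\<rho> > 0\<close> by (simp add: op_powi_minus_of_nat order_trans[OF C2(2)] mult_right_mono)
  qed
  then show ?thesis using C1(1) by (intro exI[of _ "max C1 C2"]) auto
qed

lemma closed_spectrum:
  assumes "T \<in> bounded_ops"
  shows "closed (spectrum T)"
proof -
  have diff: "(scalar_op z - T) - (scalar_op w - T) = scalar_op (z - w)" for z w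
    by (rule blinfun_eqI) (simp add: blinfun.diff_left algebra_simps flip: scaleC_add_left)
  have "open {z. op_invertible (scalar_op z - T)}"
    by (rule open_op_invertible_affine[where L = 1])
      (use assms norm_scalar_op_le in \<open>auto simp: diff\<close>)
  moreover have "- spectrum T = {z. op_invertible (scalar_op z - T)}" by (auto simp: spectrum_def)
  ultimately show ?thesis by (simp add: closed_def)
qed

lemma spectrum_in_smaller_annulus:
  assumes T: "T \<in> bounded_ops" and sp: "spectrum T \<subseteq> annulus R" and "R > 1"
  obtains \<rho> where "1 < \<rho>" "\<rho> < R" "spectrum T \<subseteq> annulus \<rho>"
proof -
  let ?f = "\<lambda>z. max 1 (max (cmod z) (1 / cmod z))"
  have f: "?f z < R" if "z \<in> spectrum T" for z
  proof -
    have z: "1 / R < cmod z" "cmod z < R" using sp that by (auto simp: annulus_def)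
    then have "cmod z > 0" using \<open>R > 1\<close> less_trans[of 0 "1 / R" "cmod z"] by simp
    then have "1 / cmod z < R" using z(1) \<open>R > 1\<close> by (simp add: field_simps)
    then show ?thesis using z \<open>R > 1\<close> by simp
  qed
  have "\<exists>s\<ge>1. s < R \<and> (\<forall>z\<in>spectrum T. ?f z \<le> s)"
  proof (cases "spectrum T = {}")
    case False
    have "compact (spectrum T)"
      unfolding compact_eq_bounded_closed
    proof
      show "bounded (spectrum T)" using f unfolding bounded_iff by (intro exI[of _ R]) force
    qed (rule closed_spectrum[OF T])
    moreover have "continuous_on (spectrum T) ?f"
      using sp \<open>R > 1\<close> by (intro continuous_intros) (force simp: annulus_def)
    ultimately obtain z where "z \<in> spectrum T" "\<forall>w\<in>spectrum T. ?f w \<le> ?f z"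
      using continuous_attains_sup[OF _ False] by blast
    then show ?thesis using f by (intro exI[of _ "?f z"]) auto
  qed (use \<open>R > 1\<close> in auto)
  then obtain s where s: "s \<ge> 1" "s < R" "\<And>z. z \<in> spectrum T \<Longrightarrow> ?f z \<le> s" by blast
  show ?thesis
  proof (rule that[of "(s + R) / 2"])
    show "spectrum T \<subseteq> annulus ((s + R) / 2)"
    proof
      fix z assume z: "z \<in> spectrum T"
      then have "z \<noteq> 0" using sp \<open>R > 1\<close> by (force simp: annulus_def)
      have "cmod z < (s + R) / 2" "1 / cmod z < (s + R) / 2" using s(2) s(3)[OF z] by auto
      then show "z \<in> annulus ((s + R) / 2)"
        using \<open>z \<noteq> 0\<close> s by (auto simp: annulus_def field_simps)
    qed
  qed (use s in auto)
qed

lemma sum_powers_abs_le: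
  assumes "0 \<le> q" "q < (1 :: real)" "finite S"
  shows "(\<Sum>n\<in>S. q ^ nat \<bar>n\<bar>) \<le> 2 / (1 - q)"
proof -
  define N where "N = nat (Max (insert 0 (abs ` S))) + 1"
  have N: "nat \<bar>n\<bar> < N" if "n \<in> S" for n
  proof -
    have "\<bar>n\<bar> \<le> Max (insert 0 (abs ` S))" using that assms(3) by (intro Max_ge) auto
    then show ?thesis by (simp add: N_def)
  qed
  have "S \<subseteq> int ` {..<N} \<union> (\<lambda>k. - int k) ` {..<N}"
  proof
    fix n assume "n \<in> S"
    then show "n \<in> int ` {..<N} \<union> (\<lambda>k. - int k) ` {..<N}"
      using N[of n] by (cases n rule: int_cases2) auto
  qed
  then have "(\<Sum>n\<in>S. q ^ nat \<bar>n\<bar>) \<le> (\<Sum>n\<in>int ` {..<N} \<union> (\<lambda>k. - int k) ` {..<N}. q ^ nat \<bar>n\<bar>)"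
    using assms by (intro sum_mono2) auto
  also have "\<dots> \<le> (\<Sum>n\<in>int ` {..<N}. q ^ nat \<bar>n\<bar>) + (\<Sum>n\<in>(\<lambda>k. - int k) ` {..<N}. q ^ nat \<bar>n\<bar>)"
    using assms by (subst sum.union_inter[symmetric]) (auto intro!: sum_nonneg)
  also have "\<dots> = 2 * (\<Sum>k<N. q ^ k)"
    by (subst (1 2) sum.reindex) (auto simp: inj_on_def)
  also have "(\<Sum>k<N. q ^ k) \<le> 1 / (1 - q)"
    using sum_le_suminf[OF summable_geometric[of q], of "{..<N}"] suminf_geometric[of q] assms by simp
  finally show ?thesis by simp
qed

text \<open>The powers of \<open>T\<close> grow more slowly than those of \<open>R\<close>, whereas Cauchy's estimates bound the
  coefficients of a function that is bounded by \<open>1\<close> on the annulus by \<open>R\<^bsup>-|n|\<^esup>\<close>.\<close>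

lemma laurent_calculus_bound_exists:
  assumes T: "T \<in> bounded_ops" and sp: "spectrum T \<subseteq> annulus R" and "R > 1"
  shows "\<exists>M. laurent_calculus_bound m R T M"
proof -
  obtain \<rho> where \<rho>: "1 < \<rho>" "\<rho> < R" "spectrum T \<subseteq> annulus \<rho>"
    using spectrum_in_smaller_annulus[OF assms] .
  then obtain C where C: "C \<ge> 0" "\<And>n. norm (op_powi T n) \<le> C * \<rho> ^ nat \<bar>n\<bar>"
    using op_powi_bound[OF T, of \<rho>] by auto
  define e where "e = C * (2 / (1 - \<rho> / R))"
  have q: "0 \<le> \<rho> / R" "\<rho> / R < 1" using \<rho> by auto
  have le: "1 / R \<le> R" using \<open>R > 1\<close> less_1_mult[of R R] by (simp add: field_simps)
  have bound: "norm (laurent_op f T) \<le> e" if f: "\<And>z. z \<in> closed_annulus R \<Longrightarrow> cmod (laurent_eval f z) \<le> 1" for f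
  proof -
    have coeff: "cmod (lcoeff f n) * R ^ nat \<bar>n\<bar> \<le> 1" for n
    proof (cases n rule: int_cases2)
      case (nonneg k)
      have "cmod (lcoeff f n) * R powi n \<le> 1"
        by (rule cauchy_estimate) (use f \<open>R > 1\<close> le in \<open>auto simp: closed_annulus_def\<close>)
      then show ?thesis using nonneg by simp
    next
      case (nonpos k)
      have "cmod (lcoeff f n) * (1 / R) powi n \<le> 1"
        by (rule cauchy_estimate) (use f \<open>R > 1\<close> le in \<open>auto simp: closed_annulus_def\<close>)
      then show ?thesis using nonpos by (simp add: power_int_minus power_one_over)
    qed
    have "norm (laurent_op f T) \<le> (\<Sum>n\<in>Poly_Mapping.keys f. norm (scalar_op (lcoeff f n) o\<^sub>L op_powi T n))"
      unfolding laurent_op_def laurent_sum_def by (rule norm_sum)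
    also have "\<dots> \<le> (\<Sum>n\<in>Poly_Mapping.keys f. C * (\<rho> / R) ^ nat \<bar>n\<bar>)"
    proof (rule sum_mono)
      fix n
      have "norm (scalar_op (lcoeff f n) o\<^sub>L op_powi T n) \<le> cmod (lcoeff f n) * (C * \<rho> ^ nat \<bar>n\<bar>)"
        by (rule order_trans[OF norm_scalar_op_compose_le mult_left_mono[OF C(2)]]) simp
      also have "\<dots> \<le> 1 / R ^ nat \<bar>n\<bar> * (C * \<rho> ^ nat \<bar>n\<bar>)"
        using coeff[of n] C(1) \<rho> \<open>R > 1\<close> by (intro mult_right_mono) (auto simp: field_simps)
      finally show "norm (scalar_op (lcoeff f n) o\<^sub>L op_powi T n) \<le> C * (\<rho> / R) ^ nat \<bar>n\<bar>"
        by (simp add: power_divide)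
    qed
    also have "\<dots> \<le> e"
      unfolding e_def sum_distrib_left[symmetric]
      by (intro mult_left_mono sum_powers_abs_le C(1)) (use q in auto)
    finally show ?thesis .
  qed
  have "e \<ge> 0" using C(1) q by (simp add: e_def)
  have "laurent_calculus_bound m R T (real m * real m * e)"
    unfolding laurent_calculus_bound_def
  proof (intro allI impI mat_bounded_entrywise \<open>e \<ge> 0\<close>)
    fix F i j x assume F: "laurent_mat_bounded m R F 1" and "i < m" "j < m"
    have "norm (laurent_op (F i j) T) \<le> e"
    proof (rule bound)
      fix z assume "z \<in> closed_annulus R"
      then have "mat_bounded m (\<lambda>i j x. laurent_eval (F i j) z * x) 1"
        using F by (simp add: laurent_mat_bounded_def)
      from mat_bounded_entry[OF this \<open>i < m\<close> \<open>j < m\<close>, of 1] show "cmod (laurent_eval (F i j) z) \<le> 1"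
        by simp
    qed
    then show "norm (laurent_op (F i j) T x) \<le> e * norm x"
      by (rule order_trans[OF norm_blinfun mult_right_mono]) simp
  qed
  then show ?thesis ..
qed

section \<open>The double layer potential of a Laurent polynomial\<close>

lemma bounded_linear_compose_scalar_op: "bounded_linear (\<lambda>a. X o\<^sub>L scalar_op a)"
proof (rule bounded_linear_intro[where K = "norm X"])
  show "norm (X o\<^sub>L scalar_op a) \<le> norm a * norm X" for a
    using order_trans[OF norm_blinfun_compose[of X "scalar_op a"] mult_left_mono[OF norm_scalar_op_le]]
    by (simp add: mult.commute)
  show "X o\<^sub>L scalar_op (r *\<^sub>R a) = r *\<^sub>R (X o\<^sub>L scalar_op a)" for r a
    by (rule blinfun_eqI)
      (simp add: scaleR_conv_of_real blinfun.scaleR_left blinfun.scaleR_right[symmetric]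
        flip: scaleC_scaleC scaleR_scaleC)
qed (auto intro!: blinfun_eqI simp: scaleC_add_left blinfun.bilinear_simps)

lemma bounded_linear_compose_left: "bounded_linear (\<lambda>X. X o\<^sub>L Y)"
  by (rule bounded_bilinear.bounded_linear_left[OF bounded_bilinear_blinfun_compose])

lemma adj_sums:
  assumes F: "\<And>k. F k \<in> bounded_ops" and S: "F sums S"
  shows "(\<lambda>k. adj (F k)) sums adj S"
proof -
  have lim: "(\<lambda>n. \<Sum>k<n. F k) \<longlonglongrightarrow> S" using S by (simp add: sums_def)
  have "S \<in> bounded_ops"
    by (rule Lim_in_closed_set[OF closed_bounded_ops _ _ lim]) (use F in auto)
  have le: "norm ((\<Sum>k<n. adj (F k)) - adj S) \<le> norm ((\<Sum>k<n. F k) - S)" for n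
    using norm_adj_le[of "(\<Sum>k<n. F k) - S"] F \<open>S \<in> bounded_ops\<close>
    by (simp add: adj_simps adj_sum)
  have "(\<lambda>n. norm ((\<Sum>k<n. F k) - S)) \<longlonglongrightarrow> 0"
    using LIM_zero[OF lim] by (rule tendsto_norm_zero)
  then have "(\<lambda>n. (\<Sum>k<n. adj (F k)) - adj S) \<longlonglongrightarrow> 0"
    by (rule Lim_null_comparison[OF always_eventually[OF allI[OF le]]])
  then show ?thesis unfolding sums_def by (rule LIM_zero_cancel)
qed

lemma compose_scalar_op_assoc: "X o\<^sub>L scalar_op a o\<^sub>L scalar_op b = X o\<^sub>L scalar_op (a * b)"
  by (simp add: scalar_op_mult blinfun_compose_assoc)

lemma compose_scalar_op_of_real: "X o\<^sub>L scalar_op (of_real r) = r *\<^sub>R X"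
  by (rule blinfun_eqI) (simp add: blinfun.scaleR_left blinfun.scaleR_right flip: scaleR_scaleC)

lemma scaleR_compose_scalar_op: "(r *\<^sub>R X) o\<^sub>L scalar_op a = X o\<^sub>L scalar_op (of_real r * a)"
  by (rule blinfun_eqI) (simp add: blinfun.bilinear_simps scalar_op_mult flip: scaleR_scaleC)

text \<open>The series converges uniformly in \<open>t\<close>, so it may be integrated term by term.\<close>

lemma fourier_series_integral:
  fixes D :: "nat \<Rightarrow> 'a::complex_hilbert \<Rightarrow>\<^sub>L 'a"
  assumes sum: "summable (\<lambda>k. norm (D k))"
    and V: "\<And>t. (\<lambda>k. D k o\<^sub>L scalar_op (cis (of_int (j k) * t))) sums V t"
    and I: "(\<lambda>k. if j k + n = 0 then (2 * pi) *\<^sub>R D k else 0) sums I"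
  shows "((\<lambda>t. V t o\<^sub>L scalar_op (cis (of_int n * t))) has_integral I) {0..2 * pi}"
proof -
  let ?g = "\<lambda>k t. D k o\<^sub>L scalar_op (cis (of_int (j k + n) * t))"
  have int_g: "(?g k has_integral (if j k + n = 0 then (2 * pi) *\<^sub>R D k else 0)) {0..2 * pi}" for k
  proof -
    have "(?g k has_integral D k o\<^sub>L scalar_op (if j k + n = 0 then of_real (2 * pi) else 0)) {0..2 * pi}"
      using has_integral_linear[OF has_integral_cis[of "j k + n"] bounded_linear_compose_scalar_op[of "D k"]]
      by (simp only: o_def)
    also have "D k o\<^sub>L scalar_op (if j k + n = 0 then of_real (2 * pi) else 0)
        = (if j k + n = 0 then (2 * pi) *\<^sub>R D k else 0)"
      using compose_scalar_op_of_real[of "D k" "2 * pi"] compose_scalar_op_of_real[of "D k" 0] by simp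
    finally show ?thesis .
  qed
  have V_eq: "suminf (\<lambda>k. ?g k t) = V t o\<^sub>L scalar_op (cis (of_int n * t))" for t
  proof -
    have "(\<lambda>k. (D k o\<^sub>L scalar_op (cis (of_int (j k) * t))) o\<^sub>L scalar_op (cis (of_int n * t)))
        sums (V t o\<^sub>L scalar_op (cis (of_int n * t)))"
      by (intro bounded_linear.sums[OF bounded_linear_compose_left] V)
    then show ?thesis
      unfolding compose_scalar_op_assoc cis_mult by (simp add: sums_iff distrib_right)
  qed
  have unif: "uniform_limit {0..2 * pi} (\<lambda>N t. \<Sum>k<N. ?g k t) (\<lambda>t. suminf (\<lambda>k. ?g k t)) sequentially"
  proof (rule Weierstrass_m_test[OF _ sum])
    fix k t
    have "norm (D k o\<^sub>L scalar_op (cis (of_int (j k + n) * t))) \<le> norm (D k) * 1"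
      by (rule order_trans[OF norm_blinfun_compose])
        (intro mult_left_mono order_trans[OF norm_scalar_op_le], auto)
    then show "norm (?g k t) \<le> norm (D k)" by simp
  qed
  have cis_cont: "continuous_on {0..2 * pi} (\<lambda>t. cis (of_int i * t))" for i
    by (intro continuous_intros)
  have cont: "continuous_on {0..2 * pi} (\<lambda>t. \<Sum>k<N. ?g k t)" for N
    by (rule continuous_on_sum)
      (rule bounded_linear.continuous_on[OF bounded_linear_compose_scalar_op cis_cont])
  obtain I' J where I': "\<And>N. ((\<lambda>t. \<Sum>k<N. ?g k t) has_integral I' N) {0..2 * pi}"
    and J: "((\<lambda>t. suminf (\<lambda>k. ?g k t)) has_integral J) {0..2 * pi}" and lim: "I' \<longlonglongrightarrow> J"
    by (rule uniform_limit_integral[OF unif cont trivial_limit_sequentially]) blast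
  have "I' N = (\<Sum>k<N. if j k + n = 0 then (2 * pi) *\<^sub>R D k else 0)" for N
    by (rule has_integral_unique[OF I' has_integral_sum]) (use int_g in auto)
  then have "I' = (\<lambda>N. \<Sum>k<N. if j k + n = 0 then (2 * pi) *\<^sub>R D k else 0)" by blast
  then have "J = I" using LIMSEQ_unique[OF lim] I unfolding sums_def by blast
  then show ?thesis using J unfolding V_eq by blast
qed

definition circle_resolvent :: "real \<Rightarrow> ('a::complex_hilbert \<Rightarrow>\<^sub>L 'a) \<Rightarrow> real \<Rightarrow> ('a \<Rightarrow>\<^sub>L 'a)" where
  "circle_resolvent R X t = op_inverse (id_blinfun - (scalar_op (cis (- t) / of_real R) o\<^sub>L X))"

text \<open>Twice the real part of the resolvent, the operator analogue of the Poisson kernel plus \<open>1\<close>.\<close>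

definition circle_kernel :: "real \<Rightarrow> ('a::complex_hilbert \<Rightarrow>\<^sub>L 'a) \<Rightarrow> real \<Rightarrow> ('a \<Rightarrow>\<^sub>L 'a)" where
  "circle_kernel R X t = circle_resolvent R X t + adj (circle_resolvent R X t)"

text \<open>The mean over the circle of the circle kernel times \<open>cis (n t)\<close>; for \<open>n = 0\<close> both terms
  contribute.\<close>

definition fourier_coeff_op :: "real \<Rightarrow> ('a::complex_hilbert \<Rightarrow>\<^sub>L 'a) \<Rightarrow> int \<Rightarrow> ('a \<Rightarrow>\<^sub>L 'a)" where
  "fourier_coeff_op R X n = (1 / R ^ nat \<bar>n\<bar>) *\<^sub>R
    ((if n \<ge> 0 then op_pow X (nat n) else 0) + (if n \<le> 0 then adj (op_pow X (nat (- n))) else 0))"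

text \<open>Both resolvents are expanded into Neumann series, which converge uniformly on the circle.\<close>

lemma circle_kernel_integral:
  assumes X: "X \<in> bounded_ops" and C: "\<And>k. norm (op_pow X k) \<le> C * \<rho> ^ k" and \<rho>: "0 < \<rho>" "\<rho> < R"
    and inv: "\<And>t. op_invertible (id_blinfun - (scalar_op (cis (- t) / of_real R) o\<^sub>L X))"
  shows "((\<lambda>t. circle_kernel R X t o\<^sub>L scalar_op (cis (of_int n * t))) has_integral
    (2 * pi) *\<^sub>R fourier_coeff_op R X n) {0..2 * pi}"
proof -
  define D where "D k = (1 / R ^ k) *\<^sub>R op_pow X k" for k
  have D_ops: "D k \<in> bounded_ops" for k using X by (simp add: D_def)
  have "R > 0" using \<rho> by simp
  have normD: "norm (D k) \<le> C * (\<rho> / R) ^ k" for k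
    using C[of k] \<open>R > 0\<close> by (simp add: D_def power_divide field_simps)
  have geom: "summable (\<lambda>k. C * (\<rho> / R) ^ k)"
    using \<rho> by (intro summable_mult summable_geometric) simp
  have sumD: "summable (\<lambda>k. norm (D k))"
    by (rule summable_comparison_test[OF _ geom]) (use normD in auto)
  have sumDa: "summable (\<lambda>k. norm (adj (D k)))"
    by (rule summable_comparison_test[OF _ geom])
      (use order_trans[OF norm_adj_le[OF D_ops] normD] in auto)
  have pow_eq: "op_pow (scalar_op (cis (- t) / of_real R) o\<^sub>L X) k
      = D k o\<^sub>L scalar_op (cis (of_int (- int k) * t))" for t k
  proof -
    have "(cis (- t) / of_real R) ^ k = of_real (1 / R ^ k) * cis (of_int (- int k) * t)"
      by (simp add: power_divide Complex.DeMoivre)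
    then show ?thesis
      unfolding op_pow_scale[OF X] scalar_op_commute[OF op_pow_in_bounded_ops[OF X]]
      by (intro blinfun_eqI) (simp add: D_def blinfun.scaleR_left op_scaleC X scaleR_scaleC scaleC_scaleC)
  qed
  have res: "(\<lambda>k. D k o\<^sub>L scalar_op (cis (of_int (- int k) * t))) sums circle_resolvent R X t" for t
    unfolding circle_resolvent_def pow_eq[symmetric]
  proof (rule neumann_sums[OF inv])
    show "(\<lambda>k. op_pow (scalar_op (cis (- t) / of_real R) o\<^sub>L X) k) \<longlonglongrightarrow> 0"
      unfolding pow_eq
    proof (rule Lim_null_comparison[OF always_eventually])
      show "(\<lambda>k. norm (D k)) \<longlonglongrightarrow> 0" using sumD by (rule summable_LIMSEQ_zero)
      have "norm (D k o\<^sub>L scalar_op (cis (of_int (- int k) * t))) \<le> norm (D k) * 1" for k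
        by (rule order_trans[OF norm_blinfun_compose])
          (intro mult_left_mono order_trans[OF norm_scalar_op_le], auto)
      then show "\<forall>k. norm (D k o\<^sub>L scalar_op (cis (of_int (- int k) * t))) \<le> norm (D k)" by simp
    qed
  qed
  have res_adj: "(\<lambda>k. adj (D k) o\<^sub>L scalar_op (cis (of_int (int k) * t))) sums adj (circle_resolvent R X t)" for t
  proof -
    have "(\<lambda>k. adj (D k o\<^sub>L scalar_op (cis (of_int (- int k) * t)))) sums adj (circle_resolvent R X t)"
      by (intro adj_sums res) (use D_ops in auto)
    then show ?thesis
      by (simp add: adj_simps D_ops cis_cnj scalar_op_commute adj_in_bounded_ops)
  qed
  let ?e = "\<lambda>t. scalar_op (cis (of_int n * t))"
  have 1: "((\<lambda>t. circle_resolvent R X t o\<^sub>L ?e t) has_integral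
      (if n \<ge> 0 then (2 * pi) *\<^sub>R D (nat n) else 0)) {0..2 * pi}"
  proof (rule fourier_series_integral[OF sumD res])
    show "(\<lambda>k. if - int k + n = 0 then (2 * pi) *\<^sub>R D k else 0) sums
        (if n \<ge> 0 then (2 * pi) *\<^sub>R D (nat n) else 0)"
    proof (cases "n \<ge> 0")
      case True
      then have "- int k + n = 0 \<longleftrightarrow> k = nat n" for k by auto
      then show ?thesis using True sums_single[of "nat n" "\<lambda>k. (2 * pi) *\<^sub>R D k"] by simp
    next
      case False
      then have "- int k + n \<noteq> 0" for k by auto
      then show ?thesis using False by simp
    qed
  qed
  have 2: "((\<lambda>t. adj (circle_resolvent R X t) o\<^sub>L ?e t) has_integral
      (if n \<le> 0 then (2 * pi) *\<^sub>R adj (D (nat (- n))) else 0)) {0..2 * pi}"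
  proof (rule fourier_series_integral[OF sumDa res_adj])
    show "(\<lambda>k. if int k + n = 0 then (2 * pi) *\<^sub>R adj (D k) else 0) sums
        (if n \<le> 0 then (2 * pi) *\<^sub>R adj (D (nat (- n))) else 0)"
    proof (cases "n \<le> 0")
      case True
      then have "int k + n = 0 \<longleftrightarrow> k = nat (- n)" for k by auto
      then show ?thesis using True sums_single[of "nat (- n)" "\<lambda>k. (2 * pi) *\<^sub>R adj (D k)"] by simp
    next
      case False
      then have "int k + n \<noteq> 0" for k by auto
      then show ?thesis using False by simp
    qed
  qed
  have "(if n \<ge> 0 then (2 * pi) *\<^sub>R D (nat n) else 0) + (if n \<le> 0 then (2 * pi) *\<^sub>R adj (D (nat (- n))) else 0)
      = (2 * pi) *\<^sub>R fourier_coeff_op R X n"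
    using X by (auto simp: fourier_coeff_op_def D_def adj_simps scaleR_add_right)
  then show ?thesis
    using has_integral_add[OF 1 2] by (simp add: circle_kernel_def blinfun_compose_simps)
qed

text \<open>On the outer circle \<open>\<sigma> = R cis \<theta>\<close> the kernel is \<open>1/(2 \<pi> R)\<close> times the circle kernel of \<open>T\<close>; on the
  inner circle \<open>\<sigma> = cis (- \<phi>) / R\<close> it is \<open>R/(2 \<pi>)\<close> times the circle kernel of \<open>T\<^sup>-\<^sup>1\<close> minus \<open>2\<close>, which makes
  the two circles symmetric. The following integrals are therefore the two parts of the double layer
  potential of \<open>f\<close>, in the angular variables.\<close>

definition has_outer_integral where
  "has_outer_integral R T f I \<longleftrightarrow>
    ((\<lambda>t. circle_kernel R T t o\<^sub>L scalar_op (laurent_eval f (of_real R * cis t)))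
      has_integral (2 * pi) *\<^sub>R I) {0..2 * pi}"

definition has_inner_integral where
  "has_inner_integral R T f J \<longleftrightarrow>
    ((\<lambda>t. (circle_kernel R (op_inverse T) t - scalar_op 2)
        o\<^sub>L scalar_op (laurent_eval f (of_real (1 / R) * cis (- t))))
      has_integral (2 * pi) *\<^sub>R J) {0..2 * pi}"

lemma circle_integrals:
  assumes T: "T \<in> bounded_ops" and sp: "spectrum T \<subseteq> annulus R" and "R > 1"
  obtains I J where "has_outer_integral R T f I" "has_inner_integral R T f J"
    "I + J = laurent_op f T + adj (laurent_op (cauchy_conj R f) T)"
proof -
  obtain \<rho> where \<rho>: "1 < \<rho>" "\<rho> < R" "spectrum T \<subseteq> annulus \<rho>"
    using spectrum_in_smaller_annulus[OF assms] .
  then obtain C where C: "C \<ge> 0" "\<And>n. norm (op_powi T n) \<le> C * \<rho> ^ nat \<bar>n\<bar>"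
    using op_powi_bound[OF T, of \<rho>] by auto
  have inv: "op_invertible T" using op_invertible_of_annulus[OF T sp] \<open>R > 1\<close> by simp
  have res: "op_invertible (id_blinfun - (scalar_op (cis (- t) / of_real R) o\<^sub>L T))"
    "op_invertible (id_blinfun - (scalar_op (cis (- t) / of_real R) o\<^sub>L op_inverse T))" for t
    using \<open>R > 1\<close>
    by (intro op_invertible_id_minus_scaled[OF T sp] op_invertible_id_minus_scaled_inverse[OF T sp];
        simp add: norm_divide)+
  have k1: "((\<lambda>t. circle_kernel R T t o\<^sub>L scalar_op (cis (of_int n * t))) has_integral
      (2 * pi) *\<^sub>R fourier_coeff_op R T n) {0..2 * pi}" for n
  proof (rule circle_kernel_integral[OF T _ _ _ res(1)])
    show "norm (op_pow T k) \<le> C * \<rho> ^ k" for k using C(2)[of "int k"] by (simp add: op_powi_of_nat)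
  qed (use \<rho> in auto)
  have k2: "((\<lambda>t. circle_kernel R (op_inverse T) t o\<^sub>L scalar_op (cis (of_int n * t))) has_integral
      (2 * pi) *\<^sub>R fourier_coeff_op R (op_inverse T) n) {0..2 * pi}" for n
  proof (rule circle_kernel_integral[OF op_inverse_in_bounded_ops[OF inv] _ _ _ res(2)])
    show "norm (op_pow (op_inverse T) k) \<le> C * \<rho> ^ k" for k
      using C(2)[of "- int k"] by (simp add: op_powi_minus_of_nat)
  qed (use \<rho> in auto)
  have const: "((\<lambda>t. scalar_op 2 o\<^sub>L scalar_op (cis (of_int n * t))) has_integral
      (2 * pi) *\<^sub>R (if n = 0 then scalar_op 2 else 0 :: 'a \<Rightarrow>\<^sub>L 'a)) {0..2 * pi}" for n
  proof -
    have "((\<lambda>t. scalar_op 2 o\<^sub>L scalar_op (cis (of_int n * t))) has_integral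
        (scalar_op 2 o\<^sub>L scalar_op (if n = 0 then of_real (2 * pi) else 0) :: 'a \<Rightarrow>\<^sub>L 'a)) {0..2 * pi}"
      using has_integral_linear[OF has_integral_cis[of n] bounded_linear_compose_scalar_op[of "scalar_op 2"]]
      by (simp only: o_def)
    also have "(scalar_op 2 o\<^sub>L scalar_op (if n = 0 then of_real (2 * pi) else 0) :: 'a \<Rightarrow>\<^sub>L 'a)
        = (2 * pi) *\<^sub>R (if n = 0 then scalar_op 2 else 0)"
      using compose_scalar_op_of_real[of "scalar_op 2 :: 'a \<Rightarrow>\<^sub>L 'a" "2 * pi"] compose_scalar_op_of_real[of "scalar_op 2 :: 'a \<Rightarrow>\<^sub>L 'a" 0]
      by simp
    finally show ?thesis .
  qed
  have scaled: "((\<lambda>t. K t o\<^sub>L scalar_op (b * cis (of_int n * t))) has_integral (2 * pi) *\<^sub>R (E o\<^sub>L scalar_op b)) {0..2 * pi}"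
    if "((\<lambda>t. K t o\<^sub>L scalar_op (cis (of_int n * t))) has_integral (2 * pi) *\<^sub>R E) {0..2 * pi}"
    for K :: "real \<Rightarrow> 'a \<Rightarrow>\<^sub>L 'a" and E b n
    using has_integral_linear[OF that bounded_linear_compose_left[of "scalar_op b"]]
    by (simp add: o_def compose_scalar_op_assoc mult.commute blinfun_compose_simps)
  have "\<exists>I J. has_outer_integral R T f I \<and> has_inner_integral R T f J \<and>
    I + J = laurent_op f T + adj (laurent_op (cauchy_conj R f) T)"
  proof (induction f rule: laurent_induct)
    case (monom n a)
    let ?b = "a * of_real R powi n" and ?b' = "a * of_real (1 / R) powi n"
    let ?I = "fourier_coeff_op R T n o\<^sub>L scalar_op ?b"
    let ?J = "(fourier_coeff_op R (op_inverse T) (- n) - (if - n = 0 then scalar_op 2 else 0)) o\<^sub>L scalar_op ?b'"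
    have eval1: "laurent_eval (lmonom n a) (of_real R * cis t) = ?b * cis (of_int n * t)" for t
      by (simp add: laurent_eval_monom power_int_mult_distrib cis_powi)
    have 1: "has_outer_integral R T (lmonom n a) ?I"
      unfolding has_outer_integral_def eval1 by (rule scaled[OF k1])
    have eval2: "laurent_eval (lmonom n a) (of_real (1 / R) * cis (- t)) = ?b' * cis (of_int (- n) * t)" for t
      unfolding laurent_eval_monom power_int_mult_distrib cis_powi by simp
    have int2: "((\<lambda>t. (circle_kernel R (op_inverse T) t - scalar_op 2) o\<^sub>L scalar_op (cis (of_int (- n) * t)))
        has_integral (2 * pi) *\<^sub>R (fourier_coeff_op R (op_inverse T) (- n) - (if - n = 0 then scalar_op 2 else 0))) {0..2 * pi}"
      using has_integral_diff[OF k2[of "- n"] const[of "- n"]]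
      unfolding blinfun_compose_simps(3) scaleR_diff_right .
    have 2: "has_inner_integral R T (lmonom n a) ?J"
      unfolding has_inner_integral_def eval2 by (rule scaled[OF int2])
    have "?I + ?J = laurent_op (lmonom n a) T + adj (laurent_op (cauchy_conj R (lmonom n a)) T)"
    proof -
      consider k where "n = int k" "k > 0" | k where "n = - int k" "k > 0" | "n = 0"
        by (rule int_cases3[of n]) blast+
      then show ?thesis
      proof cases
        case (1 k)
        have "- 2 * int k = - int (2 * k)" by simp
        then have "R powi (- 2 * int k) = 1 / R ^ k * (1 / R ^ k)"
          by (simp only: power_int_minus power_int_of_nat mult_2 power_add inverse_mult_distrib
              inverse_eq_divide) simp
        then show ?thesis
          using 1 \<open>R > 1\<close> T
          by (simp add: laurent_op_monom cauchy_conj_monom fourier_coeff_op_def adj_simps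
              scaleR_compose_scalar_op op_powi_of_nat op_powi_minus_of_nat scalar_op_commute
              op_inverse_in_bounded_ops[OF inv] power_one_over)
            (simp add: scalar_op_commute adj_in_bounded_ops op_inverse_in_bounded_ops[OF inv] field_simps)
      next
        case (2 k)
        have "- 2 * int k = - int (2 * k)" by simp
        then have "R powi (- 2 * int k) = 1 / R ^ k * (1 / R ^ k)"
          by (simp only: power_int_minus power_int_of_nat mult_2 power_add inverse_mult_distrib
              inverse_eq_divide) simp
        moreover have "complex_of_real R powi (- int k) = 1 / of_real R ^ k"
          by (simp only: power_int_minus power_int_of_nat inverse_eq_divide)
        ultimately show ?thesis
          using 2 \<open>R > 1\<close> T
          by (simp add: laurent_op_monom cauchy_conj_monom fourier_coeff_op_def adj_simps
              scaleR_compose_scalar_op op_powi_of_nat op_powi_minus_of_nat scalar_op_commute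
              op_inverse_in_bounded_ops[OF inv] power_one_over)
            (simp add: scalar_op_commute adj_in_bounded_ops op_inverse_in_bounded_ops[OF inv] field_simps)
      next
        case 3
        have two: "scalar_op 2 x = x + x" for x :: 'a
          using scaleC_add_left[of 1 1 x] by simp
        show ?thesis
          using 3 by (intro blinfun_eqI)
            (simp add: laurent_op_monom cauchy_conj_monom fourier_coeff_op_def adj_simps
              blinfun.bilinear_simps two[unfolded scalar_op_apply])
      qed
    qed
    with 1 2 show ?case by (intro exI[of _ ?I] exI[of _ ?J] conjI)
  next
    case (add f g)
    then obtain I J I' J' where *: "has_outer_integral R T f I" "has_inner_integral R T f J"
      "I + J = laurent_op f T + adj (laurent_op (cauchy_conj R f) T)"
      "has_outer_integral R T g I'" "has_inner_integral R T g J'"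
      "I' + J' = laurent_op g T + adj (laurent_op (cauchy_conj R g) T)"
      by blast
    have add_eq: "X o\<^sub>L scalar_op (laurent_eval (f + g) z)
        = (X o\<^sub>L scalar_op (laurent_eval f z)) + (X o\<^sub>L scalar_op (laurent_eval g z))"
      for X :: "'a \<Rightarrow>\<^sub>L 'a" and z
      unfolding laurent_eval_add
      by (rule linear_simps(1)[OF bounded_linear_compose_scalar_op])
    note * = *[unfolded has_outer_integral_def has_inner_integral_def]
    show ?case
      unfolding has_outer_integral_def has_inner_integral_def add_eq
      by (intro exI[of _ "I + I'"] exI[of _ "J + J'"])
        (use has_integral_add[OF *(1,4)] has_integral_add[OF *(2,5)] *(3,6)
          laurent_op_in_bounded_ops[OF T inv] in
        \<open>auto simp: scaleR_add_right laurent_op_add cauchy_conj_add adj_simps algebra_simps\<close>)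
  qed
  then show ?thesis using that by blast
qed

lemma op_inverse_scalar_op: "a \<noteq> 0 \<Longrightarrow> op_inverse (scalar_op a) = scalar_op (1 / a)"
  by (rule op_inverse_eqI) (simp_all add: scalar_op_one flip: scalar_op_mult)

lemma op_inverse_adj:
  assumes "X \<in> bounded_ops" "op_invertible X"
  shows "op_inverse (adj X) = adj (op_inverse X)"
  using assms
  by (intro op_inverse_eqI)
    (simp_all add: adj_in_bounded_ops op_inverse_in_bounded_ops op_inverse_left op_inverse_right adj_id
      flip: adj_compose)

lemma dl_kernel_eq:
  fixes T :: "'a::complex_hilbert \<Rightarrow>\<^sub>L 'a"
  assumes T: "T \<in> bounded_ops" and "\<sigma> s \<notin> spectrum T" and d: "vector_derivative \<sigma> (at s) = d"
    and Y: "scalar_op d o\<^sub>L op_inverse (scalar_op (\<sigma> s) - T) = Y"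
  shows "dl_kernel \<sigma> T s = scalar_op (1 / (2 * of_real pi * \<i>)) o\<^sub>L (Y - adj Y)"
proof -
  let ?X = "op_inverse (scalar_op (\<sigma> s) - T)"
  have inv: "op_invertible (scalar_op (\<sigma> s) - T)" using assms by (simp add: spectrum_def)
  have "op_inverse (scalar_op (cnj (\<sigma> s)) - adj T) = adj ?X"
    using op_inverse_adj[OF _ inv] T by (simp add: adj_simps)
  moreover have "adj Y = scalar_op (cnj d) o\<^sub>L adj ?X"
    using op_inverse_in_bounded_ops[OF inv]
    by (simp add: Y[symmetric] adj_simps scalar_op_commute adj_in_bounded_ops)
  ultimately show ?thesis by (simp add: dl_kernel_def d Y)
qed

lemma vector_derivative_outer_circle:
  "R > 0 \<Longrightarrow> vector_derivative (outer_circle R) (at s) = \<i> * cis (s / R)"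
  by (rule vector_derivative_at)
    (auto intro!: derivative_eq_intros simp: outer_circle_def[abs_def] has_vector_derivative_def
      fun_eq_iff complex_eq_iff)

lemma vector_derivative_inner_circle:
  "R > 0 \<Longrightarrow> vector_derivative (inner_circle R) (at s) = - \<i> * cis (- (s * R))"
  by (rule vector_derivative_at)
    (auto intro!: derivative_eq_intros simp: inner_circle_def[abs_def] has_vector_derivative_def
      fun_eq_iff complex_eq_iff)

lemma dl_kernel_outer_circle:
  fixes T :: "'a::complex_hilbert \<Rightarrow>\<^sub>L 'a"
  assumes T: "T \<in> bounded_ops" and sp: "spectrum T \<subseteq> annulus R" and "R > 1"
  shows "dl_kernel (outer_circle R) T s = (1 / (2 * pi * R)) *\<^sub>R circle_kernel R T (s / R)"
proof -
  let ?\<sigma> = "outer_circle R s" and ?W = "circle_resolvent R T (s / R)"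
  have \<sigma>: "?\<sigma> \<noteq> 0" "1 / ?\<sigma> = cis (- (s / R)) / of_real R"
    using \<open>R > 1\<close> by (auto simp: outer_circle_def divide_inverse simp flip: cis_inverse)
  have inv: "op_invertible (id_blinfun - (scalar_op (1 / ?\<sigma>) o\<^sub>L T))"
    using \<open>R > 1\<close> by (intro op_invertible_id_minus_scaled[OF T sp]) (auto simp: outer_circle_def norm_divide norm_mult)
  have "scalar_op ?\<sigma> - T = scalar_op ?\<sigma> o\<^sub>L (id_blinfun - (scalar_op (1 / ?\<sigma>) o\<^sub>L T))"
    using \<sigma>(1) by (intro blinfun_eqI) (simp add: blinfun.diff_left scaleC_diff_right scaleC_scaleC)
  then have X: "op_inverse (scalar_op ?\<sigma> - T) = ?W o\<^sub>L scalar_op (1 / ?\<sigma>)"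
    using \<sigma> inv by (simp add: op_inverse_compose op_invertible_scalar_op op_inverse_scalar_op circle_resolvent_def)
  have W: "?W \<in> bounded_ops"
    using op_inverse_in_bounded_ops[OF inv] by (simp add: circle_resolvent_def \<sigma>(2))
  have "\<i> * cis (s / R) * (1 / ?\<sigma>) = \<i> / of_real R"
    by (simp add: outer_circle_def)
  then have "scalar_op (\<i> * cis (s / R)) o\<^sub>L op_inverse (scalar_op ?\<sigma> - T) = scalar_op (\<i> / of_real R) o\<^sub>L ?W"
    unfolding X scalar_op_commute[OF W, symmetric] blinfun_compose_assoc[symmetric]
    by (simp flip: scalar_op_mult)
  moreover have "?\<sigma> \<notin> spectrum T"
    using sp \<open>R > 1\<close> by (auto simp: annulus_def outer_circle_def norm_mult)
  ultimately have "dl_kernel (outer_circle R) T s = scalar_op (1 / (2 * of_real pi * \<i>)) o\<^sub>L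
      ((scalar_op (\<i> / of_real R) o\<^sub>L ?W) - adj (scalar_op (\<i> / of_real R) o\<^sub>L ?W))"
    using \<open>R > 1\<close> T by (intro dl_kernel_eq[where d = "\<i> * cis (s / R)"]) (auto simp: vector_derivative_outer_circle)
  also have "\<dots> = (1 / (2 * pi * R)) *\<^sub>R circle_kernel R T (s / R)"
    using W \<open>R > 1\<close>
    by (intro blinfun_eqI)
      (simp add: circle_kernel_def adj_simps blinfun.bilinear_simps op_scaleC adj_in_bounded_ops
        scaleC_diff_right scaleC_scaleC scaleR_scaleC scaleC_add_right scaleC_minus_right
        flip: scaleC_minus_one)
  finally show ?thesis .
qed

text \<open>On this circle \<open>\<sigma> (\<sigma> - T)\<^sup>-\<^sup>1 = 1 - (1 - \<sigma> T\<^sup>-\<^sup>1)\<^sup>-\<^sup>1\<close>, and \<open>\<sigma>' = - \<i> R \<sigma>\<close> because of the clockwise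
  orientation.\<close>

lemma dl_kernel_inner_circle:
  fixes T :: "'a::complex_hilbert \<Rightarrow>\<^sub>L 'a"
  assumes T: "T \<in> bounded_ops" and sp: "spectrum T \<subseteq> annulus R" and "R > 1"
  shows "dl_kernel (inner_circle R) T s
    = (R / (2 * pi)) *\<^sub>R (circle_kernel R (op_inverse T) (s * R) - scalar_op 2)"
proof -
  let ?\<sigma> = "inner_circle R s" and ?W = "circle_resolvent R (op_inverse T) (s * R)"
  let ?c = "- \<i> * cis (- (s * R))"
  have invT: "op_invertible T" using op_invertible_of_annulus[OF T sp] \<open>R > 1\<close> by simp
  have \<sigma>: "?\<sigma> \<noteq> 0" "?\<sigma> = cis (- (s * R)) / of_real R"
    using \<open>R > 1\<close> by (auto simp: inner_circle_def)
  let ?B = "id_blinfun - (scalar_op ?\<sigma> o\<^sub>L op_inverse T)"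
  have inv: "op_invertible ?B"
    using \<open>R > 1\<close> by (intro op_invertible_id_minus_scaled_inverse[OF T sp]) (auto simp: \<sigma>(2) norm_divide)
  have W_def: "?W = op_inverse ?B" by (simp add: circle_resolvent_def \<sigma>(2))
  have W: "?W \<in> bounded_ops" unfolding W_def by (rule op_inverse_in_bounded_ops[OF inv])
  have "scalar_op ?\<sigma> - T = scalar_op (- 1) o\<^sub>L (?B o\<^sub>L T)"
    unfolding blinfun_compose_simps(3) blinfun_compose_assoc op_inverse_left[OF invT]
    by (rule blinfun_eqI) (simp add: blinfun.diff_left scaleC_minus_one)
  then have X: "op_inverse (scalar_op ?\<sigma> - T) = op_inverse T o\<^sub>L ?W o\<^sub>L scalar_op (- 1)"
    using inv invT
    by (simp add: op_inverse_compose op_invertible_compose op_invertible_scalar_op op_inverse_scalar_op W_def)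
  have "?W - (scalar_op ?\<sigma> o\<^sub>L (op_inverse T o\<^sub>L ?W)) = ?B o\<^sub>L ?W"
    by (simp add: blinfun_compose_simps(3) blinfun_compose_assoc)
  also have "\<dots> = id_blinfun" unfolding W_def by (rule op_inverse_right[OF inv])
  finally have QW: "scalar_op ?\<sigma> o\<^sub>L (op_inverse T o\<^sub>L ?W) = ?W - id_blinfun" by (simp add: algebra_simps)
  have "scalar_op ?c o\<^sub>L op_inverse (scalar_op ?\<sigma> - T)
      = scalar_op (\<i> * of_real R) o\<^sub>L (scalar_op ?\<sigma> o\<^sub>L (op_inverse T o\<^sub>L ?W))"
    unfolding X unfolding \<sigma>(2) using \<open>R > 1\<close> W op_inverse_in_bounded_ops[OF invT]
    by (intro blinfun_eqI) (simp add: op_scaleC scaleC_scaleC)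
  then have "scalar_op ?c o\<^sub>L op_inverse (scalar_op ?\<sigma> - T) = scalar_op (\<i> * of_real R) o\<^sub>L (?W - id_blinfun)"
    unfolding QW .
  moreover have "?\<sigma> \<notin> spectrum T"
    using sp \<open>R > 1\<close> by (auto simp: annulus_def \<sigma>(2) norm_divide)
  ultimately have "dl_kernel (inner_circle R) T s = scalar_op (1 / (2 * of_real pi * \<i>)) o\<^sub>L
      ((scalar_op (\<i> * of_real R) o\<^sub>L (?W - id_blinfun)) - adj (scalar_op (\<i> * of_real R) o\<^sub>L (?W - id_blinfun)))"
    using \<open>R > 1\<close> T by (intro dl_kernel_eq[where d = ?c]) (auto simp: vector_derivative_inner_circle)
  also have "\<dots> = (R / (2 * pi)) *\<^sub>R (circle_kernel R (op_inverse T) (s * R) - scalar_op 2)"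
  proof (rule blinfun_eqI)
    fix x :: 'a
    have two: "2 *\<^sub>C x = x + x" using scaleC_add_left[of 1 1 x] by simp
    show "(scalar_op (1 / (2 * of_real pi * \<i>)) o\<^sub>L
        ((scalar_op (\<i> * of_real R) o\<^sub>L (?W - id_blinfun)) - adj (scalar_op (\<i> * of_real R) o\<^sub>L (?W - id_blinfun)))) x
      = ((R / (2 * pi)) *\<^sub>R (circle_kernel R (op_inverse T) (s * R) - scalar_op 2)) x"
      using W \<open>R > 1\<close>
      by (simp add: circle_kernel_def adj_simps blinfun.bilinear_simps op_scaleC adj_in_bounded_ops two
          scaleC_diff_right scaleC_scaleC scaleR_scaleC scaleC_add_right scaleC_minus_right
          flip: scaleC_minus_one)
  qed
  finally show ?thesis .
qed

lemma has_integral_rescale: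
  fixes g :: "real \<Rightarrow> 'b::real_normed_vector"
  assumes "(g has_integral I) {0..b}" "r > 0"
  shows "((\<lambda>s. r *\<^sub>R g (s * r)) has_integral I) {0..b / r}"
proof -
  have "((\<lambda>x. g (r *\<^sub>R x + 0)) has_integral (I /\<^sub>R r ^ DIM(real))) (cbox ((0 - 0) /\<^sub>R r) ((b - 0) /\<^sub>R r))"
    by (rule has_integral_affinity') (use assms in auto)
  from has_integral_cmul[OF this, of r] show ?thesis
    using assms(2) by (simp add: mult.commute divide_inverse)
qed

lemma dl_integral_laurent:
  fixes T :: "'a::complex_hilbert \<Rightarrow>\<^sub>L 'a"
  assumes T: "T \<in> bounded_ops" and sp: "spectrum T \<subseteq> annulus R" and "R > 1"
  shows "dl_integral R T (laurent_eval f) = laurent_op f T + adj (laurent_op (cauchy_conj R f) T)"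
proof -
  obtain I J where I: "has_outer_integral R T f I" and J: "has_inner_integral R T f J"
    and IJ: "I + J = laurent_op f T + adj (laurent_op (cauchy_conj R f) T)"
    using circle_integrals[OF assms] .
  have outer: "((\<lambda>s. dl_kernel (outer_circle R) T s o\<^sub>L scalar_op (laurent_eval f (outer_circle R s)))
      has_integral I) {0..2 * pi * R}"
    using has_integral_cmul[OF has_integral_rescale[OF I[unfolded has_outer_integral_def], of "1 / R"], of "1 / (2 * pi)"] \<open>R > 1\<close>
    by (simp add: dl_kernel_outer_circle[OF assms] outer_circle_def blinfun_compose_simps(7) mult_ac)
  have inner: "((\<lambda>s. dl_kernel (inner_circle R) T s o\<^sub>L scalar_op (laurent_eval f (inner_circle R s)))
      has_integral J) {0..2 * pi / R}"
    using has_integral_cmul[OF has_integral_rescale[OF J[unfolded has_inner_integral_def], of R], of "1 / (2 * pi)"] \<open>R > 1\<close>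
    by (simp add: dl_kernel_inner_circle[OF assms] inner_circle_def blinfun_compose_simps(7) mult_ac)
  show ?thesis
    unfolding dl_integral_def integral_unique[OF outer] integral_unique[OF inner] by (rule IJ)
qed

text \<open>On the unit circle a Laurent expansion converges absolutely; truncating it where the tail is
  small and applying Cauchy's estimate to the truncation bounds each coefficient of an expansion of
  zero.\<close>

lemma laurent_expansion_zero:
  assumes d: "\<And>z. cmod z = 1 \<Longrightarrow> ((\<lambda>n::int. d n * z powi n) has_sum (0 :: complex)) UNIV"
  shows "d m = 0"
proof (rule ccontr)
  assume "d m \<noteq> 0"
  have "(\<lambda>n::int. d n) summable_on UNIV"
    using d[of 1] by (auto simp: summable_on_def)
  then have abs: "(\<lambda>n::int. norm (d n)) summable_on UNIV"
    by (simp add: summable_on_iff_abs_summable_on_complex)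
  define S where "S = infsum (\<lambda>n::int. norm (d n)) UNIV"
  have "((\<lambda>n::int. norm (d n)) has_sum S) UNIV" using abs by (simp add: S_def)
  then have "eventually (\<lambda>F. dist (\<Sum>n\<in>F. norm (d n)) S < cmod (d m)) (finite_subsets_at_top UNIV)"
    unfolding has_sum_def using \<open>d m \<noteq> 0\<close> by (intro tendstoD) auto
  then obtain F0 where F0: "finite F0"
    "\<And>F. finite F \<Longrightarrow> F0 \<subseteq> F \<Longrightarrow> dist (\<Sum>n\<in>F. norm (d n)) S < cmod (d m)"
    unfolding eventually_finite_subsets_at_top by auto
  define F where "F = insert m F0"
  have "finite F" "F0 \<subseteq> F" using F0(1) by (simp_all add: F_def subset_insertI)
  note F = this(1) F0(2)[OF this]
  define t where "t = infsum (\<lambda>n. norm (d n)) (- F)"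
  have tail: "((\<lambda>n. norm (d n)) has_sum t) (- F)"
    unfolding t_def using summable_on_subset_banach[OF abs, of "- F"] by simp
  have "((\<lambda>n. norm (d n)) has_sum ((\<Sum>n\<in>F. norm (d n)) + t)) (F \<union> - F)"
    using F(1) tail by (intro has_sum_Un_disjoint) auto
  then have "S = (\<Sum>n\<in>F. norm (d n)) + t" by (simp add: S_def infsumI)
  then have "t < cmod (d m)" using F(2) by (simp add: dist_real_def)
  define g where "g = (\<Sum>n\<in>F. lmonom n (d n))"
  have "cmod (laurent_eval g z) \<le> t" if z: "cmod z = 1" for z
  proof -
    have "((\<lambda>n. d n * z powi n) has_sum (\<Sum>n\<in>F. d n * z powi n)) F" using F(1) by simp
    then have "((\<lambda>n. d n * z powi n) has_sum (0 - (\<Sum>n\<in>F. d n * z powi n))) (UNIV - F)"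
      by (intro has_sum_Diff d z) auto
    moreover have "((\<lambda>n. norm (d n * z powi n)) has_sum t) (UNIV - F)"
      using tail z by (simp add: norm_mult norm_power_int Compl_eq_Diff_UNIV)
    ultimately have "cmod (0 - (\<Sum>n\<in>F. d n * z powi n)) \<le> t" by (rule norm_has_sum_bound[rotated])
    then show ?thesis by (simp add: g_def laurent_eval_sum laurent_eval_monom)
  qed
  then have "cmod (lcoeff g m) * 1 powi m \<le> t" by (intro cauchy_estimate) auto
  moreover have "lcoeff g m = d m"
    using F(1) by (simp add: g_def lookup_sum lookup_single when_def F_def)
  ultimately show False using \<open>t < cmod (d m)\<close> by simp
qed

lemma laurent_coeff_laurent_eval:
  assumes "R > 1"
  shows "laurent_coeff R (laurent_eval f) n = lcoeff f n"
proof -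
  have ex: "((\<lambda>n. lcoeff f n * z powi n) has_sum laurent_eval f z) UNIV" for z
    unfolding laurent_eval_def laurent_sum_def
    by (rule has_sum_cong_neutral[THEN iffD1, OF _ _ _ has_sum_finite[of "Poly_Mapping.keys f"]])
      (auto simp: in_keys_iff)
  have "laurent_coeff R (laurent_eval f) = lcoeff f"
    unfolding laurent_coeff_def
  proof (rule the_equality)
    fix a assume a: "\<forall>z\<in>annulus R. ((\<lambda>n. a n * z powi n) has_sum laurent_eval f z) UNIV"
    have "a m - lcoeff f m = 0" for m
    proof (rule laurent_expansion_zero)
      fix z :: complex assume "cmod z = 1"
      then have "((\<lambda>n. a n * z powi n) has_sum laurent_eval f z) UNIV"
        using a \<open>R > 1\<close> by (auto simp: annulus_def)
      from has_sum_add[OF this has_sum_cmult_right[OF ex[of z], of "- 1"]] show "((\<lambda>n. (a n - lcoeff f n) * z powi n) has_sum 0) UNIV"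
        by (simp add: left_diff_distrib)
    qed
    then show "a = lcoeff f" by auto
  qed (use ex in auto)
  then show ?thesis by simp
qed

lemma S_map_laurent:
  assumes "T \<in> bounded_ops" "spectrum T \<subseteq> annulus R" "R > 1"
  shows "S_map R c T (laurent_eval f) = laurent_S R c T f"
  by (simp add: S_map_def laurent_S_def dl_integral_laurent[OF assms] laurent_coeff_laurent_eval assms)

section \<open>Positive maps on the disk algebra\<close>

text \<open>Twice the coefficients of \<open>N\<close> times the Fejer kernel of order \<open>N\<close>, the constant term not being
  doubled: on the unit circle the real part of \<open>\<Sum> fejer_coeff N i w\<^sup>i\<close> is \<open>|1 + w + \<dots> + w\<^bsup>N-1\<^esup>|\<^sup>2\<close>.\<close>

definition fejer_coeff :: "nat \<Rightarrow> nat \<Rightarrow> real" where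
  "fejer_coeff N i = (if i = 0 then real N else 2 * (real N - real i))"

text \<open>With \<open>t\<^sub>N = 1 + w + \<dots> + w\<^bsup>N-1\<^esup>\<close>, the sum grows by \<open>2 t\<^sub>N\<^sub>+\<^sub>1 - 1\<close> from \<open>N\<close> to \<open>N + 1\<close>, and
  \<open>t\<^sub>N\<^sub>+\<^sub>1 - 1 = w t\<^sub>N\<close>; hence the real part of this increment is at least
  \<open>|t\<^sub>N\<^sub>+\<^sub>1|\<^sup>2 - |t\<^sub>N|\<^sup>2\<close> when \<open>|w| \<le> 1\<close>.\<close>

lemma fejer_sum_nonneg:
  fixes w :: complex
  assumes "cmod w \<le> 1"
  shows "0 \<le> Re (\<Sum>i<N. of_real (fejer_coeff N i) * w ^ i)"
proof -
  have "(cmod (\<Sum>i<N. w ^ i))\<^sup>2 \<le> Re (\<Sum>i<N. of_real (fejer_coeff N i) * w ^ i)"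
  proof (induction N)
    case (Suc N)
    let ?t = "\<lambda>N. \<Sum>i<N. w ^ i"
    have "(\<Sum>i<Suc N. of_real (fejer_coeff (Suc N) i) * w ^ i)
        = (\<Sum>i<Suc N. of_real (fejer_coeff N i) * w ^ i + (2 * w ^ i - (if i = 0 then 1 else 0)))"
      by (intro sum.cong) (auto simp: fejer_coeff_def algebra_simps)
    also have "\<dots> = (\<Sum>i<Suc N. of_real (fejer_coeff N i) * w ^ i) + (2 * ?t (Suc N) - 1)"
      by (simp add: sum.distrib sum_subtractf sum_distrib_left del: sum.lessThan_Suc)
    also have "(\<Sum>i<Suc N. of_real (fejer_coeff N i) * w ^ i) = (\<Sum>i<N. of_real (fejer_coeff N i) * w ^ i)"
      by (simp add: fejer_coeff_def)
    finally have step: "(\<Sum>i<Suc N. of_real (fejer_coeff (Suc N) i) * w ^ i)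
        = (\<Sum>i<N. of_real (fejer_coeff N i) * w ^ i) + (2 * ?t (Suc N) - 1)" .
    have "?t (Suc N) = 1 + w * ?t N"
      by (simp only: sum.lessThan_Suc_shift) (simp add: sum_distrib_left)
    then have "cmod (?t (Suc N) - 1) \<le> cmod (?t N)"
      using assms by (simp add: norm_mult mult_left_le_one_le)
    then have "(cmod (?t (Suc N) - 1))\<^sup>2 \<le> (cmod (?t N))\<^sup>2" by (rule power_mono) simp
    then have "(cmod (?t (Suc N)))\<^sup>2 - 2 * Re (?t (Suc N)) + 1 \<le> (cmod (?t N))\<^sup>2"
      unfolding cmod_power2 by (simp add: power2_eq_square algebra_simps)
    then show ?case unfolding step using Suc by simp
  qed simp
  then show ?thesis by (rule order_trans[rotated]) simp
qed

lemma sum_roots_of_unity: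
  assumes "L > 0" "j \<noteq> 0" "\<bar>j\<bar> < int L"
  shows "(\<Sum>k<L. cis (2 * pi * real k / real L) powi j) = 0"
proof -
  let ?u = "cis (2 * pi * of_int j / real L)"
  have "?u \<noteq> 1"
  proof
    assume "?u = 1"
    then have "cos (2 * pi * of_int j / real L) = 1" by (metis cis.sel(1) one_complex.sel(1))
    then obtain n :: int where "2 * pi * of_int j / real L = of_int n * 2 * pi"
      by (auto simp: cos_one_2pi_int)
    then have "real_of_int j = of_int n * real L" using \<open>L > 0\<close> by (simp add: field_simps)
    then have "j = n * int L" by (metis of_int_eq_iff of_int_mult of_int_of_nat_eq)
    then have "int L dvd j" by simp
    then show False using assms zdvd_imp_le[of "int L" "\<bar>j\<bar>"] by auto
  qed
  moreover have "?u ^ L = 1"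
    using \<open>L > 0\<close> cis_multiple_2pi[of "of_int j"] by (simp add: Complex.DeMoivre)
  moreover have "cis (2 * pi * real k / real L) powi j = ?u ^ k" for k
    by (simp add: cis_powi Complex.DeMoivre mult_ac)
  ultimately show ?thesis using geometric_sum[of ?u L] by simp
qed

text \<open>Averaging over the roots of unity extracts \<open>B\<^sub>1\<close> from the positive forms of the hypothesis, with
  the weight \<open>2 (N - 1)\<close>, and \<open>N B\<^sub>0\<close> from their diagonal values; the factor \<open>(N - 1)/N\<close> disappears
  in the limit.\<close>

lemma contraction_of_fejer_positive:
  fixes B :: "nat \<Rightarrow> 'a::complex_hilbert \<Rightarrow>\<^sub>L 'a"
  assumes B0: "B 0 = id_blinfun" and ops: "\<And>i. B i \<in> bounded_ops"
    and pos: "\<And>N \<zeta> x. cmod \<zeta> = 1 \<Longrightarrow>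
      0 \<le> Re (\<Sum>i<N. of_real (fejer_coeff N i) * \<zeta> ^ i * cinner (B i x) x)"
  shows "norm (B 1) \<le> 1"
proof -
  define \<Theta> where "\<Theta> N \<zeta> x y = (\<Sum>i<N. of_real (fejer_coeff N i) * \<zeta> ^ i * cinner (B i x) y)" for N \<zeta> x y
  define F where "F N \<zeta> x y = \<Theta> N \<zeta> x y + cnj (\<Theta> N \<zeta> y x)" for N \<zeta> x y
  have F_le: "cmod (F N \<zeta> x y) \<le> Re (\<Theta> N \<zeta> x x) + Re (\<Theta> N \<zeta> y y)" if "cmod \<zeta> = 1" for N \<zeta> x y
  proof -
    obtain u where u: "cmod u = 1" "u * F N \<zeta> x y = of_real (cmod (F N \<zeta> x y))"
      using cmod_eq_Re_rotation by blast
    have "u * cnj u = 1" using complex_norm_square[of u] u(1) by simp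
    then have uu: "cnj u * (u * z) = z" for z
      by (metis mult.assoc mult.commute mult_1)
    have "\<Theta> N \<zeta> (u *\<^sub>C x - y) (u *\<^sub>C x - y) = \<Theta> N \<zeta> x x + \<Theta> N \<zeta> y y - u * \<Theta> N \<zeta> x y - cnj u * \<Theta> N \<zeta> y x"
    proof -
      have exp: "cinner (B i (u *\<^sub>C x - y)) (u *\<^sub>C x - y) = cinner (B i x) x + cinner (B i y) y
          - u * cinner (B i x) y - cnj u * cinner (B i y) x" for i
        by (simp add: uu right_diff_distrib blinfun.diff_right op_scaleC ops cinner_diff_left cinner_diff_right
            cinner_scaleC_left cinner_scaleC_right)
      show ?thesis
        unfolding \<Theta>_def exp by (simp add: algebra_simps sum.distrib sum_subtractf sum_distrib_left)
    qed
    then have "0 \<le> Re (\<Theta> N \<zeta> x x + \<Theta> N \<zeta> y y - u * \<Theta> N \<zeta> x y - cnj u * \<Theta> N \<zeta> y x)"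
      using pos[OF that, of N "u *\<^sub>C x - y"] by (simp only: \<Theta>_def)
    also have "\<dots> = Re (\<Theta> N \<zeta> x x) + Re (\<Theta> N \<zeta> y y) - Re (u * F N \<zeta> x y)"
      by (simp add: F_def algebra_simps)
    also have "\<dots> = Re (\<Theta> N \<zeta> x x) + Re (\<Theta> N \<zeta> y y) - cmod (F N \<zeta> x y)"
      by (simp only: u(2) Re_complex_of_real)
    finally show ?thesis by simp
  qed
  have bound: "(2 * real N) * cmod (cinner (B 1 x) y) \<le> real (Suc N) * ((norm x)\<^sup>2 + (norm y)\<^sup>2)"
    if "N > 0" for N x y
  proof -
    \<comment> \<open>The exponents that occur are \<open>i\<close>, \<open>i - 1\<close> and \<open>i + 1\<close> with \<open>i \<le> N\<close>; all are less than \<open>L\<close> in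
      absolute value.\<close>
    define L where "L = Suc (Suc N)"
    define \<omega> where "\<omega> k = cis (2 * pi * real k / real L)" for k
    have \<omega>: "cmod (\<omega> k) = 1" "\<omega> k \<noteq> 0" "cnj (\<omega> k) = \<omega> k powi - 1" for k
      by (auto simp: \<omega>_def cis_cnj cis_powi)
    have roots: "(\<Sum>k<L. \<omega> k powi j) = (if j = 0 then of_nat L else 0)" if "\<bar>j\<bar> < int L" for j
      using sum_roots_of_unity[of L j] that by (auto simp: \<omega>_def L_def)
    have pair: "(\<Sum>k<L. \<omega> k powi a * \<Theta> (Suc N) (\<omega> k) v w)
        = (\<Sum>i<Suc N. of_real (fejer_coeff (Suc N) i) * cinner (B i v) w * (if a + int i = 0 then of_nat L else 0))"
      if "\<bar>a\<bar> \<le> 1" for a v w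
    proof -
      have "(\<Sum>k<L. \<omega> k powi a * \<Theta> (Suc N) (\<omega> k) v w)
          = (\<Sum>k<L. \<Sum>i<Suc N. of_real (fejer_coeff (Suc N) i) * cinner (B i v) w * \<omega> k powi (a + int i))"
        unfolding \<Theta>_def sum_distrib_left
        by (intro sum.cong refl) (simp add: power_int_add \<omega>(2) mult_ac)
      also have "\<dots> = (\<Sum>i<Suc N. of_real (fejer_coeff (Suc N) i) * cinner (B i v) w * (\<Sum>k<L. \<omega> k powi (a + int i)))"
        by (subst sum.swap) (simp only: sum_distrib_left)
      also have "\<dots> = (\<Sum>i<Suc N. of_real (fejer_coeff (Suc N) i) * cinner (B i v) w * (if a + int i = 0 then of_nat L else 0))"
        using that by (intro sum.cong refl arg_cong2[where f = "(*)"] roots) (auto simp: L_def)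
      finally show ?thesis .
    qed
    have diag: "(\<Sum>k<L. \<Theta> (Suc N) (\<omega> k) v v) = of_nat L * (of_nat (Suc N) * of_real ((norm v)\<^sup>2))" for v
    proof -
      have "(\<Sum>k<L. \<Theta> (Suc N) (\<omega> k) v v) = of_real (fejer_coeff (Suc N) 0) * cinner (B 0 v) v * of_nat L"
        using pair[of 0 v v] by (simp add: sum.lessThan_Suc_shift del: sum.lessThan_Suc)
      then show ?thesis by (simp add: fejer_coeff_def B0 cinner_self)
    qed
    have first: "(\<Sum>k<L. \<omega> k powi - 1 * \<Theta> (Suc N) (\<omega> k) x y) = of_nat L * (2 * of_nat N * cinner (B 1 x) y)"
    proof -
      have "(\<Sum>k<L. \<omega> k powi - 1 * \<Theta> (Suc N) (\<omega> k) x y) = (\<Sum>i<Suc N.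
          of_real (fejer_coeff (Suc N) i) * cinner (B i x) y * (if - 1 + int i = 0 then of_nat L else 0))"
        by (rule pair) simp
      also have "\<dots> = (\<Sum>i<Suc N. if i = 1
          then of_real (fejer_coeff (Suc N) 1) * cinner (B 1 x) y * of_nat L else 0)"
        by (intro sum.cong refl) auto
      also have "\<dots> = of_real (fejer_coeff (Suc N) 1) * cinner (B 1 x) y * of_nat L"
        using that by (simp del: sum.lessThan_Suc)
      finally show ?thesis by (simp add: fejer_coeff_def)
    qed
    have second: "(\<Sum>k<L. \<omega> k powi - 1 * cnj (\<Theta> (Suc N) (\<omega> k) y x)) = 0"
    proof -
      have "(\<Sum>k<L. \<omega> k powi - 1 * cnj (\<Theta> (Suc N) (\<omega> k) y x)) = cnj (\<Sum>k<L. \<omega> k powi 1 * \<Theta> (Suc N) (\<omega> k) y x)"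
        unfolding cnj_sum by (intro sum.cong refl) (simp add: \<omega>(3))
      also have "(\<Sum>k<L. \<omega> k powi 1 * \<Theta> (Suc N) (\<omega> k) y x) = 0"
        by (subst pair) (auto intro!: sum.neutral)
      finally show ?thesis by simp
    qed
    have "of_nat L * (2 * of_nat N * cinner (B 1 x) y) = (\<Sum>k<L. \<omega> k powi - 1 * F (Suc N) (\<omega> k) x y)"
      by (simp only: F_def distrib_left sum.distrib first second add_0_right)
    also have "cmod \<dots> \<le> (\<Sum>k<L. Re (\<Theta> (Suc N) (\<omega> k) x x) + Re (\<Theta> (Suc N) (\<omega> k) y y))"
      by (rule order_trans[OF norm_sum sum_mono])
        (simp add: norm_mult norm_inverse \<omega>(1) F_le)
    also have "\<dots> = Re (\<Sum>k<L. \<Theta> (Suc N) (\<omega> k) x x) + Re (\<Sum>k<L. \<Theta> (Suc N) (\<omega> k) y y)"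
      by (simp add: sum.distrib)
    also have "\<dots> = real L * (real (Suc N) * ((norm x)\<^sup>2 + (norm y)\<^sup>2))"
      unfolding diag by (simp add: algebra_simps flip: of_real_power)
    finally have "real L * (2 * real N * cmod (cinner (B 1 x) y)) \<le> real L * (real (Suc N) * ((norm x)\<^sup>2 + (norm y)\<^sup>2))"
      by (simp add: norm_mult)
    then show ?thesis by (simp add: L_def)
  qed
  have half: "cmod (cinner (B 1 x) y) \<le> 1 * ((norm x)\<^sup>2 + (norm y)\<^sup>2) / 2" for x y
  proof (rule tendsto_lowerbound)
    let ?s = "(norm x)\<^sup>2 + (norm y)\<^sup>2"
    have "(\<lambda>N. (1 + 1 / real N) * ?s / 2) \<longlonglongrightarrow> (1 + 0) * ?s / 2"
      by (intro tendsto_intros lim_1_over_n) simp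
    then show "(\<lambda>N. (1 + 1 / real N) * ?s / 2) \<longlonglongrightarrow> 1 * ?s / 2" by simp
    show "eventually (\<lambda>N. cmod (cinner (B 1 x) y) \<le> (1 + 1 / real N) * ?s / 2) sequentially"
      using eventually_gt_at_top[of 0]
    proof eventually_elim
      case (elim N)
      then show ?case using bound[OF elim, of x y] by (simp add: field_simps)
    qed
  qed simp
  show ?thesis
    by (rule norm_le_of_cinner_bound[OF sesquilinear_le_of_le_half_squares[OF half]])
      (auto simp: blinfun.scaleR_right cinner_scaleR_left cinner_scaleR_right)
qed


section \<open>The class of the resolvent condition\<close>

lemma compact_closed_annulus: "compact (closed_annulus R)"
proof -
  have "closed_annulus R = cball 0 R - ball 0 (1 / R)"
    by (auto simp: closed_annulus_def)
  then show ?thesis by (simp add: compact_diff)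
qed

lemma closure_annulus:
  assumes "R > 1"
  shows "closure (annulus R) = closed_annulus R"
proof
  show "closure (annulus R) \<subseteq> closed_annulus R"
    by (rule closure_minimal[OF _ compact_imp_closed[OF compact_closed_annulus]])
      (auto simp: annulus_def closed_annulus_def)
  show "closed_annulus R \<subseteq> closure (annulus R)"
  proof
    fix z assume z: "z \<in> closed_annulus R"
    have R: "1 / R < 1" using assms by simp
    have "cmod z > 0" using z assms R by (auto simp: closed_annulus_def intro: less_le_trans[of 0 "1 / R"])
    \<comment> \<open>\<open>z\<close> is moved radially towards the unit circle, which lies in the open annulus\<close>
    define w where "w n = of_real (((1 - 1 / real (Suc (Suc n))) * cmod z + 1 / real (Suc (Suc n))) / cmod z) * z" for n
    have "w n \<in> annulus R" for n
    proof -
      define t where "t = 1 / real (Suc (Suc n))"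
      have t: "0 < t" "t < 1" by (auto simp: t_def)
      have "cmod (w n) = (1 - t) * cmod z + t"
      proof -
        have "cmod (w n) = \<bar>((1 - t) * cmod z + t) / cmod z\<bar> * cmod z"
          by (simp only: w_def t_def norm_mult norm_of_real)
        then show ?thesis using \<open>cmod z > 0\<close> t by (simp add: abs_of_pos add_nonneg_pos)
      qed
      moreover have "(1 - t) * (1 / R) \<le> (1 - t) * cmod z" "(1 - t) * cmod z \<le> (1 - t) * R"
        using z t mult_left_mono[of "1 / R" "cmod z" "1 - t"] mult_left_mono[of "cmod z" R "1 - t"]
        by (auto simp: closed_annulus_def)
      moreover have "t * (1 / R) < t * 1" "t * 1 < t * R" 
        using mult_strict_left_mono[OF R t(1)] mult_strict_left_mono[OF assms t(1)] by auto
      ultimately show ?thesis by (simp add: annulus_def algebra_simps diff_divide_distrib)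
    qed
    moreover have "w \<longlonglongrightarrow> of_real (((1 - 0) * cmod z + 0) / cmod z) * z"
      unfolding w_def using LIMSEQ_Suc[OF LIMSEQ_inverse_real_of_nat] \<open>cmod z > 0\<close>
      by (intro tendsto_intros) (auto simp: inverse_eq_divide)
    then have "w \<longlonglongrightarrow> z" using \<open>cmod z > 0\<close> by simp
    ultimately show "z \<in> closure (annulus R)" unfolding closure_sequential by blast
  qed
qed

context
  fixes T :: "'a::complex_hilbert \<Rightarrow>\<^sub>L 'a"
  assumes T: "T \<in> bounded_ops" "op_invertible T"
begin

lemma laurent_S_in_bounded_ops: "laurent_S R c T f \<in> bounded_ops"
  by (simp add: laurent_S_def laurent_op_in_bounded_ops[OF T] adj_in_bounded_ops)

lemma laurent_S_add: "laurent_S R c T (f + g) = laurent_S R c T f + laurent_S R c T g"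
proof -
  have "scalar_op (a + b) = scalar_op a + (scalar_op b :: 'a \<Rightarrow>\<^sub>L 'a)" for a b
    by (rule blinfun_eqI) (simp add: blinfun.add_left scaleC_add_left)
  then show ?thesis
    by (simp add: laurent_S_def laurent_op_add cauchy_conj_add adj_simps lookup_add distrib_left
        laurent_op_in_bounded_ops[OF T] scaleR_add_right)
qed

lemma laurent_S_sum: "laurent_S R c T (\<Sum>i\<in>I. f i) = (\<Sum>i\<in>I. laurent_S R c T (f i))"
  using Modules.additive.sum[of "laurent_S R c T"] laurent_S_add by (simp add: Modules.additive_def)

lemma laurent_S_scale: "laurent_S R c T (lmonom 0 a * f) = scalar_op a o\<^sub>L laurent_S R c T f"
  unfolding laurent_S_def laurent_op_scale cauchy_conj_scale lcoeff_scale
  by (rule blinfun_eqI)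
    (simp add: adj_simps laurent_op_in_bounded_ops[OF T] adj_in_bounded_ops op_scaleC
      blinfun.bilinear_simps scaleC_add_right scaleC_scaleC scaleR_scaleC mult_ac)

lemma laurent_S_one:
  assumes "c > -2"
  shows "laurent_S R c T 1 = id_blinfun"
proof -
  have "cauchy_conj R 1 = 1" using cauchy_conj_monom[of R 0 1] by simp
  then have "laurent_S R c T 1 = (1 / (2 + c)) *\<^sub>R (id_blinfun + id_blinfun + scalar_op (of_real c))"
    by (simp add: laurent_S_def adj_id)
  also have "\<dots> = (1 / (2 + c)) *\<^sub>R ((2 + c) *\<^sub>R id_blinfun)"
    by (rule arg_cong[where f = "(*\<^sub>R) _"], rule blinfun_eqI)
      (simp add: blinfun.bilinear_simps scaleR_add_left scaleR_2 flip: scaleR_scaleC)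
  finally show ?thesis using assms by simp
qed

end

lemma laurent_mean_reflected:
  "((\<lambda>t. laurent_eval f (of_real r * cis (- t))) has_integral of_real (2 * pi) * lcoeff f 0) {0..2 * pi}"
proof (induction f rule: laurent_induct)
  case (monom m a)
  have "((\<lambda>t. (a * of_real r powi m) * cis (of_int (- m) * t)) has_integral
    (a * of_real r powi m) * (if - m = 0 then of_real (2 * pi) else 0)) {0..2 * pi}"
    by (intro has_integral_mult_right has_integral_cis)
  moreover have "laurent_eval (lmonom m a) (of_real r * cis (- t))
    = (a * of_real r powi m) * cis (of_int (- m) * t)" for t
    by (simp add: laurent_eval_monom power_int_mult_distrib cis_powi)
  ultimately show ?case by (simp add: lookup_single when_def mult_ac split: if_splits)
next
  case (add f g)
  from has_integral_add[OF this] show ?case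
    by (simp add: laurent_eval_add lookup_add algebra_simps)
qed

lemma DLA_spectrum:
  assumes "T \<in> DLA R c" "1 < R" "R < R'"
  shows "T \<in> bounded_ops" "spectrum T \<subseteq> annulus R'"
proof -
  have "closed_annulus R \<subseteq> annulus R'"
    using assms(2,3) frac_less2[of 1 1 R R'] by (auto simp: closed_annulus_def annulus_def)
  then show "T \<in> bounded_ops" "spectrum T \<subseteq> annulus R'"
    using assms closure_annulus by (auto simp: DLA_def)
qed

text \<open>For a fixed vector \<open>x\<close> the condition on the resolvents says that the quadratic forms \<open>P(t)\<close> and
  \<open>Q(u)\<close> of the kernels on the two circles satisfy \<open>P(t) + Q(u) + c \<parallel>x\<parallel>\<^sup>2 \<ge> 0\<close> for all \<open>t\<close> and \<open>u\<close>
  independently. So \<open>P + \<beta> \<ge> 0\<close> and \<open>Q + c \<parallel>x\<parallel>\<^sup>2 - \<beta> \<ge> 0\<close> for a suitable constant \<open>\<beta>\<close>, and as the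
  mean of \<open>f\<close> is the same on both circles, the term \<open>c a\<^sub>0\<close> may be shared out between them
  accordingly.\<close>

lemma laurent_S_positive:
  fixes T :: "'a::complex_hilbert \<Rightarrow>\<^sub>L 'a"
  assumes DLA: "T \<in> DLA R c" and "1 < R" "R < R'" and "c > -2"
    and f: "\<And>z. z \<in> closed_annulus R' \<Longrightarrow> 0 \<le> Re (laurent_eval f z)"
  shows "0 \<le> Re (cinner (laurent_S R' c T f x) x)"
proof -
  note T = DLA_spectrum[OF DLA \<open>1 < R\<close> \<open>R < R'\<close>]
  have "R' > 1" using assms by simp
  have inv: "op_invertible T" using op_invertible_of_annulus[OF T] \<open>R' > 1\<close> by simp
  let ?Q = "op_inverse T"
  have res: "op_invertible (id_blinfun - (scalar_op (cis (- t) / of_real R') o\<^sub>L T))"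
    "op_invertible (id_blinfun - (scalar_op (cis (- t) / of_real R') o\<^sub>L ?Q))" for t
    using \<open>R' > 1\<close>
    by (intro op_invertible_id_minus_scaled[OF T] op_invertible_id_minus_scaled_inverse[OF T];
        simp add: norm_divide)+
  then have W_ops: "circle_resolvent R' T t \<in> bounded_ops" "circle_resolvent R' ?Q t \<in> bounded_ops" for t
    by (auto simp: circle_resolvent_def op_inverse_in_bounded_ops)
  let ?n = "(norm x)\<^sup>2"
  define P where "P t = 2 * Re (cinner (circle_resolvent R' T t x) x)" for t
  define Q where "Q t = 2 * Re (cinner (circle_resolvent R' ?Q t x) x) - 2 * ?n" for t
  have form: "cinner ((W + adj W) x) x = of_real (2 * Re (cinner (W x) x))"
    if "W \<in> bounded_ops" for W :: "'a \<Rightarrow>\<^sub>L 'a"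
    using that by (simp add: blinfun.add_left cinner_add_left cinner_adj_left cinner_commute[of x] complex_add_cnj)
  have PQ: "0 \<le> P t + Q u + c * ?n" for t u
  proof -
    \<comment> \<open>points of the open disk, as \<open>R < R'\<close>, where the condition for \<open>R\<close> gives the kernels for \<open>R'\<close>\<close>
    let ?z = "\<lambda>t. cis (- t) * of_real (R / R')"
    have z: "?z t \<in> ball 0 1" "?z t / of_real R = cis (- t) / of_real R'" for t
      using \<open>1 < R\<close> \<open>R < R'\<close> by (auto simp: norm_mult norm_divide)
    let ?W = "circle_resolvent R' T t + circle_resolvent R' ?Q u"
    have "positive_op (2 *\<^sub>R op_Re (op_inverse (id_blinfun - (scalar_op (?z t / of_real R) o\<^sub>L T))
                      + op_inverse (id_blinfun - (scalar_op (?z u / of_real R) o\<^sub>L ?Q)))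
           - scalar_op 2 + scalar_op (of_real c))"
      using DLA z(1) unfolding DLA_def by blast
    then have "positive_op (2 *\<^sub>R op_Re ?W - scalar_op 2 + scalar_op (of_real c))"
      by (simp only: z(2) circle_resolvent_def)
    then have "0 \<le> Re (cinner ((2 *\<^sub>R op_Re ?W - scalar_op 2 + scalar_op (of_real c)) x) x)"
      by (simp add: positive_op_def)
    also have "2 *\<^sub>R op_Re ?W = ?W + adj ?W" by (simp add: op_Re_def)
    finally have "0 \<le> Re (cinner ((?W + adj ?W) x) x) - 2 * ?n + c * ?n"
      by (simp add: blinfun.add_left[of "_ - _"] blinfun.diff_left[of "_ + _"] cinner_add_left[of "_ - _"]
          cinner_diff_left cinner_scaleC_left cinner_self del: of_real_power)
    also have "cinner ((?W + adj ?W) x) x = of_real (2 * Re (cinner (?W x) x))"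
      using W_ops by (intro form) auto
    finally show ?thesis by (simp add: P_def Q_def blinfun.add_left cinner_add_left)
  qed
  define \<beta> where "\<beta> = - Inf (range P)"
  have lower: "- (Q u + c * ?n) \<le> P t" for t u using PQ[of t u] by simp
  have "Inf (range P) \<le> P t" for t
    using lower[of 0] by (intro cInf_lower bdd_belowI2[where m = "- (Q 0 + c * ?n)"]) auto
  then have P: "0 \<le> P t + \<beta>" for t by (simp add: \<beta>_def)
  have lower_Inf: "- (Q u + c * ?n) \<le> Inf (range P)" for u
    by (rule cInf_greatest) (use lower in auto)
  have Q: "0 \<le> Q u + (c * ?n - \<beta>)" for u using lower_Inf[of u] by (simp add: \<beta>_def)
  obtain I J where I: "has_outer_integral R' T f I" and J: "has_inner_integral R' T f J"
    and IJ: "I + J = laurent_op f T + adj (laurent_op (cauchy_conj R' f) T)"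
    using circle_integrals[OF T \<open>R' > 1\<close>] .
  let ?f1 = "\<lambda>t. laurent_eval f (of_real R' * cis t)"
  let ?f2 = "\<lambda>t. laurent_eval f (of_real (1 / R') * cis (- t))"
  have lin: "bounded_linear (\<lambda>X. Re (cinner (blinfun_apply X x) x))"
    by (intro bounded_linear_compose[OF bounded_linear_Re] bounded_linear_compose[OF bounded_linear_cinner_left]
        blinfun.bounded_linear_left)
  have "Re (cinner ((circle_kernel R' T t o\<^sub>L scalar_op (?f1 t)) x) x) = Re (?f1 t) * P t" for t
  proof -
    have "circle_kernel R' T t \<in> bounded_ops"
      using W_ops by (simp add: circle_kernel_def adj_in_bounded_ops)
    then show ?thesis
      using form[OF W_ops(1)[of t]] by (simp add: op_scaleC cinner_scaleC_left circle_kernel_def P_def)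
  qed
  then have H1: "((\<lambda>t. Re (?f1 t) * P t) has_integral 2 * pi * Re (cinner (I x) x)) {0..2 * pi}"
    using has_integral_linear[OF I[unfolded has_outer_integral_def] lin] by (simp add: o_def blinfun.scaleR_left cinner_scaleR_left)
  have "Re (cinner (((circle_kernel R' ?Q t - scalar_op 2) o\<^sub>L scalar_op (?f2 t)) x) x) = Re (?f2 t) * Q t" for t
  proof -
    have "circle_kernel R' ?Q t - scalar_op 2 \<in> bounded_ops"
      using W_ops by (simp add: circle_kernel_def adj_in_bounded_ops)
    moreover have "cinner ((circle_kernel R' ?Q t - scalar_op 2) x) x = of_real (Q t)"
      using form[OF W_ops(2)[of t]]
      by (simp add: circle_kernel_def blinfun.diff_left cinner_diff_left cinner_scaleC_left cinner_self Q_def)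
    ultimately show ?thesis by (simp add: op_scaleC cinner_scaleC_left)
  qed
  then have H2: "((\<lambda>t. Re (?f2 t) * Q t) has_integral 2 * pi * Re (cinner (J x) x)) {0..2 * pi}"
    using has_integral_linear[OF J[unfolded has_inner_integral_def] lin] by (simp add: o_def blinfun.scaleR_left cinner_scaleR_left)
  have A1: "((\<lambda>t. Re (?f1 t)) has_integral 2 * pi * Re (lcoeff f 0)) {0..2 * pi}"
    using has_integral_linear[OF laurent_coeff_integral[of R' f 0] bounded_linear_Re] \<open>R' > 1\<close>
    by (simp add: o_def)
  have A2: "((\<lambda>t. Re (?f2 t)) has_integral 2 * pi * Re (lcoeff f 0)) {0..2 * pi}"
    using has_integral_linear[OF laurent_mean_reflected[of f "1 / R'"] bounded_linear_Re]
    by (simp add: o_def)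
  let ?a = "Re (lcoeff f 0)"
  have "((\<lambda>t. Re (?f1 t) * P t + \<beta> * Re (?f1 t) + (Re (?f2 t) * Q t + (c * ?n - \<beta>) * Re (?f2 t))) has_integral
      (2 * pi * Re (cinner (I x) x) + \<beta> * (2 * pi * ?a)
        + (2 * pi * Re (cinner (J x) x) + (c * ?n - \<beta>) * (2 * pi * ?a)))) {0..2 * pi}"
    by (intro has_integral_add has_integral_mult_right H1 H2 A1 A2)
  then have "0 \<le> 2 * pi * Re (cinner (I x) x) + \<beta> * (2 * pi * ?a)
        + (2 * pi * Re (cinner (J x) x) + (c * ?n - \<beta>) * (2 * pi * ?a))"
  proof (rule has_integral_nonneg)
    fix t
    have "1 / R' \<le> R'" using \<open>R' > 1\<close> less_1_mult[of R' R'] by (simp add: field_simps)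
    then have f12: "0 \<le> Re (?f1 t)" "0 \<le> Re (?f2 t)"
      using \<open>R' > 1\<close> by (auto intro!: f simp: closed_annulus_def norm_mult norm_divide)
    have "0 \<le> Re (?f1 t) * (P t + \<beta>) + Re (?f2 t) * (Q t + (c * ?n - \<beta>))"
      by (rule add_nonneg_nonneg[OF mult_nonneg_nonneg[OF f12(1) P] mult_nonneg_nonneg[OF f12(2) Q]])
    then show "0 \<le> Re (?f1 t) * P t + \<beta> * Re (?f1 t) + (Re (?f2 t) * Q t + (c * ?n - \<beta>) * Re (?f2 t))"
      by (simp add: algebra_simps)
  qed
  also have "\<dots> = 2 * pi * (Re (cinner ((I + J) x) x) + c * ?n * ?a)"
    by (simp add: blinfun.add_left cinner_add_left algebra_simps)
  finally have "0 \<le> Re (cinner ((I + J) x) x) + c * ?n * ?a" using pi_gt_zero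
    by (auto simp: zero_le_mult_iff)
  moreover have "Re (cinner (laurent_S R' c T f x) x)
      = (1 / (2 + c)) * (Re (cinner ((I + J) x) x) + c * ?n * ?a)"
    unfolding laurent_S_def IJ[symmetric]
    by (simp add: blinfun.add_left blinfun.scaleR_left cinner_add_left cinner_scaleR_left cinner_scaleC_left
        cinner_self algebra_simps del: of_real_power)
  ultimately show ?thesis using \<open>c > -2\<close> by (simp add: zero_le_divide_iff)
qed

text \<open>The sequence \<open>S(f\<^sup>i)\<close> satisfies the positivity condition for contractions, because the Fejer sums of
  \<open>\<zeta> f\<close> have nonnegative real part.\<close>

lemma norm_laurent_S_le:
  fixes T :: "'a::complex_hilbert \<Rightarrow>\<^sub>L 'a"
  assumes DLA: "T \<in> DLA R c" and "1 < R" "R < R'" and "c > -2"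
    and f: "\<And>z. z \<in> closed_annulus R' \<Longrightarrow> cmod (laurent_eval f z) \<le> 1"
  shows "norm (laurent_S R' c T f) \<le> 1"
proof -
  note T = DLA_spectrum[OF DLA \<open>1 < R\<close> \<open>R < R'\<close>]
  have "R' > 1" using assms by simp
  have inv: "op_invertible T" using op_invertible_of_annulus[OF T] \<open>R' > 1\<close> by simp
  have "norm (laurent_S R' c T (f ^ 1)) \<le> 1"
  proof (rule contraction_of_fejer_positive[where B = "\<lambda>i. laurent_S R' c T (f ^ i)"])
    show "laurent_S R' c T (f ^ 0) = id_blinfun" by (simp add: laurent_S_one[OF T(1) inv \<open>c > -2\<close>])
    show "laurent_S R' c T (f ^ i) \<in> bounded_ops" for i by (rule laurent_S_in_bounded_ops[OF T(1) inv])
    fix N \<zeta> and x :: 'a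
    assume \<zeta>: "cmod \<zeta> = 1"
    define g where "g = (\<Sum>i<N. lmonom 0 (of_real (fejer_coeff N i) * \<zeta> ^ i) * f ^ i)"
    have "0 \<le> Re (laurent_eval g z)" if z: "z \<in> closed_annulus R'" for z
    proof -
      have "z \<noteq> 0" using z \<open>R' > 1\<close> by (rule closed_annulus_nonzero)
      then have "laurent_eval g z = (\<Sum>i<N. of_real (fejer_coeff N i) * (\<zeta> * laurent_eval f z) ^ i)"
        by (simp add: g_def laurent_eval_sum laurent_eval_mult laurent_eval_monom laurent_eval_power
            power_mult_distrib mult_ac)
      then show ?thesis using fejer_sum_nonneg f[OF z] \<zeta> by (simp only: norm_mult)
    qed
    then have "0 \<le> Re (cinner (laurent_S R' c T g x) x)"
      by (rule laurent_S_positive[OF DLA \<open>1 < R\<close> \<open>R < R'\<close> \<open>c > -2\<close>])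
    then show "0 \<le> Re (\<Sum>i<N. of_real (fejer_coeff N i) * \<zeta> ^ i * cinner (laurent_S R' c T (f ^ i) x) x)"
      by (simp add: g_def laurent_S_sum[OF T(1) inv] laurent_S_scale[OF T(1) inv] blinfun.sum_left
          cinner_sum_left cinner_scaleC_left del: Re_sum)
  qed
  then show ?thesis by simp
qed

section \<open>The constant for Laurent polynomials\<close>

lemma mat_bounded_one_iff: "mat_bounded 1 A B \<longleftrightarrow> (\<forall>x. norm (A 0 0 x) \<le> B * norm x)"
proof -
  have "fam_norm 1 x = norm (x 0)" for x :: "nat \<Rightarrow> 'a"
    by (simp add: fam_norm_def L2_set_def)
  moreover have "(\<forall>y :: nat \<Rightarrow> 'a. norm (A 0 0 (y 0)) \<le> B * norm (y 0)) \<longleftrightarrow> (\<forall>x. norm (A 0 0 x) \<le> B * norm x)"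
    by (auto dest: spec[of _ "\<lambda>_. x" for x])
  ultimately show ?thesis by (simp add: mat_bounded_def)
qed

lemma laurent_mat_bounded_one_iff:
  "laurent_mat_bounded 1 R F B \<longleftrightarrow> (\<forall>z\<in>closed_annulus R. cmod (laurent_eval (F 0 0) z) \<le> B)"
proof -
  have eq: "(\<forall>x. cmod (w * x) \<le> B * cmod x) \<longleftrightarrow> cmod w \<le> B" for w
    by (auto simp: norm_mult mult_right_mono dest: spec[of _ 1])
  show ?thesis unfolding laurent_mat_bounded_def mat_bounded_one_iff eq ..
qed

lemma norm_blinfun_le_iff: "B \<ge> 0 \<Longrightarrow> norm X \<le> B \<longleftrightarrow> (\<forall>x. norm (blinfun_apply X x) \<le> B * norm x)"
  by (meson norm_blinfun norm_blinfun_bound mult_right_mono norm_ge_zero order_trans)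

lemma laurent_eval_continuous_on:
  assumes "0 \<notin> A"
  shows "continuous_on A (laurent_eval f)" "laurent_eval f holomorphic_on A"
proof -
  have *: "laurent_eval f = (\<lambda>z. \<Sum>n\<in>Poly_Mapping.keys f. lcoeff f n * z powi n)"
    by (simp add: laurent_eval_def[abs_def] laurent_sum_def)
  show "laurent_eval f holomorphic_on A" unfolding * using assms by (auto intro!: holomorphic_intros)
  then show "continuous_on A (laurent_eval f)" by (rule holomorphic_on_imp_continuous_on)
qed

text \<open>Points of the larger annulus are projected radially to the smaller one.\<close>

lemma laurent_eval_near:
  assumes "R > 1" "\<epsilon> > 0"
  obtains R' where "R' > R"
    "\<And>z. z \<in> closed_annulus R' \<Longrightarrow> \<exists>w\<in>closed_annulus R. cmod (laurent_eval f z - laurent_eval f w) < \<epsilon>"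
proof -
  have "0 \<notin> closed_annulus (R + 1)" using assms by (simp add: closed_annulus_def)
  then have "uniformly_continuous_on (closed_annulus (R + 1)) (laurent_eval f)"
    by (intro compact_uniformly_continuous laurent_eval_continuous_on compact_closed_annulus)
  then obtain \<delta> where \<delta>: "\<delta> > 0" "\<And>z w. z \<in> closed_annulus (R + 1) \<Longrightarrow> w \<in> closed_annulus (R + 1) \<Longrightarrow>
      dist w z < \<delta> \<Longrightarrow> dist (laurent_eval f w) (laurent_eval f z) < \<epsilon>"
    using \<open>\<epsilon> > 0\<close> unfolding uniformly_continuous_on_def by metis
  define h where "h = min 1 (\<delta> / 2)"
  have h: "0 < h" "h \<le> 1" "h < \<delta>" using \<delta>(1) by (auto simp: h_def)
  have mono: "closed_annulus (R + s) \<subseteq> closed_annulus (R + 1)" if "0 \<le> s" "s \<le> 1" for s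
    using that assms frac_le[of 1 1 "R + s" "R + 1"] by (auto simp: closed_annulus_def)
  show ?thesis
  proof (rule that[of "R + h"])
    fix z assume z: "z \<in> closed_annulus (R + h)"
    have "1 / R - 1 / (R + h) = h / (R * (R + h))"
      using assms h by (simp add: field_simps)
    also have "\<dots> \<le> h / 1"
      using assms h mult_mono[of 1 R 1 "R + h"] by (intro divide_left_mono) auto
    finally have inner: "1 / R - h \<le> cmod z" using z by (simp add: closed_annulus_def)
    have outer: "cmod z \<le> R + h" using z by (simp add: closed_annulus_def)
    have "0 < 1 / (R + h)" using assms h by simp
    then have z0: "cmod z > 0" using z by (auto simp: closed_annulus_def)
    define r where "r = max (1 / R) (min R (cmod z))"
    define w where "w = of_real (r / cmod z) * z"
    have R1: "1 / R \<le> R" using assms less_1_mult[of R R] by (simp add: field_simps)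
    have "r > 0" using assms by (auto simp: r_def less_max_iff_disj)
    then have "cmod w = r" using z0 by (simp add: w_def norm_mult norm_divide)
    then have w: "w \<in> closed_annulus R" using R1 by (auto simp: closed_annulus_def r_def)
    have "z - w = of_real ((cmod z - r) / cmod z) * z" using z0 by (simp add: w_def diff_divide_distrib left_diff_distrib)
    then have "cmod (z - w) = \<bar>cmod z - r\<bar>" using z0 by (simp only: norm_mult norm_of_real) simp
    also have "\<dots> \<le> h" using inner outer R1 h(1) by (auto simp: r_def)
    finally have "dist w z < \<delta>" using h(3) by (simp add: dist_norm norm_minus_commute)
    moreover have "z \<in> closed_annulus (R + 1)" "w \<in> closed_annulus (R + 1)"
      using mono[of h] mono[of 0] h z w by auto
    ultimately have "dist (laurent_eval f w) (laurent_eval f z) < \<epsilon>" by (intro \<delta>(2))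
    then show "\<exists>w\<in>closed_annulus R. cmod (laurent_eval f z - laurent_eval f w) < \<epsilon>"
      using w by (auto simp: dist_norm norm_minus_commute)
  qed (use h in simp)
qed

definition spectral_constant :: "real \<Rightarrow> real" where
  "spectral_constant c = 1 + c / 2 + sqrt ((1 + c / 2)\<^sup>2 + 1 + \<bar>c\<bar>)"

lemma spectral_constant_nonneg: "c > -2 \<Longrightarrow> 0 \<le> spectral_constant c"
  by (auto simp: spectral_constant_def intro!: add_nonneg_nonneg)

text \<open>The estimate holds on every larger annulus, where the supremum of \<open>|f|\<close> exceeds \<open>B\<close> by
  arbitrarily little.\<close>

lemma DLA_laurent_bound:
  fixes T :: "'a::complex_hilbert \<Rightarrow>\<^sub>L 'a"
  assumes DLA: "T \<in> DLA R c" and "R > 1" "c > -2"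
    and B: "\<And>z. z \<in> closed_annulus R \<Longrightarrow> cmod (laurent_eval f z) \<le> B" "B > 0"
  shows "norm (laurent_op f T) \<le> spectral_constant c * B"
proof (rule tendsto_lowerbound[where F = "at_right 0" and f = "\<lambda>\<epsilon>. spectral_constant c * (B + \<epsilon>)"])
  have "((\<lambda>\<epsilon>. spectral_constant c * (B + \<epsilon>)) \<longlongrightarrow> spectral_constant c * (B + 0)) (at_right 0)"
    by (intro tendsto_intros)
  then show "((\<lambda>\<epsilon>. spectral_constant c * (B + \<epsilon>)) \<longlongrightarrow> spectral_constant c * B) (at_right 0)" by simp
  show "eventually (\<lambda>\<epsilon>. norm (laurent_op f T) \<le> spectral_constant c * (B + \<epsilon>)) (at_right 0)"
    using eventually_at_right_less[of 0]
  proof eventually_elim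
    case (elim \<epsilon>)
    obtain R' where R': "R' > R" "\<And>z. z \<in> closed_annulus R' \<Longrightarrow>
        \<exists>w\<in>closed_annulus R. cmod (laurent_eval f z - laurent_eval f w) < \<epsilon>"
      using laurent_eval_near[OF \<open>R > 1\<close> elim, where f = f] by blast
    note T = DLA_spectrum[OF DLA \<open>R > 1\<close> R'(1)]
    have "R' > 1" using \<open>R > 1\<close> R'(1) by simp
    have inv: "op_invertible T" using op_invertible_of_annulus[OF T] \<open>R' > 1\<close> by simp
    obtain M where M: "laurent_calculus_bound 1 R' T M"
      using laurent_calculus_bound_exists[OF T \<open>R' > 1\<close>] by blast
    have "laurent_calculus_bound 1 R' T (spectral_constant c)"
      unfolding spectral_constant_def
    proof (rule laurent_calculus_bound_K[OF \<open>R' > 1\<close> \<open>c > -2\<close> T(1) inv _ M])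
      fix F assume "laurent_mat_bounded 1 R' F 1"
      then have "norm (laurent_S R' c T (F 0 0)) \<le> 1"
        unfolding laurent_mat_bounded_one_iff
        by (intro norm_laurent_S_le[OF DLA \<open>R > 1\<close> R'(1) \<open>c > -2\<close>]) auto
      then show "op_mat_bounded 1 (\<lambda>i j. laurent_S R' c T (F i j)) 1"
        unfolding mat_bounded_one_iff by (simp add: norm_blinfun_le_iff)
    qed
    moreover have "laurent_mat_bounded 1 R' (\<lambda>_ _. f) (B + \<epsilon>)"
      unfolding laurent_mat_bounded_one_iff
    proof
      fix z assume "z \<in> closed_annulus R'"
      then obtain w where w: "w \<in> closed_annulus R" "cmod (laurent_eval f z - laurent_eval f w) < \<epsilon>"
        using R'(2) by blast
      then show "cmod (laurent_eval f z) \<le> B + \<epsilon>"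
        using B(1)[OF w(1)] norm_triangle_ineq2[of "laurent_eval f z" "laurent_eval f w"] by linarith
    qed
    ultimately have "op_mat_bounded 1 (\<lambda>_ _. laurent_op f T) (spectral_constant c * (B + \<epsilon>))"
      using laurent_calculus_boundD[of 1 R' T "spectral_constant c" "B + \<epsilon>"] \<open>R' > 1\<close> B(2) elim by simp
    then show ?case
      using spectral_constant_nonneg[OF \<open>c > -2\<close>] B(2) elim
      unfolding mat_bounded_one_iff by (simp add: norm_blinfun_le_iff)
  qed
qed simp

lemma scalar_mat_bounded_scalar_mat_norm: "mat_bounded m (\<lambda>i j x. M i j * x) (scalar_mat_norm m M)"
  unfolding scalar_mat_norm_def by (rule mat_bounded_mat_norm) (rule bounded_linear_mult_right)

lemma CDLA_laurent_bound:
  fixes T :: "'a::complex_hilbert \<Rightarrow>\<^sub>L 'a"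
  assumes CDLA: "T \<in> CDLA R c" and "R > 1" "c > -2" and "m \<ge> 1"
  shows "laurent_calculus_bound m R T (spectral_constant c)"
proof -
  have T: "T \<in> bounded_ops" "spectrum T \<subseteq> annulus R" using CDLA by (auto simp: CDLA_def)
  have inv: "op_invertible T" using op_invertible_of_annulus[OF T] \<open>R > 1\<close> by simp
  obtain M where M: "laurent_calculus_bound m R T M"
    using laurent_calculus_bound_exists[OF T \<open>R > 1\<close>] by blast
  show ?thesis
    unfolding spectral_constant_def
  proof (rule laurent_calculus_bound_K[OF \<open>R > 1\<close> \<open>c > -2\<close> T(1) inv _ M])
    fix F assume F: "laurent_mat_bounded m R F 1"
    have 0: "0 \<notin> closed_annulus R" using \<open>R > 1\<close> by (simp add: closed_annulus_def)
    then have mem: "laurent_eval (F i j) \<in> annulus_algebra R" for i j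
      unfolding annulus_algebra_def closure_annulus[OF \<open>R > 1\<close>]
      using \<open>R > 1\<close> by (auto intro!: laurent_eval_continuous_on simp: annulus_def)
    have le: "op_mat_norm m (\<lambda>i j. S_map R c T (f i j)) \<le> (SUP z\<in>closed_annulus R. scalar_mat_norm m (\<lambda>i j. f i j z))"
      if "\<And>i j. f i j \<in> annulus_algebra R" for f
      using CDLA \<open>m \<ge> 1\<close> that by (simp add: CDLA_def closure_annulus[OF \<open>R > 1\<close>])
    have "op_mat_norm m (\<lambda>i j. S_map R c T (laurent_eval (F i j)))
        \<le> (SUP z\<in>closed_annulus R. scalar_mat_norm m (\<lambda>i j. laurent_eval (F i j) z))"
      by (rule le[OF mem])
    also have "\<dots> \<le> 1"
    proof (rule cSUP_least)
      have "1 \<in> closed_annulus R" using \<open>R > 1\<close> by (simp add: closed_annulus_def)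
      then show "closed_annulus R \<noteq> {}" by blast
      show "scalar_mat_norm m (\<lambda>i j. laurent_eval (F i j) z) \<le> 1" if "z \<in> closed_annulus R" for z
        unfolding scalar_mat_norm_def using F that by (intro mat_norm_le) (auto simp: laurent_mat_bounded_def)
    qed
    finally have le: "op_mat_norm m (\<lambda>i j. laurent_S R c T (F i j)) \<le> 1"
      by (simp add: S_map_laurent[OF T \<open>R > 1\<close>])
    have "op_mat_bounded m (\<lambda>i j. laurent_S R c T (F i j)) (op_mat_norm m (\<lambda>i j. laurent_S R c T (F i j)))"
      unfolding op_mat_norm_def by (rule mat_bounded_mat_norm) (rule blinfun.bounded_linear_right)
    then show "op_mat_bounded m (\<lambda>i j. laurent_S R c T (F i j)) 1" using le by (rule mat_bounded_mono)
  qed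
qed


section \<open>Approximation of rational functions\<close>

definition laurent_approx ::
    "real \<Rightarrow> ('a::complex_hilbert \<Rightarrow>\<^sub>L 'a) \<Rightarrow> (complex \<Rightarrow> complex) \<Rightarrow> ('a \<Rightarrow>\<^sub>L 'a) \<Rightarrow> bool" where
  "laurent_approx R T g X \<longleftrightarrow> bounded (g ` closed_annulus R) \<and>
    (\<exists>F. uniform_limit (closed_annulus R) (\<lambda>k. laurent_eval (F k)) g sequentially \<and>
         (\<lambda>k. laurent_op (F k) T) \<longlonglongrightarrow> X)"

lemma laurent_bounded_image: "R > 1 \<Longrightarrow> bounded (laurent_eval f ` closed_annulus R)"
  by (intro compact_imp_bounded compact_continuous_image laurent_eval_continuous_on compact_closed_annulus)
    (simp add: closed_annulus_def)

lemma laurent_approx_laurent: "R > 1 \<Longrightarrow> laurent_approx R T (laurent_eval f) (laurent_op f T)"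
  unfolding laurent_approx_def
  by (intro conjI laurent_bounded_image exI[of _ "\<lambda>_. f"] uniform_limit_const tendsto_const)

lemma laurent_approx_mult:
  assumes "R > 1" and T: "T \<in> bounded_ops" "op_invertible T"
    and "laurent_approx R T g X" "laurent_approx R T h Y"
  shows "laurent_approx R T (\<lambda>z. g z * h z) (X o\<^sub>L Y)"
proof -
  note nz = closed_annulus_nonzero[OF _ \<open>R > 1\<close>]
  obtain F G where F: "uniform_limit (closed_annulus R) (\<lambda>k. laurent_eval (F k)) g sequentially"
      "(\<lambda>k. laurent_op (F k) T) \<longlonglongrightarrow> X"
    and G: "uniform_limit (closed_annulus R) (\<lambda>k. laurent_eval (G k)) h sequentially"
      "(\<lambda>k. laurent_op (G k) T) \<longlonglongrightarrow> Y"
    and bdd: "bounded (g ` closed_annulus R)" "bounded (h ` closed_annulus R)"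
    using assms(4,5) unfolding laurent_approx_def by blast
  have "uniform_limit (closed_annulus R) (\<lambda>k z. laurent_eval (F k) z * laurent_eval (G k) z)
      (\<lambda>z. g z * h z) sequentially"
    using F(1) G(1) bdd by (intro uniform_lim_mult)
  then have "uniform_limit (closed_annulus R) (\<lambda>k. laurent_eval (F k * G k)) (\<lambda>z. g z * h z) sequentially"
    by (rule uniform_limit_cong'[THEN iffD1, rotated -1])
      (simp_all add: laurent_eval_mult nz)
  moreover have "(\<lambda>k. laurent_op (F k * G k) T) \<longlonglongrightarrow> (X o\<^sub>L Y)"
    unfolding laurent_op_mult[OF T] by (intro tendsto_blinfun_compose F G)
  moreover have "bounded ((\<lambda>z. g z * h z) ` closed_annulus R)"
  proof -
    obtain a b where "\<And>z. z \<in> closed_annulus R \<Longrightarrow> cmod (g z) \<le> a" "\<And>z. z \<in> closed_annulus R \<Longrightarrow> cmod (h z) \<le> b"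
      using bdd unfolding bounded_iff by blast
    then have "cmod (g z * h z) \<le> \<bar>a\<bar> * \<bar>b\<bar>" if "z \<in> closed_annulus R" for z
      using that unfolding norm_mult by (intro mult_mono) (force+)
    then show ?thesis unfolding bounded_iff by blast
  qed
  ultimately show ?thesis unfolding laurent_approx_def by (intro conjI exI[of _ "\<lambda>k. F k * G k"])
qed

text \<open>This covers both expansions of the resolvent at a point \<open>a\<close> off the annulus: \<open>u\<close> will be \<open>z / a\<close> or
  \<open>a / z\<close>.\<close>

lemma laurent_approx_geometric:
  assumes "R > 1" and T: "T \<in> bounded_ops" "op_invertible T"
    and X: "X \<in> bounded_ops" "op_invertible (id_blinfun - X)" "(\<lambda>k. op_pow X k) \<longlonglongrightarrow> 0"
    and v: "\<And>z. z \<in> closed_annulus R \<Longrightarrow> laurent_eval v z = u z" "laurent_op v T = X"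
    and q: "\<And>z. z \<in> closed_annulus R \<Longrightarrow> cmod (u z) \<le> q" "0 \<le> q" "q < 1"
  shows "laurent_approx R T (\<lambda>z. 1 / (1 - u z)) (op_inverse (id_blinfun - X))"
proof -
  note nz = closed_annulus_nonzero[OF _ \<open>R > 1\<close>]
  let ?F = "\<lambda>N. \<Sum>k<N. v ^ k"
  have "uniform_limit (closed_annulus R) (\<lambda>N z. \<Sum>k<N. u z ^ k) (\<lambda>z. suminf (\<lambda>k. u z ^ k)) sequentially"
    by (rule Weierstrass_m_test[where M = "\<lambda>k. q ^ k"])
      (use q in \<open>auto simp: norm_power power_mono intro!: summable_geometric\<close>)
  then have "uniform_limit (closed_annulus R) (\<lambda>N. laurent_eval (?F N)) (\<lambda>z. 1 / (1 - u z)) sequentially"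
  proof (rule uniform_limit_cong'[THEN iffD1, rotated -1])
    fix z assume z: "z \<in> closed_annulus R"
    then show "suminf (\<lambda>k. u z ^ k) = 1 / (1 - u z)"
      using q(1)[OF z] q(3) by (intro suminf_geometric) simp
    show "(\<Sum>k<N. u z ^ k) = laurent_eval (?F N) z" for N
      using z by (simp add: laurent_eval_sum laurent_eval_power nz v)
  qed
  moreover have "(\<lambda>N. laurent_op (?F N) T) \<longlonglongrightarrow> op_inverse (id_blinfun - X)"
  proof -
    have "laurent_op (v ^ k) T = op_pow X k" for k
      by (induction k) (auto simp: laurent_op_mult[OF T] v(2))
    then show ?thesis using neumann_sums[OF X(2,3)] by (simp add: sums_def laurent_op_sum)
  qed
  moreover have "bounded ((\<lambda>z. 1 / (1 - u z)) ` closed_annulus R)"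
  proof -
    have "cmod (1 / (1 - u z)) \<le> 1 / (1 - q)" if "z \<in> closed_annulus R" for z
    proof -
      have "1 - q \<le> cmod (1 - u z)" using q(1)[OF that] norm_triangle_ineq2[of 1 "u z"] by simp
      then show ?thesis using q(3) by (simp add: norm_divide frac_le)
    qed
    then show ?thesis unfolding bounded_iff by blast
  qed
  ultimately show ?thesis unfolding laurent_approx_def by (intro conjI exI[of _ ?F])
qed

lemma op_powi_one: "op_powi T 1 = T" "op_powi T (- 1) = op_inverse T"
  by (simp_all add: op_powi_def)

lemma op_pow_scale_tendsto_zero:
  assumes X: "X \<in> bounded_ops" and C: "\<And>n. norm (op_pow X n) \<le> C * \<rho> ^ n" and "0 \<le> \<rho>" "cmod w * \<rho> < 1"
  shows "(\<lambda>k. op_pow (scalar_op w o\<^sub>L X) k) \<longlonglongrightarrow> 0"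
proof (rule Lim_null_comparison[OF always_eventually])
  have "(\<lambda>k. C * (cmod w * \<rho>) ^ k) \<longlonglongrightarrow> C * 0"
    by (intro tendsto_intros LIMSEQ_power_zero) (use assms in auto)
  then show "(\<lambda>k. C * (cmod w * \<rho>) ^ k) \<longlonglongrightarrow> 0" by simp
  have "norm (op_pow (scalar_op w o\<^sub>L X) k) \<le> cmod w ^ k * (C * \<rho> ^ k)" for k
    unfolding op_pow_scale[OF X] norm_power[symmetric]
    by (rule order_trans[OF norm_scalar_op_compose_le mult_left_mono[OF C]]) simp
  then show "\<forall>k. norm (op_pow (scalar_op w o\<^sub>L X) k) \<le> C * (cmod w * \<rho>) ^ k"
    by (simp add: power_mult_distrib mult_ac)
qed

text \<open>The resolvent at \<open>a\<close> is expanded in powers of \<open>T\<close> if \<open>|a| > R\<close>, and in powers of \<open>T\<^sup>-\<^sup>1\<close> if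
  \<open>|a| < 1 / R\<close>.\<close>

lemma laurent_approx_resolvent:
  fixes T :: "'a::complex_hilbert \<Rightarrow>\<^sub>L 'a"
  assumes "R > 1" and T: "T \<in> bounded_ops" and sp: "spectrum T \<subseteq> closed_annulus R" and a: "a \<notin> closed_annulus R"
  shows "op_invertible (T - scalar_op a)"
    and "laurent_approx R T (\<lambda>z. 1 / (z - a)) (op_inverse (T - scalar_op a))"
proof -
  note nz = closed_annulus_nonzero[OF _ \<open>R > 1\<close>]
  have sp': "spectrum T \<subseteq> annulus \<rho>" if "\<rho> > R" for \<rho>
  proof -
    have "closed_annulus R \<subseteq> annulus \<rho>"
      using that \<open>R > 1\<close> frac_less2[of 1 1 R \<rho>] by (auto simp: closed_annulus_def annulus_def)
    then show ?thesis using sp by blast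
  qed
  have inv: "op_invertible T" using op_invertible_of_annulus[OF T sp'[of "R + 1"]] \<open>R > 1\<close> by simp
  have "op_invertible (T - scalar_op a) \<and> laurent_approx R T (\<lambda>z. 1 / (z - a)) (op_inverse (T - scalar_op a))"
  proof (cases "cmod a > R")
    case True
    define \<rho> where "\<rho> = (R + cmod a) / 2"
    have \<rho>: "R < \<rho>" "\<rho> < cmod a" "\<rho> > 0" using True \<open>R > 1\<close> by (auto simp: \<rho>_def)
    have "a \<noteq> 0" using True \<open>R > 1\<close> by auto
    obtain C where C: "\<And>n. norm (op_powi T n) \<le> C * \<rho> ^ nat \<bar>n\<bar>"
      using op_powi_bound[OF T sp'[OF \<rho>(1)] \<rho>(3)] by blast
    let ?X = "scalar_op (1 / a) o\<^sub>L T"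
    have invX: "op_invertible (id_blinfun - ?X)"
      using \<rho> by (intro op_invertible_id_minus_scaled[OF T sp'[OF \<rho>(1)] \<rho>(3)]) (simp add: norm_divide frac_le)
    have approx: "laurent_approx R T (\<lambda>z. 1 / (1 - z / a)) (op_inverse (id_blinfun - ?X))"
    proof (rule laurent_approx_geometric[OF \<open>R > 1\<close> T inv, where v = "lmonom 1 (1 / a)" and q = "R / cmod a"])
      show "(\<lambda>k. op_pow ?X k) \<longlonglongrightarrow> 0"
        using C[of "int _"] \<rho> \<open>a \<noteq> 0\<close>
        by (intro op_pow_scale_tendsto_zero[where \<rho> = \<rho> and C = C] T) (auto simp: op_powi_of_nat norm_divide)
      show "R / cmod a < 1" using True \<open>R > 1\<close> by (simp add: divide_less_eq)
    qed (use T invX True \<open>R > 1\<close> in \<open>auto simp: laurent_eval_monom laurent_op_monom op_powi_one norm_divide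
        closed_annulus_def divide_right_mono\<close>)
    have eq: "T - scalar_op a = scalar_op (- a) o\<^sub>L (id_blinfun - ?X)"
      using \<open>a \<noteq> 0\<close> by (intro blinfun_eqI)
        (simp add: blinfun.diff_left scaleC_diff_right scaleC_scaleC scaleC_minus_one,
          metis scaleC_minus_one scaleC_scaleC mult_minus1 minus_diff_eq add_uminus_conv_diff diff_minus_eq_add add.commute)
    have "laurent_approx R T (\<lambda>z. 1 / (1 - z / a) * laurent_eval (lmonom 0 (- 1 / a)) z)
        (op_inverse (id_blinfun - ?X) o\<^sub>L laurent_op (lmonom 0 (- 1 / a)) T)"
      by (intro laurent_approx_mult laurent_approx_laurent approx \<open>R > 1\<close> T inv)
    also have "(\<lambda>z. 1 / (1 - z / a) * laurent_eval (lmonom 0 (- 1 / a)) z) = (\<lambda>z. 1 / (z - a))"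
      using \<open>a \<noteq> 0\<close> by (auto simp: laurent_eval_monom fun_eq_iff divide_simps)
    also have "op_inverse (id_blinfun - ?X) o\<^sub>L laurent_op (lmonom 0 (- 1 / a)) T = op_inverse (T - scalar_op a)"
      unfolding eq using \<open>a \<noteq> 0\<close> invX
      by (simp add: op_inverse_compose op_invertible_scalar_op op_inverse_scalar_op laurent_op_const)
    finally show ?thesis
      unfolding eq using op_invertible_compose[OF op_invertible_scalar_op invX] \<open>a \<noteq> 0\<close> by simp
  next
    case False
    then have small: "cmod a < 1 / R" using a by (simp add: closed_annulus_def)
    obtain \<rho> where \<rho>: "R < \<rho>" "cmod a * \<rho> < 1"
    proof (cases "a = 0")
      case True
      then show ?thesis using that[of "R + 1"] by simp
    next
      case False
      then show ?thesis using that[of "(R + 1 / cmod a) / 2"] small \<open>R > 1\<close> by (simp add: field_simps)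
    qed
    have "\<rho> > 0" using \<rho> \<open>R > 1\<close> by simp
    obtain C where C: "\<And>n. norm (op_powi T n) \<le> C * \<rho> ^ nat \<bar>n\<bar>"
      using op_powi_bound[OF T sp'[OF \<rho>(1)] \<open>\<rho> > 0\<close>] by blast
    let ?X = "scalar_op a o\<^sub>L op_inverse T"
    have invX: "op_invertible (id_blinfun - ?X)"
      using \<rho> \<open>\<rho> > 0\<close> by (intro op_invertible_id_minus_scaled_inverse[OF T sp'[OF \<rho>(1)] \<open>\<rho> > 0\<close>]) (simp add: field_simps)
    have le: "cmod (a / z) \<le> cmod a * R" if "z \<in> closed_annulus R" for z
    proof -
      have "1 / cmod z \<le> R" using that nz[OF that] \<open>R > 1\<close> by (auto simp: closed_annulus_def field_simps)
      then show ?thesis using mult_left_mono[of "1 / cmod z" R "cmod a"] by (simp add: norm_divide)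
    qed
    have approx: "laurent_approx R T (\<lambda>z. 1 / (1 - a / z)) (op_inverse (id_blinfun - ?X))"
    proof (rule laurent_approx_geometric[OF \<open>R > 1\<close> T inv, where v = "lmonom (- 1) a" and q = "cmod a * R"])
      show "(\<lambda>k. op_pow ?X k) \<longlonglongrightarrow> 0"
        using C[of "- int _"] \<rho> \<open>\<rho> > 0\<close>
        by (intro op_pow_scale_tendsto_zero[where \<rho> = \<rho> and C = C] op_inverse_in_bounded_ops inv)
          (auto simp: op_powi_minus_of_nat)
      show "cmod a * R < 1" using small \<open>R > 1\<close> by (simp add: field_simps)
    qed (use invX le \<open>R > 1\<close> in \<open>auto simp: laurent_eval_monom laurent_op_monom op_powi_one op_inverse_in_bounded_ops inv
        divide_inverse power_int_minus\<close>)
    have eq: "T - scalar_op a = (id_blinfun - ?X) o\<^sub>L T"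
      unfolding blinfun_compose_simps(3) blinfun_compose_assoc op_inverse_left[OF inv] by simp
    have "laurent_approx R T (\<lambda>z. laurent_eval (lmonom (- 1) 1) z * (1 / (1 - a / z)))
        (laurent_op (lmonom (- 1) 1) T o\<^sub>L op_inverse (id_blinfun - ?X))"
      by (intro laurent_approx_mult laurent_approx_laurent approx \<open>R > 1\<close> T inv)
    moreover have "laurent_op (lmonom (- 1) 1) T o\<^sub>L op_inverse (id_blinfun - ?X) = op_inverse (T - scalar_op a)"
      unfolding eq op_inverse_compose[OF invX inv]
      by (simp add: laurent_op_monom op_powi_one scalar_op_one)
    moreover have "laurent_eval (lmonom (- 1) 1) z * (1 / (1 - a / z)) = 1 / (z - a)" if "z \<in> closed_annulus R" for z
      using nz[OF that] by (simp add: laurent_eval_monom power_int_minus field_simps)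
    ultimately have "laurent_approx R T (\<lambda>z. 1 / (z - a)) (op_inverse (T - scalar_op a))"
      unfolding laurent_approx_def by (simp cong: image_cong uniform_limit_cong')
    then show ?thesis unfolding eq using op_invertible_compose[OF invX inv] by simp
  qed
  then show "op_invertible (T - scalar_op a)"
    "laurent_approx R T (\<lambda>z. 1 / (z - a)) (op_inverse (T - scalar_op a))" by auto
qed

section \<open>Rational functions of the operator\<close>

definition laurent_of_poly :: "complex poly \<Rightarrow> laurent" where
  "laurent_of_poly p = (\<Sum>n\<le>degree p. lmonom (int n) (coeff p n))"

lemma lcoeff_laurent_of_poly: "lcoeff (laurent_of_poly p) k = (if k \<ge> 0 then coeff p (nat k) else 0)"
proof -
  have "lcoeff (laurent_of_poly p) k = (\<Sum>n\<le>degree p. if int n = k then coeff p n else 0)"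
    by (simp add: laurent_of_poly_def lookup_sum lookup_single when_def)
  also have "\<dots> = (\<Sum>n\<le>degree p. if n = nat k then (if k \<ge> 0 then coeff p (nat k) else 0) else 0)"
    by (intro sum.cong) auto
  also have "\<dots> = (if k \<ge> 0 then coeff p (nat k) else 0)"
    by (auto simp: coeff_eq_0)
  finally show ?thesis .
qed

lemma lcoeff_shift: "lcoeff (lmonom 1 1 * f) k = lcoeff f (k - 1)"
  by (induction f rule: laurent_induct)
    (auto simp: mult_single lookup_single when_def lookup_add distrib_left)

text \<open>Through this the calculus of Laurent polynomials yields the multiplicativity of \<^const>\<open>op_poly\<close>.\<close>

lemma laurent_of_poly_mult: "laurent_of_poly (p * q) = laurent_of_poly p * laurent_of_poly q"
proof (induction p)
  case 0
  then show ?case by (simp add: laurent_of_poly_def)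
next
  case (pCons a p)
  have pCons_eq: "laurent_of_poly (pCons b r) = lmonom 0 b + lmonom 1 1 * laurent_of_poly r" for b r
    by (rule poly_mapping_eqI)
      (auto simp: lookup_add lookup_single when_def lcoeff_shift lcoeff_laurent_of_poly coeff_pCons
        nat_diff_distrib split: nat.splits)
  have "laurent_of_poly (pCons a p * q) = lmonom 0 a * laurent_of_poly q + laurent_of_poly (pCons 0 (p * q))"
    by (rule poly_mapping_eqI)
      (auto simp: lookup_add lcoeff_scale lcoeff_laurent_of_poly)
  then show ?case by (simp add: pCons_eq pCons.IH algebra_simps)
qed

lemma laurent_eval_of_poly: "laurent_eval (laurent_of_poly p) z = poly p z"
  by (simp add: laurent_of_poly_def laurent_eval_sum laurent_eval_monom poly_altdef)

lemma op_poly_eq_laurent_op: "op_poly p T = laurent_op (laurent_of_poly p) T"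
  by (simp add: op_poly_def laurent_of_poly_def laurent_op_sum laurent_op_monom op_powi_of_nat)

lemma op_poly_linear: "op_poly [:- a, 1:] T = T - scalar_op a"
  by (rule blinfun_eqI)
    (simp add: op_poly_def blinfun.bilinear_simps, metis scaleC_minus_one scaleC_scaleC mult_minus1
      add.commute add_uminus_conv_diff)

text \<open>The denominator is split into linear factors, whose zeros lie off the annulus.\<close>

lemma laurent_approx_inverse_poly:
  fixes T :: "'a::complex_hilbert \<Rightarrow>\<^sub>L 'a"
  assumes "R > 1" and T: "T \<in> bounded_ops" "op_invertible T" and sp: "spectrum T \<subseteq> closed_annulus R"
    and "\<forall>z\<in>closed_annulus R. poly q z \<noteq> 0"
  shows "op_invertible (op_poly q T) \<and> laurent_approx R T (\<lambda>z. 1 / poly q z) (op_inverse (op_poly q T))"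
  using assms(5)
proof (induction "degree q" arbitrary: q rule: less_induct)
  case less
  have one: "1 \<in> closed_annulus R" using \<open>R > 1\<close> by (simp add: closed_annulus_def)
  show ?case
  proof (cases "degree q = 0")
    case True
    then obtain b where q: "q = [:b:]" by (rule degree_eq_zeroE)
    have "b \<noteq> 0" using less.prems one by (auto simp: q)
    have "op_poly q T = scalar_op b" by (rule blinfun_eqI) (simp add: op_poly_def q)
    moreover have "laurent_approx R T (laurent_eval (lmonom 0 (1 / b))) (laurent_op (lmonom 0 (1 / b)) T)"
      by (rule laurent_approx_laurent) fact
    moreover have "laurent_eval (lmonom 0 (1 / b)) = (\<lambda>z. 1 / poly q z)"
      by (simp add: laurent_eval_monom q fun_eq_iff)
    ultimately show ?thesis
      using \<open>b \<noteq> 0\<close> by (simp add: op_invertible_scalar_op op_inverse_scalar_op laurent_op_const)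
  next
    case False
    then have "\<not> constant (poly q)" by (simp add: constant_degree)
    then obtain a where a: "poly q a = 0" using fundamental_theorem_of_algebra by blast
    then obtain r where r: "q = [:- a, 1:] * r" unfolding poly_eq_0_iff_dvd by (elim dvdE)
    have "r \<noteq> 0" using False r by auto
    then have "degree r < degree q" unfolding r by (subst degree_mult_eq) auto
    moreover have "\<forall>z\<in>closed_annulus R. poly r z \<noteq> 0" using less.prems by (auto simp: r)
    ultimately have IH: "op_invertible (op_poly r T)"
      "laurent_approx R T (\<lambda>z. 1 / poly r z) (op_inverse (op_poly r T))"
      using less.hyps by blast+
    have "a \<notin> closed_annulus R" using less.prems a by blast
    note res = laurent_approx_resolvent[OF \<open>R > 1\<close> T(1) sp this]
    have q_op: "op_poly q T = (T - scalar_op a) o\<^sub>L op_poly r T"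
      unfolding r op_poly_eq_laurent_op laurent_of_poly_mult laurent_op_mult[OF T]
      by (simp flip: op_poly_eq_laurent_op add: op_poly_linear)
    have "laurent_approx R T (\<lambda>z. 1 / poly r z * (1 / (z - a)))
        (op_inverse (op_poly r T) o\<^sub>L op_inverse (T - scalar_op a))"
      by (intro laurent_approx_mult IH res \<open>R > 1\<close> T)
    moreover have "(\<lambda>z. 1 / poly r z * (1 / (z - a))) = (\<lambda>z. 1 / poly q z)"
      by (simp add: r fun_eq_iff algebra_simps)
    ultimately show ?thesis
      unfolding q_op op_inverse_compose[OF res(1) IH(1)]
      using op_invertible_compose[OF res(1) IH(1)] by simp
  qed
qed

lemma laurent_approx_rat:
  fixes T :: "'a::complex_hilbert \<Rightarrow>\<^sub>L 'a"
  assumes "R > 1" and T: "T \<in> bounded_ops" "op_invertible T" and sp: "spectrum T \<subseteq> closed_annulus R"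
    and "\<forall>z\<in>closed_annulus R. poly q z \<noteq> 0"
  shows "laurent_approx R T (\<lambda>z. poly p z / poly q z) (op_rat p q T)"
proof -
  have "laurent_approx R T (\<lambda>z. laurent_eval (laurent_of_poly p) z * (1 / poly q z))
      (laurent_op (laurent_of_poly p) T o\<^sub>L op_inverse (op_poly q T))"
    using laurent_approx_inverse_poly[OF assms]
    by (intro laurent_approx_mult laurent_approx_laurent \<open>R > 1\<close> T) auto
  then show ?thesis by (simp add: laurent_eval_of_poly op_rat_def op_poly_eq_laurent_op)
qed

lemma mat_bounded_perturb:
  assumes "mat_bounded m A B" "\<epsilon> \<ge> 0" "\<And>i j x. i < m \<Longrightarrow> j < m \<Longrightarrow> norm (A' i j x - A i j x) \<le> \<epsilon> * norm x"
  shows "mat_bounded m A' (B + real m * real m * \<epsilon>)"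
proof -
  have "mat_bounded m (\<lambda>i j x. A' i j x - A i j x) (real m * real m * \<epsilon>)"
    by (rule mat_bounded_entrywise) (use assms in auto)
  from mat_bounded_add[OF assms(1) this] show ?thesis by simp
qed

text \<open>A bound for matrices of Laurent polynomials extends to matrices of rational functions by
  simultaneous approximation of the entries, on the annulus and at \<open>T\<close>.\<close>

lemma rational_mat_bounded:
  fixes T :: "'a::complex_hilbert \<Rightarrow>\<^sub>L 'a"
  assumes "R > 1" and T: "T \<in> bounded_ops" "op_invertible T" and sp: "spectrum T \<subseteq> closed_annulus R"
    and K: "\<And>F B. B > 0 \<Longrightarrow> laurent_mat_bounded m R F B \<Longrightarrow> op_mat_bounded m (laurent_mat_op F T) (K * B)"
    and q: "\<And>i j z. i < m \<Longrightarrow> j < m \<Longrightarrow> z \<in> closed_annulus R \<Longrightarrow> poly (q i j) z \<noteq> 0"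
    and B: "\<And>z. z \<in> closed_annulus R \<Longrightarrow> mat_bounded m (\<lambda>i j x. poly (p i j) z / poly (q i j) z * x) B" "B \<ge> 0"
  shows "op_mat_bounded m (\<lambda>i j. op_rat (p i j) (q i j) T) (K * B)"
proof -
  let ?X = "\<lambda>i j. op_rat (p i j) (q i j) T" and ?g = "\<lambda>i j z. poly (p i j) z / poly (q i j) z"
  define approx where "approx i j G \<longleftrightarrow>
      uniform_limit (closed_annulus R) (\<lambda>k. laurent_eval (G k)) (?g i j) sequentially \<and>
      (\<lambda>k. laurent_op (G k) T) \<longlonglongrightarrow> ?X i j" for i j G
  define F where "F i j = (SOME G. approx i j G)" for i j
  have "approx i j (F i j)" if "i < m" "j < m" for i j
  proof -
    have "\<exists>G. approx i j G"
      using laurent_approx_rat[OF \<open>R > 1\<close> T sp, of "q i j" "p i j"] q[OF that]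
      unfolding laurent_approx_def approx_def by blast
    then show ?thesis unfolding F_def by (rule someI_ex)
  qed
  then have F: "uniform_limit (closed_annulus R) (\<lambda>k. laurent_eval (F i j k)) (?g i j) sequentially"
      "(\<lambda>k. laurent_op (F i j k) T) \<longlonglongrightarrow> ?X i j" if "i < m" "j < m" for i j
    using that unfolding approx_def by blast+
  have near: "op_mat_bounded m ?X (K * (B + real m * real m * \<epsilon> + \<epsilon>) + real m * real m * \<epsilon>)" if "\<epsilon> > 0" for \<epsilon>
  proof -
    have "eventually (\<lambda>k. \<forall>i\<in>{..<m}. \<forall>j\<in>{..<m}. (\<forall>z\<in>closed_annulus R. dist (laurent_eval (F i j k) z) (?g i j z) < \<epsilon>)
        \<and> dist (laurent_op (F i j k) T) (?X i j) < \<epsilon>) sequentially"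
      by (intro eventually_ball_finite finite_lessThan ballI eventually_conj
          uniform_limitD[OF F(1) \<open>\<epsilon> > 0\<close>] tendstoD[OF F(2) \<open>\<epsilon> > 0\<close>]) auto
    then obtain k where k: "\<And>i j z. i < m \<Longrightarrow> j < m \<Longrightarrow> z \<in> closed_annulus R \<Longrightarrow>
          dist (laurent_eval (F i j k) z) (?g i j z) < \<epsilon>"
        "\<And>i j. i < m \<Longrightarrow> j < m \<Longrightarrow> dist (laurent_op (F i j k) T) (?X i j) < \<epsilon>"
      unfolding eventually_sequentially by (meson lessThan_iff order_refl)
    have "laurent_mat_bounded m R (\<lambda>i j. F i j k) (B + real m * real m * \<epsilon>)"
      unfolding laurent_mat_bounded_def
    proof
      fix z assume z: "z \<in> closed_annulus R"
      show "mat_bounded m (\<lambda>i j x. laurent_eval (F i j k) z * x) (B + real m * real m * \<epsilon>)"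
      proof (rule mat_bounded_perturb[OF B(1)[OF z]])
        fix i j x assume "i < m" "j < m"
        then have "cmod (laurent_eval (F i j k) z - ?g i j z) \<le> \<epsilon>"
          using k(1)[OF _ _ z] by (simp add: dist_norm less_imp_le)
        then show "norm (laurent_eval (F i j k) z * x - ?g i j z * x) \<le> \<epsilon> * norm x"
          unfolding left_diff_distrib[symmetric] norm_mult by (rule mult_right_mono) simp
      qed (use \<open>\<epsilon> > 0\<close> in auto)
    qed
    then have "laurent_mat_bounded m R (\<lambda>i j. F i j k) (B + real m * real m * \<epsilon> + \<epsilon>)"
      using \<open>\<epsilon> > 0\<close> unfolding laurent_mat_bounded_def by (auto intro: mat_bounded_mono)
    then have "op_mat_bounded m (\<lambda>i j. laurent_op (F i j k) T) (K * (B + real m * real m * \<epsilon> + \<epsilon>))"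
      using \<open>\<epsilon> > 0\<close> \<open>B \<ge> 0\<close> by (intro K) (auto intro: add_nonneg_pos)
    then show ?thesis
    proof (rule mat_bounded_perturb)
      fix i j x assume "i < m" "j < m"
      then have "norm (?X i j - laurent_op (F i j k) T) \<le> \<epsilon>"
        using k(2)[of i j] by (simp add: dist_norm norm_minus_commute)
      then have "norm ((?X i j - laurent_op (F i j k) T) x) \<le> \<epsilon> * norm x"
        by (rule order_trans[OF norm_blinfun mult_right_mono]) simp
      then show "norm (?X i j x - laurent_op (F i j k) T x) \<le> \<epsilon> * norm x" by (simp add: blinfun.diff_left)
    qed (use \<open>\<epsilon> > 0\<close> in auto)
  qed
  show ?thesis
  proof (rule op_mat_boundedI)
    fix x :: "nat \<Rightarrow> 'a"
    let ?b = "\<lambda>\<epsilon>. (K * (B + real m * real m * \<epsilon> + \<epsilon>) + real m * real m * \<epsilon>) * fam_norm m x"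
    have "(?b \<longlongrightarrow> (K * (B + real m * real m * 0 + 0) + real m * real m * 0) * fam_norm m x) (at_right 0)"
      by (intro tendsto_intros)
    then have lim: "(?b \<longlongrightarrow> K * B * fam_norm m x) (at_right 0)" by simp
    show "fam_norm m (op_mat_apply m ?X x) \<le> K * B * fam_norm m x"
    proof (rule tendsto_lowerbound[OF lim])
      show "eventually (\<lambda>\<epsilon>. fam_norm m (op_mat_apply m ?X x) \<le> ?b \<epsilon>) (at_right 0)"
        using eventually_at_right_less[of 0] by eventually_elim (intro op_mat_boundedD near)
    qed simp
  qed
qed

lemma one_in_closed_annulus: "R > 1 \<Longrightarrow> 1 \<in> closed_annulus R"
  by (simp add: closed_annulus_def)

lemma rational_bounded_on_annulus:
  assumes "R > 1" "\<forall>z\<in>closed_annulus R. poly q z \<noteq> 0"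
  shows "\<exists>b\<ge>0. \<forall>z\<in>closed_annulus R. cmod (poly p z / poly q z) \<le> b"
proof -
  have compact: "compact ((\<lambda>z. poly p z / poly q z) ` closed_annulus R)"
    using assms by (intro compact_continuous_image compact_closed_annulus continuous_intros) auto
  obtain b where "\<forall>z\<in>closed_annulus R. cmod (poly p z / poly q z) \<le> b"
    using compact_imp_bounded[OF compact] by (auto simp: bounded_iff)
  moreover have "0 \<le> cmod (poly p 1 / poly q 1)" by simp
  ultimately show ?thesis
    using one_in_closed_annulus[OF \<open>R > 1\<close>] order_trans by blast
qed

lemma DLA_K_spectral_set:
  fixes T :: "'a::complex_hilbert \<Rightarrow>\<^sub>L 'a"
  assumes DLA: "T \<in> DLA R c" and "R > 1" "c > -2"
  shows "K_spectral_set (spectral_constant c) (closure (annulus R)) T"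
  unfolding K_spectral_set_def closure_annulus[OF \<open>R > 1\<close>]
proof (intro conjI allI impI)
  show T: "T \<in> bounded_ops" and sp: "spectrum T \<subseteq> closed_annulus R"
    using DLA closure_annulus[OF \<open>R > 1\<close>] by (auto simp: DLA_def)
  have inv: "op_invertible T"
    using op_invertible_of_annulus[OF DLA_spectrum[OF DLA \<open>R > 1\<close>, of "R + 1"]] \<open>R > 1\<close> by simp
  fix p q assume q: "\<forall>z\<in>closed_annulus R. poly q z \<noteq> 0"
  let ?B = "SUP z\<in>closed_annulus R. cmod (poly p z / poly q z)"
  obtain b where b: "\<forall>z\<in>closed_annulus R. cmod (poly p z / poly q z) \<le> b"
    using rational_bounded_on_annulus[OF \<open>R > 1\<close> q] by blast
  then have le: "cmod (poly p z / poly q z) \<le> ?B" if "z \<in> closed_annulus R" for z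
    using that by (intro cSUP_upper bdd_aboveI2[where M = b]) auto
  then have "0 \<le> ?B"
    using order_trans[OF norm_ge_zero le[OF one_in_closed_annulus[OF \<open>R > 1\<close>]]] by blast
  have "op_mat_bounded 1 (\<lambda>_ _. op_rat p q T) (spectral_constant c * ?B)"
  proof (rule rational_mat_bounded[OF \<open>R > 1\<close> T inv sp, where p = "\<lambda>_ _. p" and q = "\<lambda>_ _. q"])
    fix F B assume "(B :: real) > 0" "laurent_mat_bounded 1 R F B"
    then have "norm (laurent_op (F 0 0) T) \<le> spectral_constant c * B"
      unfolding laurent_mat_bounded_one_iff by (intro DLA_laurent_bound[OF DLA \<open>R > 1\<close> \<open>c > -2\<close>]) auto
    then show "op_mat_bounded 1 (laurent_mat_op F T) (spectral_constant c * B)"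
      unfolding mat_bounded_one_iff
      using spectral_constant_nonneg[OF \<open>c > -2\<close>] \<open>B > 0\<close> by (simp add: norm_blinfun_le_iff)
  next
    fix z assume "z \<in> closed_annulus R"
    then show "mat_bounded 1 (\<lambda>_ _ x. poly p z / poly q z * x) ?B"
      unfolding mat_bounded_one_iff norm_mult by (intro allI mult_right_mono le) auto
  qed (use q \<open>0 \<le> ?B\<close> in auto)
  then show "norm (op_rat p q T) \<le> spectral_constant c * ?B"
    unfolding mat_bounded_one_iff
    using spectral_constant_nonneg[OF \<open>c > -2\<close>] \<open>0 \<le> ?B\<close> by (simp add: norm_blinfun_le_iff)
qed (rule compact_closed_annulus)

lemma scalar_mat_norm_nonneg:
  assumes "m \<ge> 1"
  shows "0 \<le> scalar_mat_norm m M"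
proof -
  have "norm (M 0 0 * 1) \<le> scalar_mat_norm m M * norm (1 :: complex)"
    by (rule mat_bounded_entry[OF scalar_mat_bounded_scalar_mat_norm]) (use assms in auto)
  then show ?thesis using norm_ge_zero[of "M 0 0"] by (simp del: norm_ge_zero)
qed

lemma CDLA_complete_K_spectral_set:
  fixes T :: "'a::complex_hilbert \<Rightarrow>\<^sub>L 'a"
  assumes CDLA: "T \<in> CDLA R c" and "R > 1" "c > -2"
  shows "complete_K_spectral_set (spectral_constant c) (closure (annulus R)) T"
  unfolding complete_K_spectral_set_def closure_annulus[OF \<open>R > 1\<close>]
proof (intro conjI allI impI)
  show T: "T \<in> bounded_ops" using CDLA by (simp add: CDLA_def)
  have sp': "spectrum T \<subseteq> annulus R" using CDLA by (simp add: CDLA_def)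
  then show sp: "spectrum T \<subseteq> closed_annulus R"
    using closure_subset[of "annulus R"] closure_annulus[OF \<open>R > 1\<close>] by blast
  have inv: "op_invertible T" using op_invertible_of_annulus[OF T sp'] \<open>R > 1\<close> by simp
  fix m :: nat and p q :: "nat \<Rightarrow> nat \<Rightarrow> complex poly"
  assume "m \<ge> 1" and q: "\<forall>i<m. \<forall>j<m. \<forall>z\<in>closed_annulus R. poly (q i j) z \<noteq> 0"
  let ?M = "\<lambda>z i j. poly (p i j) z / poly (q i j) z"
  let ?B = "SUP z\<in>closed_annulus R. scalar_mat_norm m (?M z)"
  have "\<forall>i j. \<exists>b. i < m \<longrightarrow> j < m \<longrightarrow> b \<ge> 0 \<and> (\<forall>z\<in>closed_annulus R. cmod (?M z i j) \<le> b)"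
    using rational_bounded_on_annulus[OF \<open>R > 1\<close>] q by blast
  then obtain b where b: "\<And>i j. i < m \<Longrightarrow> j < m \<Longrightarrow> b i j \<ge> 0"
      "\<And>i j z. i < m \<Longrightarrow> j < m \<Longrightarrow> z \<in> closed_annulus R \<Longrightarrow> cmod (?M z i j) \<le> b i j"
    by metis
  define e where "e = (\<Sum>i<m. \<Sum>j<m. b i j)"
  have e: "b i j \<le> e" if "i < m" "j < m" for i j
  proof -
    have "b i j \<le> (\<Sum>j<m. b i j)" using that b(1) by (intro member_le_sum) auto
    also have "\<dots> \<le> e" unfolding e_def
      using that b(1) by (intro member_le_sum[of i _ "\<lambda>i. \<Sum>j<m. b i j"] sum_nonneg) auto
    finally show ?thesis .
  qed
  have "e \<ge> 0" using e[of 0 0] b(1)[of 0 0] \<open>m \<ge> 1\<close> by simp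
  have "scalar_mat_norm m (?M z) \<le> real m * real m * e" if z: "z \<in> closed_annulus R" for z
    unfolding scalar_mat_norm_def
  proof (intro mat_norm_le mat_bounded_entrywise)
    fix i j x assume "i < m" "j < m"
    then show "norm (?M z i j * x) \<le> e * norm x"
      unfolding norm_mult using order_trans[OF b(2) e] z by (intro mult_right_mono) auto
  qed (use \<open>e \<ge> 0\<close> in auto)
  then have le: "scalar_mat_norm m (?M z) \<le> ?B" if "z \<in> closed_annulus R" for z
    using that by (intro cSUP_upper bdd_aboveI2[where M = "real m * real m * e"]) auto
  have "0 \<le> ?B"
    by (rule order_trans[OF scalar_mat_norm_nonneg[OF \<open>m \<ge> 1\<close>] le[OF one_in_closed_annulus[OF \<open>R > 1\<close>]]])
  have "op_mat_bounded m (\<lambda>i j. op_rat (p i j) (q i j) T) (spectral_constant c * ?B)"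
  proof (rule rational_mat_bounded[OF \<open>R > 1\<close> T inv sp])
    show "op_mat_bounded m (laurent_mat_op F T) (spectral_constant c * B)"
      if "B > 0" "laurent_mat_bounded m R F B" for F B
      using laurent_calculus_boundD[OF CDLA_laurent_bound[OF CDLA \<open>R > 1\<close> \<open>c > -2\<close> \<open>m \<ge> 1\<close>] \<open>R > 1\<close> that] .
    show "mat_bounded m (\<lambda>i j x. ?M z i j * x) ?B" if "z \<in> closed_annulus R" for z
      using scalar_mat_bounded_scalar_mat_norm le[OF that] by (rule mat_bounded_mono)
  qed (use q \<open>0 \<le> ?B\<close> in auto)
  then show "op_mat_norm m (\<lambda>i j. op_rat (p i j) (q i j) T) \<le> spectral_constant c * ?B"
    unfolding op_mat_norm_def
    using spectral_constant_nonneg[OF \<open>c > -2\<close>] \<open>0 \<le> ?B\<close> by (intro mat_norm_le) auto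
qed (rule compact_closed_annulus)

section \<open>The theorem\<close>

theorem theorem5p3:
  fixes T :: "'a::complex_hilbert \<Rightarrow>\<^sub>L 'a" and R c K :: real
  assumes "R > 1" and "c > -2"
    and "K = 1 + c / 2 + sqrt ((1 + c / 2)\<^sup>2 + 1 + \<bar>c\<bar>)"
  shows "(T \<in> DLA R c \<longrightarrow> K_spectral_set K (closure (annulus R)) T) \<and>
         (T \<in> CDLA R c \<longrightarrow> complete_K_spectral_set K (closure (annulus R)) T)"
proof -
  have "K = spectral_constant c" using assms(3) by (simp add: spectral_constant_def)
  then show ?thesis using DLA_K_spectral_set CDLA_complete_K_spectral_set assms(1,2) by blast
qed

end
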